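(* Let $G$ be a compact simple Lie group and let $H$ be a finitely normally generated group. If there is a group homomorphism $H\to G$ with dense image, then $H$ is not strongly bounded.
   Context: A Lie group is called simple if it is connected and its (real) Lie algebra is simple, i.e. non-abelian with no non-trivial ideals. A subset $S$ of a group $H$ normally generates $H$ if the normal subgroup of $H$ generated by $S$ is $H$; $H$ is finitely normally generated if some finite $S$ normally generates it. For such $S$, $\|h\|_S$ is the least $n\ge 0$ such that $h$ is a product of $n$ conjugates in $H$ of elements of $S$ and their inverses, and $\|H\|_S=\sup_{h\in H}\|h\|_S$. Set $\Delta_k(H)=\sup\{\|H\|_S : S \text{ normally generates } H,\ |S|\le k\}$ (with $\sup\emptyset=-\infty$). A finitely normally generated group $H$ is strongly bounded if $\Delta_k(H)<\infty$ for all $k\ge 1$. *)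

theory Defs
  imports "HOL-Analysis.Analysis" "HOL-Algebra.Coset"
begin

section \<open>Smooth manifolds\<close>

primrec times_cont_diff_on ::
  "nat \<Rightarrow> 'a::real_normed_vector set \<Rightarrow> ('a \<Rightarrow> 'b::real_normed_vector) \<Rightarrow> bool"
where
  "times_cont_diff_on 0 S f \<longleftrightarrow> continuous_on S f"
| "times_cont_diff_on (Suc n) S f \<longleftrightarrow>
     (\<forall>x\<in>S. f differentiable (at x)) \<and>
     (\<forall>v. times_cont_diff_on n S (\<lambda>x. frechet_derivative f (at x) v))"

text \<open>Smooth means of class \<open>C\<^sup>\<infinity>\<close>; this is only used for open sets \<open>S\<close>.\<close>

definition smooth_on :: "'a::real_normed_vector set \<Rightarrow> ('a \<Rightarrow> 'b::real_normed_vector) \<Rightarrow> bool" where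
  "smooth_on S f \<longleftrightarrow> (\<forall>n. times_cont_diff_on n S f)"

type_synonym ('a, 'e) atlas = "('a set \<times> ('a \<Rightarrow> 'e)) set"

definition chart_on :: "'a topology \<Rightarrow> 'a set \<Rightarrow> ('a \<Rightarrow> 'e::euclidean_space) \<Rightarrow> bool" where
  "chart_on X U \<phi> \<longleftrightarrow> openin X U \<and> open (\<phi> ` U) \<and>
     homeomorphic_map (subtopology X U) (top_of_set (\<phi> ` U)) \<phi>"

definition smooth_atlas :: "'a topology \<Rightarrow> ('a, 'e::euclidean_space) atlas \<Rightarrow> bool" where
  "smooth_atlas X A \<longleftrightarrow>
     (\<forall>(U, \<phi>)\<in>A. chart_on X U \<phi>) \<and>
     (\<Union>(U, \<phi>)\<in>A. U) = topspace X \<and>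
     (\<forall>(U, \<phi>)\<in>A. \<forall>(V, \<psi>)\<in>A. smooth_on (\<phi> ` (U \<inter> V)) (\<lambda>x. \<psi> (inv_into U \<phi> x)))"

definition second_countable_space :: "'a topology \<Rightarrow> bool" where
  "second_countable_space X \<longleftrightarrow>
     (\<exists>B. countable B \<and> (\<forall>V\<in>B. openin X V) \<and>
        (\<forall>U x. openin X U \<and> x \<in> U \<longrightarrow> (\<exists>V\<in>B. x \<in> V \<and> V \<subseteq> U)))"

definition smooth_manifold :: "'a topology \<Rightarrow> ('a, 'e::euclidean_space) atlas \<Rightarrow> bool" where
  "smooth_manifold X A \<longleftrightarrow> Hausdorff_space X \<and> second_countable_space X \<and> smooth_atlas X A"

definition smooth_map ::
  "'a topology \<Rightarrow> ('a, 'e::euclidean_space) atlas \<Rightarrow>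
   'b topology \<Rightarrow> ('b, 'f::euclidean_space) atlas \<Rightarrow> ('a \<Rightarrow> 'b) \<Rightarrow> bool" where
  "smooth_map X A Y B f \<longleftrightarrow> continuous_map X Y f \<and>
     (\<forall>(U, \<phi>)\<in>A. \<forall>(V, \<psi>)\<in>B.
        smooth_on (\<phi> ` (U \<inter> f -` V)) (\<lambda>x. \<psi> (f (inv_into U \<phi> x))))"

definition prod_atlas ::
  "('a, 'e) atlas \<Rightarrow> ('b, 'f) atlas \<Rightarrow> ('a \<times> 'b, 'e \<times> 'f) atlas" where
  "prod_atlas A B = {(U \<times> V, map_prod \<phi> \<psi>) |U \<phi> V \<psi>. (U, \<phi>) \<in> A \<and> (V, \<psi>) \<in> B}"


section \<open>Lie groups and their Lie algebras\<close>

text \<open>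
  A 0-dimensional Lie group has no atlas in this sense, since every Euclidean space type has positive
  dimension. Its Lie algebra is zero, hence not simple, so no simple Lie group is lost.
\<close>

definition lie_group ::
  "('a, 'm) monoid_scheme \<Rightarrow> 'a topology \<Rightarrow> ('a, 'e::euclidean_space) atlas \<Rightarrow> bool" where
  "lie_group G X A \<longleftrightarrow> group G \<and> topspace X = carrier G \<and> smooth_manifold X A \<and>
     smooth_map (prod_topology X X) (prod_atlas A A) X A (\<lambda>(x, y). x \<otimes>\<^bsub>G\<^esub> y) \<and>
     smooth_map X A X A (\<lambda>x. inv\<^bsub>G\<^esub> x)"

text \<open>
  The algebra \<open>C\<^sup>\<infinity>(M)\<close>. Its elements are total functions normalised to be 0 outside the manifold, so
  that equality of functions is equality on the manifold.
\<close>

definition smooth_functions ::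
  "'a topology \<Rightarrow> ('a, 'e::euclidean_space) atlas \<Rightarrow> ('a \<Rightarrow> real) set" where
  "smooth_functions X A =
     {f. smooth_map X A euclidean {(UNIV, \<lambda>x::real. x)} f \<and> (\<forall>x. x \<notin> topspace X \<longrightarrow> f x = 0)}"

text \<open>
  A smooth vector field is a derivation of \<open>C\<^sup>\<infinity>(M)\<close>, normalised to be 0 off \<open>C\<^sup>\<infinity>(M)\<close>, so that
  equality of such operators is equality of vector fields.
\<close>

definition vector_field ::
  "'a topology \<Rightarrow> ('a, 'e::euclidean_space) atlas \<Rightarrow> (('a \<Rightarrow> real) \<Rightarrow> 'a \<Rightarrow> real) \<Rightarrow> bool" where
  "vector_field X A D \<longleftrightarrow>
     (\<forall>f\<in>smooth_functions X A. D f \<in> smooth_functions X A) \<and>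
     (\<forall>f. f \<notin> smooth_functions X A \<longrightarrow> D f = (\<lambda>_. 0)) \<and>
     (\<forall>f\<in>smooth_functions X A. \<forall>g\<in>smooth_functions X A.
        D (\<lambda>x. f x + g x) = (\<lambda>x. D f x + D g x)) \<and>
     (\<forall>f\<in>smooth_functions X A. \<forall>c. D (\<lambda>x. c * f x) = (\<lambda>x. c * D f x)) \<and>
     (\<forall>f\<in>smooth_functions X A. \<forall>g\<in>smooth_functions X A.
        D (\<lambda>x. f x * g x) = (\<lambda>x. f x * D g x + g x * D f x))"

definition left_translate :: "('a, 'm) monoid_scheme \<Rightarrow> 'a \<Rightarrow> ('a \<Rightarrow> real) \<Rightarrow> 'a \<Rightarrow> real" where
  "left_translate G g f = (\<lambda>x. if x \<in> carrier G then f (g \<otimes>\<^bsub>G\<^esub> x) else 0)"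

text \<open>The real Lie algebra of \<open>G\<close> consists of the left-invariant vector fields, with the commutator bracket.\<close>

definition lie_algebra ::
  "('a, 'm) monoid_scheme \<Rightarrow> 'a topology \<Rightarrow> ('a, 'e::euclidean_space) atlas \<Rightarrow>
   (('a \<Rightarrow> real) \<Rightarrow> 'a \<Rightarrow> real) set" where
  "lie_algebra G X A =
     {D. vector_field X A D \<and>
         (\<forall>g\<in>carrier G. \<forall>f\<in>smooth_functions X A.
            D (left_translate G g f) = left_translate G g (D f))}"

definition lie_bracket ::
  "(('a \<Rightarrow> real) \<Rightarrow> 'a \<Rightarrow> real) \<Rightarrow> (('a \<Rightarrow> real) \<Rightarrow> 'a \<Rightarrow> real) \<Rightarrow> ('a \<Rightarrow> real) \<Rightarrow> 'a \<Rightarrow> real"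
where
  "lie_bracket D E = (\<lambda>f x. D (E f) x - E (D f) x)"

definition lie_ideal ::
  "(('a \<Rightarrow> real) \<Rightarrow> 'a \<Rightarrow> real) set \<Rightarrow> (('a \<Rightarrow> real) \<Rightarrow> 'a \<Rightarrow> real) set \<Rightarrow> bool" where
  "lie_ideal L I \<longleftrightarrow> I \<subseteq> L \<and> (\<lambda>f x. 0) \<in> I \<and>
     (\<forall>D\<in>I. \<forall>E\<in>I. (\<lambda>f x. D f x + E f x) \<in> I) \<and>
     (\<forall>c. \<forall>D\<in>I. (\<lambda>f x. c * D f x) \<in> I) \<and>
     (\<forall>D\<in>L. \<forall>E\<in>I. lie_bracket D E \<in> I)"

definition simple_lie_algebra :: "(('a \<Rightarrow> real) \<Rightarrow> 'a \<Rightarrow> real) set \<Rightarrow> bool" where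
  "simple_lie_algebra L \<longleftrightarrow>
     (\<exists>D\<in>L. \<exists>E\<in>L. lie_bracket D E \<noteq> (\<lambda>f x. 0)) \<and>
     (\<forall>I. lie_ideal L I \<longrightarrow> I = {\<lambda>f x. 0} \<or> I = L)"

definition simple_lie_group ::
  "('a, 'm) monoid_scheme \<Rightarrow> 'a topology \<Rightarrow> ('a, 'e::euclidean_space) atlas \<Rightarrow> bool" where
  "simple_lie_group G X A \<longleftrightarrow>
     lie_group G X A \<and> connected_space X \<and> simple_lie_algebra (lie_algebra G X A)"


section \<open>Normal generation and strong boundedness\<close>

definition normal_closure :: "('h, 'm) monoid_scheme \<Rightarrow> 'h set \<Rightarrow> 'h set" where
  "normal_closure H S = \<Inter>{N. N \<lhd> H \<and> S \<subseteq> N}"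

definition normally_generates :: "('h, 'm) monoid_scheme \<Rightarrow> 'h set \<Rightarrow> bool" where
  "normally_generates H S \<longleftrightarrow> S \<subseteq> carrier H \<and> normal_closure H S = carrier H"

definition finitely_normally_generated :: "('h, 'm) monoid_scheme \<Rightarrow> bool" where
  "finitely_normally_generated H \<longleftrightarrow> (\<exists>S. finite S \<and> normally_generates H S)"

definition conjugates :: "('h, 'm) monoid_scheme \<Rightarrow> 'h set \<Rightarrow> 'h set" where
  "conjugates H S =
     {x \<otimes>\<^bsub>H\<^esub> s \<otimes>\<^bsub>H\<^esub> inv\<^bsub>H\<^esub> x |x s. x \<in> carrier H \<and> s \<in> S \<union> (\<lambda>s. inv\<^bsub>H\<^esub> s) ` S}"

text \<open>Meaningful when \<open>S\<close> normally generates \<open>H\<close>, in which case such an \<open>n\<close> exists for every \<open>h\<close>.\<close>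

definition conj_length :: "('h, 'm) monoid_scheme \<Rightarrow> 'h set \<Rightarrow> 'h \<Rightarrow> nat" where
  "conj_length H S h =
     (LEAST n. \<exists>xs. length xs = n \<and> set xs \<subseteq> conjugates H S \<and> h = foldr (\<otimes>\<^bsub>H\<^esub>) xs \<one>\<^bsub>H\<^esub>)"

definition conj_diameter :: "('h, 'm) monoid_scheme \<Rightarrow> 'h set \<Rightarrow> ereal" where
  "conj_diameter H S = (SUP h\<in>carrier H. ereal (real (conj_length H S h)))"

text \<open>The supremum over the empty set in \<^typ>\<open>ereal\<close> is \<open>-\<infinity>\<close>.\<close>

definition Delta :: "nat \<Rightarrow> ('h, 'm) monoid_scheme \<Rightarrow> ereal" where
  "Delta k H = (SUP S\<in>{S. normally_generates H S \<and> finite S \<and> card S \<le> k}. conj_diameter H S)"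

definition strongly_bounded :: "('h, 'm) monoid_scheme \<Rightarrow> bool" where
  "strongly_bounded H \<longleftrightarrow>
     group H \<and> finitely_normally_generated H \<and> (\<forall>k\<ge>1. Delta k H < \<infinity>)"

end

theory Submission
  imports Defs "HOL-Algebra.Generated_Groups"
begin

text \<open>
  Let \<open>S\<close> be a finite normal generating set of \<open>H\<close> and \<open>B\<close> a neighbourhood of \<open>\<one>\<close> in \<open>G\<close>. Choose \<open>h\<close> with
  \<open>\<phi> h \<in> B\<close> not central, and let \<open>M\<close> be its normal closure in \<open>H\<close>. The closure of \<open>\<phi> M\<close> is a closed
  normal subgroup of \<open>G\<close>. It is not discrete, since a discrete normal subgroup of a connected group is
  central, hence it is all of \<open>G\<close>. So each \<open>s \<in> S\<close> can be corrected by some \<open>m\<^sub>s \<in> M\<close> to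
  \<open>\<phi> (s m\<^sub>s) \<in> B\<close>, and \<open>h\<close> together with the \<open>s m\<^sub>s\<close> normally generates \<open>H\<close>. This uses \<open>|S| + 1\<close>
  elements whatever \<open>B\<close> is, whereas products of boundedly many conjugates of elements of \<open>B\<close> and their
  inverses stay close to \<open>\<one>\<close> when \<open>B\<close> is small.

  That a closed normal subgroup \<open>N\<close> is discrete or all of \<open>G\<close> is shown without the exponential map. In a
  chart at \<open>\<one>\<close>, let \<open>\<Lambda>\<close> consist of the covectors \<open>z\<close> with \<open>z \<bullet> a = o(|a|)\<close> for \<open>a \<in> N\<close>, \<open>a \<rightarrow> 0\<close>. Its
  annihilator is invariant under \<open>Ad\<close>, so the corresponding left-invariant fields form an ideal. If the
  ideal is zero, then \<open>z \<bullet> a = o(|a|)\<close> for all \<open>z\<close>, and \<open>\<one>\<close> is isolated in \<open>N\<close>; if it is everything, then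
  \<open>\<Lambda> = 0\<close> and a nearest-point argument shows that \<open>N\<close> is a neighbourhood of \<open>\<one>\<close>.
\<close>

section \<open>Smooth functions on Euclidean spaces\<close>

text \<open>The Lie algebra consists of derivations of global smooth functions, while the ideals
  have to come from covectors in one chart. Bump functions and Hadamard's lemma bridge the gap:
  every left-invariant derivation is differentiation along one vector at \<open>\<one>\<close>, and
  the bracket becomes the derivative of \<open>Ad\<close>. Covectors take the place of one-parameter
  subgroups. The condition z \<bullet> a = o(|a|) is linear in z, so it gives a subspace at once,
  whereas limit directions of N would first have to be shown closed under addition. The price is
  that N must be recovered from its covectors. Simplicity enters twice: non-commutativity puts
  non-commuting pairs, hence non-central elements of a dense set, into every neighbourhood of
  \<open>\<one>\<close>, and the absence of ideals gives the dichotomy for closed normal subgroups.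
  Compactness makes conjugates of small elements uniformly small. The length bound for |S| + 1
  generators is fixed before the neighbourhood B is chosen; the image of H then misses a nonempty
  open set, against density.\<close>

lemma frechet_derivative_eqI:
  assumes "(f has_derivative f') (at x)"
  shows "frechet_derivative f (at x) = f'"
  using frechet_derivative_at[OF assms] by simp

text \<open>\<open>frechet_derivative\<close> chooses some derivative, so two functions with the
  same set of derivatives get the same choice, differentiable or not.\<close>

lemma frechet_derivative_cong_open:
  assumes "open S" "x \<in> S" "\<And>y. y \<in> S \<Longrightarrow> f y = g y"
  shows "frechet_derivative f (at x) = frechet_derivative g (at x)"
proof -
  have "(f has_derivative D) (at x) \<longleftrightarrow> (g has_derivative D) (at x)" for D
    using has_derivative_transform_within_open[of f D x UNIV S g]
      has_derivative_transform_within_open[of g D x UNIV S f] assms by auto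
  then show ?thesis unfolding frechet_derivative_def by simp
qed

lemma times_cont_diff_on_cong:
  assumes "open S" "\<And>x. x \<in> S \<Longrightarrow> f x = g x" "times_cont_diff_on n S f"
  shows "times_cont_diff_on n S g"
  using assms(2,3)
proof (induction n arbitrary: f g)
  case 0
  then show ?case using continuous_on_eq by auto
next
  case (Suc n)
  have "g differentiable (at x)" if "x \<in> S" for x
    using Suc.prems that assms(1) has_derivative_transform_within_open[of f _ x UNIV S g]
    unfolding differentiable_def times_cont_diff_on.simps by metis
  moreover have "times_cont_diff_on n S (\<lambda>x. frechet_derivative g (at x) v)" for v
    by (rule Suc.IH[of "\<lambda>x. frechet_derivative f (at x) v"])
      (use Suc.prems frechet_derivative_cong_open[OF assms(1), of _ f g] in auto)
  ultimately show ?case by simp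
qed

text \<open>Lets the inductions exhibit a derivative by a formula instead of handling the choice
  operator \<open>frechet_derivative\<close>.\<close>

lemma times_cont_diff_on_SucI:
  assumes "open S" "\<And>x. x \<in> S \<Longrightarrow> (f has_derivative f' x) (at x)"
    and "\<And>v. times_cont_diff_on n S (\<lambda>x. f' x v)"
  shows "times_cont_diff_on (Suc n) S f"
proof -
  have "times_cont_diff_on n S (\<lambda>x. frechet_derivative f (at x) v)" for v
    by (rule times_cont_diff_on_cong[OF assms(1) _ assms(3)[of v]])
      (use frechet_derivative_eqI[OF assms(2)] in auto)
  then show ?thesis using assms(2) by (auto simp: differentiable_def)
qed

lemma times_cont_diff_on_SucE:
  assumes "times_cont_diff_on (Suc n) S f"
  obtains f' where "\<And>x. x \<in> S \<Longrightarrow> (f has_derivative f' x) (at x)"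
    "\<And>v. times_cont_diff_on n S (\<lambda>x. f' x v)"
  by (rule that[of "\<lambda>x. frechet_derivative f (at x)"])
    (use assms frechet_derivative_works in auto)

lemma times_cont_diff_on_SucD:
  "times_cont_diff_on (Suc n) S f \<Longrightarrow> times_cont_diff_on n S f"
proof (induction n arbitrary: f)
  case 0
  then show ?case
    by (auto intro!: continuous_at_imp_continuous_on differentiable_imp_continuous_within)
next
  case (Suc n)
  then show ?case by simp
qed

lemma times_cont_diff_on_subset:
  "times_cont_diff_on n S f \<Longrightarrow> T \<subseteq> S \<Longrightarrow> times_cont_diff_on n T f"
  by (induction n arbitrary: f) (auto intro: continuous_on_subset)

lemma times_cont_diff_on_local:
  assumes "\<And>x. x \<in> S \<Longrightarrow> \<exists>T. open T \<and> x \<in> T \<and> times_cont_diff_on n T f"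
  shows "times_cont_diff_on n S f"
  using assms
proof (induction n arbitrary: f)
  case 0
  have "isCont f x" if "x \<in> S" for x
    using 0[OF that] continuous_on_eq_continuous_at by auto
  then show ?case by (simp add: continuous_at_imp_continuous_on)
next
  case (Suc n)
  have "f differentiable (at x)" if "x \<in> S" for x
    using Suc.prems[OF that] by auto
  moreover have "times_cont_diff_on n S (\<lambda>x. frechet_derivative f (at x) v)" for v
  proof (rule Suc.IH)
    fix x assume "x \<in> S"
    from Suc.prems[OF this] show
      "\<exists>T. open T \<and> x \<in> T \<and> times_cont_diff_on n T (\<lambda>x. frechet_derivative f (at x) v)"
      by auto
  qed
  ultimately show ?case by simp
qed

lemma times_cont_diff_on_const: "times_cont_diff_on n S (\<lambda>_. c)"
proof (induction n arbitrary: c)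
  case (Suc n)
  have "frechet_derivative (\<lambda>_. c) (at x) v = 0" for x v
    by (simp add: frechet_derivative_eqI)
  with Suc show ?case by simp
qed simp

lemma times_cont_diff_on_linear:
  assumes "bounded_linear L"
  shows "times_cont_diff_on n S L"
proof (cases n)
  case 0
  then show ?thesis using assms by (simp add: linear_continuous_on)
next
  case (Suc k)
  have "frechet_derivative L (at x) = L" for x
    by (intro frechet_derivative_eqI bounded_linear_imp_has_derivative assms)
  with Suc show ?thesis
    using assms by (simp add: times_cont_diff_on_const bounded_linear_imp_differentiable)
qed

lemma times_cont_diff_on_add:
  assumes "open S" "times_cont_diff_on n S f" "times_cont_diff_on n S g"
  shows "times_cont_diff_on n S (\<lambda>x. f x + g x)"
  using assms(2,3)
proof (induction n arbitrary: f g)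
  case 0
  then show ?case by (simp add: continuous_on_add)
next
  case (Suc n)
  obtain f' where f': "\<And>x. x \<in> S \<Longrightarrow> (f has_derivative f' x) (at x)"
    "\<And>v. times_cont_diff_on n S (\<lambda>x. f' x v)"
    using times_cont_diff_on_SucE[OF Suc.prems(1)] by blast
  obtain g' where g': "\<And>x. x \<in> S \<Longrightarrow> (g has_derivative g' x) (at x)"
    "\<And>v. times_cont_diff_on n S (\<lambda>x. g' x v)"
    using times_cont_diff_on_SucE[OF Suc.prems(2)] by blast
  show ?case
    by (rule times_cont_diff_on_SucI[OF assms(1), where f' = "\<lambda>x v. f' x v + g' x v"])
      (auto intro: has_derivative_add f' g' Suc.IH)
qed

text \<open>One product rule covers multiplication, inner product and scaling.
  \<open>times_cont_diff_on_SucD\<close> supplies the factor that stays undifferentiated.\<close>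

lemma times_cont_diff_on_bilinear:
  assumes "bounded_bilinear p" "open S" "times_cont_diff_on n S f" "times_cont_diff_on n S g"
  shows "times_cont_diff_on n S (\<lambda>x. p (f x) (g x))"
  using assms(3,4)
proof (induction n arbitrary: f g)
  case 0
  then show ?case by (simp add: bounded_bilinear.continuous_on[OF assms(1)])
next
  case (Suc n)
  obtain f' where f': "\<And>x. x \<in> S \<Longrightarrow> (f has_derivative f' x) (at x)"
    "\<And>v. times_cont_diff_on n S (\<lambda>x. f' x v)"
    using times_cont_diff_on_SucE[OF Suc.prems(1)] by blast
  obtain g' where g': "\<And>x. x \<in> S \<Longrightarrow> (g has_derivative g' x) (at x)"
    "\<And>v. times_cont_diff_on n S (\<lambda>x. g' x v)"
    using times_cont_diff_on_SucE[OF Suc.prems(2)] by blast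
  have "times_cont_diff_on n S f" "times_cont_diff_on n S g"
    using Suc.prems by (auto intro: times_cont_diff_on_SucD)
  then show ?case
    by (intro times_cont_diff_on_SucI[OF assms(2), where f' = "\<lambda>x v. p (f x) (g' x v) + p (f' x v) (g x)"])
      (auto intro!: bounded_bilinear.FDERIV[OF assms(1)] f' g' Suc.IH times_cont_diff_on_add assms(2))
qed

lemma times_cont_diff_on_sum:
  assumes "open S" "\<And>i. i \<in> I \<Longrightarrow> times_cont_diff_on n S (f i)"
  shows "times_cont_diff_on n S (\<lambda>x. \<Sum>i\<in>I. f i x)"
  using assms(2)
  by (induction I rule: infinite_finite_induct)
    (auto simp: times_cont_diff_on_const intro!: times_cont_diff_on_add[OF assms(1)])

lemma linear_eq_sum_Basis:
  fixes L :: "'a::euclidean_space \<Rightarrow> 'b::real_vector"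
  assumes "linear L"
  shows "L v = (\<Sum>i\<in>Basis. (v \<bullet> i) *\<^sub>R L i)"
proof -
  have "L v = L (\<Sum>i\<in>Basis. (v \<bullet> i) *\<^sub>R i)" by (simp add: euclidean_representation)
  then show ?thesis using assms by (simp add: linear_sum linear_scale)
qed

text \<open>The chain rule produces \<open>g' (f x) (f' x v)\<close>, whose direction varies with
  \<open>x\<close>, while the definition only controls fixed directions. Expanding in
  \<open>Basis\<close> gives products of scalar functions with derivatives in fixed directions, to
  which the induction hypothesis applies.\<close>

lemma times_cont_diff_on_compose:
  fixes f :: "'a::real_normed_vector \<Rightarrow> 'b::euclidean_space"
  assumes "open S" "times_cont_diff_on n S f" "times_cont_diff_on n T g" "f ` S \<subseteq> T"
  shows "times_cont_diff_on n S (\<lambda>x. g (f x))"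
  using assms(2,3)
proof (induction n arbitrary: g)
  case 0
  then show ?case using assms(4) continuous_on_compose2 by auto
next
  case (Suc n)
  obtain f' where f': "\<And>x. x \<in> S \<Longrightarrow> (f has_derivative f' x) (at x)"
    "\<And>v. times_cont_diff_on n S (\<lambda>x. f' x v)"
    using times_cont_diff_on_SucE[OF Suc.prems(1)] by blast
  obtain g' where g': "\<And>x. x \<in> T \<Longrightarrow> (g has_derivative g' x) (at x)"
    "\<And>v. times_cont_diff_on n T (\<lambda>x. g' x v)"
    using times_cont_diff_on_SucE[OF Suc.prems(2)] by blast
  have f: "times_cont_diff_on n S f" using Suc.prems by (auto intro: times_cont_diff_on_SucD)
  show ?case
  proof (rule times_cont_diff_on_SucI[OF assms(1)])
    fix x assume x: "x \<in> S"
    show "((\<lambda>x. g (f x)) has_derivative (\<lambda>v. \<Sum>i\<in>Basis. (f' x v \<bullet> i) *\<^sub>R g' (f x) i)) (at x)"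
    proof -
      have fx: "f x \<in> T" using x assms(4) by auto
      have "((\<lambda>x. g (f x)) has_derivative (\<lambda>v. g' (f x) (f' x v))) (at x)"
        using has_derivative_compose[OF f'(1)[OF x] g'(1)[OF fx]] .
      then show ?thesis
        by (subst (asm) linear_eq_sum_Basis[OF has_derivative_linear[OF g'(1)[OF fx]]])
    qed
  next
    fix v
    have "times_cont_diff_on n S (\<lambda>x. f' x v \<bullet> i)" for i
      using times_cont_diff_on_bilinear[OF bounded_bilinear_inner assms(1) f'(2) times_cont_diff_on_const] .
    then show "times_cont_diff_on n S (\<lambda>x. \<Sum>i\<in>Basis. (f' x v \<bullet> i) *\<^sub>R g' (f x) i)"
      by (intro times_cont_diff_on_sum assms(1)
          times_cont_diff_on_bilinear[OF bounded_bilinear_scaleR] Suc.IH[OF f g'(2)])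
  qed
qed

section \<open>Closure properties of smooth maps\<close>

lemma smooth_on_cong: "smooth_on S f \<Longrightarrow> open S \<Longrightarrow> (\<And>x. x \<in> S \<Longrightarrow> f x = g x) \<Longrightarrow> smooth_on S g"
  unfolding smooth_on_def using times_cont_diff_on_cong by blast

lemma smooth_on_subset: "smooth_on S f \<Longrightarrow> T \<subseteq> S \<Longrightarrow> smooth_on T f"
  unfolding smooth_on_def using times_cont_diff_on_subset by blast

lemma smooth_on_local:
  assumes "\<And>x. x \<in> S \<Longrightarrow> \<exists>T. open T \<and> x \<in> T \<and> smooth_on T f"
  shows "smooth_on S f"
  unfolding smooth_on_def
  by (intro allI times_cont_diff_on_local) (use assms smooth_on_def in blast)

lemma smooth_on_imp_continuous_on: "smooth_on S f \<Longrightarrow> continuous_on S f"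
  unfolding smooth_on_def by (metis times_cont_diff_on.simps(1))

lemma smooth_on_differentiable: "smooth_on S f \<Longrightarrow> x \<in> S \<Longrightarrow> f differentiable (at x)"
  unfolding smooth_on_def by (metis times_cont_diff_on.simps(2))

lemma smooth_on_has_derivative:
  "smooth_on S f \<Longrightarrow> x \<in> S \<Longrightarrow> (f has_derivative frechet_derivative f (at x)) (at x)"
  using smooth_on_differentiable frechet_derivative_works by blast

lemma smooth_on_frechet_derivative:
  "smooth_on S f \<Longrightarrow> smooth_on S (\<lambda>x. frechet_derivative f (at x) v)"
  unfolding smooth_on_def by (metis times_cont_diff_on.simps(2))

lemma smooth_on_const: "smooth_on S (\<lambda>_. c)"
  unfolding smooth_on_def by (simp add: times_cont_diff_on_const)

lemma smooth_on_linear: "bounded_linear L \<Longrightarrow> smooth_on S L"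
  unfolding smooth_on_def by (simp add: times_cont_diff_on_linear)

lemma smooth_on_id: "smooth_on S (\<lambda>x. x)"
  by (rule smooth_on_linear[OF bounded_linear_ident])

lemma smooth_on_add: "open S \<Longrightarrow> smooth_on S f \<Longrightarrow> smooth_on S g \<Longrightarrow> smooth_on S (\<lambda>x. f x + g x)"
  unfolding smooth_on_def by (simp add: times_cont_diff_on_add)

lemma smooth_on_bilinear:
  "bounded_bilinear p \<Longrightarrow> open S \<Longrightarrow> smooth_on S f \<Longrightarrow> smooth_on S g \<Longrightarrow> smooth_on S (\<lambda>x. p (f x) (g x))"
  unfolding smooth_on_def by (simp add: times_cont_diff_on_bilinear)

lemmas smooth_on_mult = smooth_on_bilinear[OF bounded_bilinear_mult]
lemmas smooth_on_inner = smooth_on_bilinear[OF bounded_bilinear_inner]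

lemma smooth_on_compose:
  fixes f :: "'a::real_normed_vector \<Rightarrow> 'b::euclidean_space"
  shows "open S \<Longrightarrow> smooth_on S f \<Longrightarrow> smooth_on T g \<Longrightarrow> f ` S \<subseteq> T \<Longrightarrow> smooth_on S (\<lambda>x. g (f x))"
  unfolding smooth_on_def by (blast intro: times_cont_diff_on_compose)

lemma smooth_on_diff:
  assumes "open S" "smooth_on S f" "smooth_on S g"
  shows "smooth_on S (\<lambda>x. f x - g x)"
  using smooth_on_add[OF assms(1,2)
      smooth_on_bilinear[OF bounded_bilinear_scaleR assms(1) smooth_on_const[of S "-1"] assms(3)]]
  by simp

lemma smooth_on_Pair:
  fixes f :: "'a::real_normed_vector \<Rightarrow> 'b::euclidean_space" and g :: "'a \<Rightarrow> 'c::euclidean_space"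
  assumes "open S" "smooth_on S f" "smooth_on S g"
  shows "smooth_on S (\<lambda>x. (f x, g x))"
proof -
  have "smooth_on S (\<lambda>x. (f x, 0) + (0, g x))"
    by (intro smooth_on_add assms smooth_on_compose[OF assms(1,2), where T = UNIV and g = "\<lambda>y. (y, 0)"]
        smooth_on_compose[OF assms(1,3), where T = UNIV and g = "Pair 0"] smooth_on_linear
        bounded_linear_Pair bounded_linear_ident bounded_linear_zero) auto
  then show ?thesis by simp
qed

text \<open>The mean value theorem in direction \<open>v\<close>, applied to the difference of
  \<open>f\<close> on two parallel segments, leaves a difference of values of \<open>f' y v\<close>;
  its differentiability at \<open>x\<close> then extracts \<open>F w\<close>.\<close>

lemma second_difference_tendsto:
  fixes f :: "'a::real_normed_vector \<Rightarrow> real"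
  assumes S: "open S" "x \<in> S" and f': "\<And>y. y \<in> S \<Longrightarrow> (f has_derivative f' y) (at y)"
    and F: "((\<lambda>y. f' y v) has_derivative F) (at x)"
  shows "((\<lambda>t. (f (x + t *\<^sub>R v + t *\<^sub>R w) - f (x + t *\<^sub>R v) - f (x + t *\<^sub>R w) + f x) / t\<^sup>2) \<longlongrightarrow> F w)
    (at_right 0)"
proof (rule tendstoI)
  fix e :: real assume e: "0 < e"
  \<comment> \<open>The two remainder estimates below add up to
    \<open>e / (2 * K) * (t * (2 * norm v + norm w))\<close>, so this \<open>K\<close> brings the
    total under \<open>t * (e / 2)\<close>. The summand 1 keeps \<open>K\<close> positive when
    \<open>v\<close> and \<open>w\<close> vanish.\<close>
  define K where "K = 2 * norm v + norm w + 1"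
  have K: "K > 0" by (simp add: K_def add_nonneg_pos)
  obtain r where r: "r > 0" "ball x r \<subseteq> S" using S openE by blast
  have "\<exists>d>0. \<forall>y. norm (y - x) < d \<longrightarrow> norm (f' y v - f' x v - F (y - x)) \<le> e / (2 * K) * norm (y - x)"
    using F e K unfolding has_derivative_at_alt by (metis divide_pos_pos mult_pos_pos zero_less_numeral)
  then obtain d where d: "d > 0"
    "\<And>y. norm (y - x) < d \<Longrightarrow> norm (f' y v - f' x v - F (y - x)) \<le> e / (2 * K) * norm (y - x)"
    by blast
  have linF: "linear F" using F has_derivative_linear by blast
  define t0 where "t0 = min r d / K"
  have t0: "t0 > 0" using r d K by (simp add: t0_def)
  have main: "dist ((f (x + t *\<^sub>R v + t *\<^sub>R w) - f (x + t *\<^sub>R v) - f (x + t *\<^sub>R w) + f x) / t\<^sup>2) (F w) < e"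
    if t: "0 < t" "t < t0" for t
  proof -
    have tK: "t * K < r" "t * K < d"
      using t K by (simp_all add: t0_def field_simps)
    have small: "norm (s *\<^sub>R v + u *\<^sub>R w) \<le> t * (norm v + norm w)" if "0 \<le> s" "s \<le> t" "0 \<le> u" "u \<le> t" for s u
    proof -
      have "norm (s *\<^sub>R v + u *\<^sub>R w) \<le> s * norm v + u * norm w"
        using norm_triangle_ineq[of "s *\<^sub>R v" "u *\<^sub>R w"] that by simp
      also have "\<dots> \<le> t * norm v + t * norm w"
        using that by (intro add_mono mult_right_mono) auto
      finally show ?thesis by (simp add: algebra_simps)
    qed
    have Kb: "t * (norm v + norm w) < t * K" using t by (simp add: K_def add_nonneg_pos)
    have inS: "x + s *\<^sub>R v + u *\<^sub>R w \<in> S" if "0 \<le> s" "s \<le> t" "0 \<le> u" "u \<le> t" for s u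
    proof -
      have "norm (s *\<^sub>R v + u *\<^sub>R w) < r"
        using small[OF that] Kb tK by linarith
      then have "dist (x + s *\<^sub>R v + u *\<^sub>R w) x < r" by (simp add: dist_norm)
      then have "dist x (x + s *\<^sub>R v + u *\<^sub>R w) < r" by (simp add: dist_commute)
      then show ?thesis using r by auto
    qed
    define g where "g s = f (x + s *\<^sub>R v + t *\<^sub>R w) - f (x + s *\<^sub>R v)" for s
    have "\<exists>z. 0 < z \<and> z < t \<and> g t - g 0 = (t - 0) * (f' (x + z *\<^sub>R v + t *\<^sub>R w) v - f' (x + z *\<^sub>R v) v)"
    proof (rule MVT2)
      show "0 < t" by fact
      fix s assume s: "0 \<le> s" "s \<le> t"
      have 1: "x + s *\<^sub>R v + t *\<^sub>R w \<in> S" "x + s *\<^sub>R v \<in> S" using inS[of s t] inS[of s 0] s t by auto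
      have "(g has_derivative (\<lambda>h. f' (x + s *\<^sub>R v + t *\<^sub>R w) (h *\<^sub>R v) - f' (x + s *\<^sub>R v) (h *\<^sub>R v))) (at s)"
        unfolding g_def
        by (intro has_derivative_diff has_derivative_compose[OF _ f'] 1)
          (auto intro!: derivative_eq_intros)
      moreover have "linear (f' (x + s *\<^sub>R v + t *\<^sub>R w))" "linear (f' (x + s *\<^sub>R v))"
        using f' 1 has_derivative_linear by blast+
      ultimately show "(g has_real_derivative (f' (x + s *\<^sub>R v + t *\<^sub>R w) v - f' (x + s *\<^sub>R v) v)) (at s)"
        by (rule_tac has_derivative_imp_has_field_derivative) (auto simp: linear_scale right_diff_distrib)
    qed
    then obtain z where z: "0 < z" "z < t"
      "g t - g 0 = t * (f' (x + z *\<^sub>R v + t *\<^sub>R w) v - f' (x + z *\<^sub>R v) v)" by auto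
    have A: "norm (f' (x + z *\<^sub>R v + u *\<^sub>R w) v - f' x v - F (z *\<^sub>R v + u *\<^sub>R w))
         \<le> e / (2 * K) * norm (z *\<^sub>R v + u *\<^sub>R w)" if u: "0 \<le> u" "u \<le> t" for u
    proof -
      have "norm (z *\<^sub>R v + u *\<^sub>R w) < d" using small[of z u] z u Kb tK by linarith
      then show ?thesis using d(2)[of "x + z *\<^sub>R v + u *\<^sub>R w"] by (simp add: add.assoc)
    qed
    have A1: "\<bar>f' (x + z *\<^sub>R v + t *\<^sub>R w) v - f' x v - (z * F v + t * F w)\<bar> \<le> e / (2 * K) * (t * (norm v + norm w))"
    proof -
      have "\<bar>f' (x + z *\<^sub>R v + t *\<^sub>R w) v - f' x v - (z * F v + t * F w)\<bar> \<le> e / (2 * K) * norm (z *\<^sub>R v + t *\<^sub>R w)"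
        using A[of t] t by (simp add: linear_add[OF linF] linear_scale[OF linF])
      also have "\<dots> \<le> e / (2 * K) * (t * (norm v + norm w))"
        using small[of z t] z t e K by (intro mult_left_mono) auto
      finally show ?thesis .
    qed
    have nz: "norm (z *\<^sub>R v) \<le> t * norm v" using z by (simp add: mult_right_mono)
    have A2: "\<bar>f' (x + z *\<^sub>R v) v - f' x v - z * F v\<bar> \<le> e / (2 * K) * (t * norm v)"
    proof -
      have "\<bar>f' (x + z *\<^sub>R v) v - f' x v - z * F v\<bar> \<le> e / (2 * K) * norm (z *\<^sub>R v)"
        using A[of 0] t by (simp add: linear_scale[OF linF])
      also have "\<dots> \<le> e / (2 * K) * (t * norm v)"
        using nz e K by (intro mult_left_mono) auto
      finally show ?thesis .
    qed
    have "\<bar>f' (x + z *\<^sub>R v + t *\<^sub>R w) v - f' (x + z *\<^sub>R v) v - t * F w\<bar>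
      \<le> e / (2 * K) * (t * (norm v + norm w)) + e / (2 * K) * (t * norm v)"
      using A1 A2 by linarith
    also have "\<dots> = e / (2 * K) * (t * (2 * norm v + norm w))" by (simp add: algebra_simps)
    also have "\<dots> \<le> e / (2 * K) * (t * K)"
      using e K t by (intro mult_left_mono) (auto simp: K_def)
    also have "\<dots> = t * (e / 2)" using K by simp
    finally have "\<bar>(g t - g 0) / t - t * F w\<bar> \<le> t * (e / 2)" using z t by simp
    moreover have "(g t - g 0) / t - t * F w = t * ((g t - g 0) / t / t - F w)"
      using t by (simp add: field_simps)
    ultimately have "t * \<bar>(g t - g 0) / t / t - F w\<bar> \<le> t * (e / 2)"
      using t by (simp add: abs_mult)
    then have "\<bar>(g t - g 0) / t / t - F w\<bar> \<le> e / 2" using t mult_le_cancel_left_pos by blast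
    then have "\<bar>(g t - g 0) / t\<^sup>2 - F w\<bar> < e" using e by (simp add: power2_eq_square)
    then show ?thesis by (simp add: dist_real_def g_def algebra_simps)
  qed
  show "\<forall>\<^sub>F t in at_right 0. dist ((f (x + t *\<^sub>R v + t *\<^sub>R w) - f (x + t *\<^sub>R v) - f (x + t *\<^sub>R w) + f x) / t\<^sup>2) (F w) < e"
    unfolding eventually_at_right_field using main t0 by blast
qed

text \<open>The second difference quotient is symmetric in \<open>v\<close> and \<open>w\<close>, so
  its two limits agree. The argument is componentwise because the mean value theorem needs real
  values.\<close>

lemma second_derivative_symmetric:
  fixes f :: "'a::real_normed_vector \<Rightarrow> 'b::euclidean_space"
  assumes S: "open S" "x \<in> S" "smooth_on S f"
  shows "frechet_derivative (\<lambda>y. frechet_derivative f (at y) v) (at x) w =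
         frechet_derivative (\<lambda>y. frechet_derivative f (at y) w) (at x) v"
proof (rule euclidean_eqI)
  fix i :: 'b assume "i \<in> Basis"
  have f': "((\<lambda>y. f y \<bullet> i) has_derivative (\<lambda>u. frechet_derivative f (at y) u \<bullet> i)) (at y)"
    if "y \<in> S" for y
    using smooth_on_has_derivative[OF S(3) that] by (rule has_derivative_inner_left)
  have F: "((\<lambda>y. frechet_derivative f (at y) v \<bullet> i) has_derivative
     (\<lambda>u. frechet_derivative (\<lambda>y. frechet_derivative f (at y) v) (at x) u \<bullet> i)) (at x)" for v
    using smooth_on_has_derivative[OF smooth_on_frechet_derivative[OF S(3)] S(2)]
    by (rule has_derivative_inner_left)
  have "((\<lambda>t. (f (x + t *\<^sub>R w + t *\<^sub>R v) \<bullet> i - f (x + t *\<^sub>R w) \<bullet> i - f (x + t *\<^sub>R v) \<bullet> i + f x \<bullet> i) / t\<^sup>2)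
     \<longlongrightarrow> frechet_derivative (\<lambda>y. frechet_derivative f (at y) v) (at x) w \<bullet> i) (at_right 0)"
    using second_difference_tendsto[OF S(1,2) f' F, of v w]
    by (simp add: algebra_simps)
  from tendsto_unique[OF _ this second_difference_tendsto[OF S(1,2) f' F, of w v]]
  show "frechet_derivative (\<lambda>y. frechet_derivative f (at y) v) (at x) w \<bullet> i =
     frechet_derivative (\<lambda>y. frechet_derivative f (at y) w) (at x) v \<bullet> i"
    by simp
qed

text \<open>The product rule when both the base point and the argument of a derivative move. It
  serves to differentiate a vector field applied to a function, and the relation that defines
  conjugation.\<close>

lemma has_derivative_frechet_apply:
  fixes f :: "'a::euclidean_space \<Rightarrow> 'b::real_normed_vector" and \<gamma> y :: "'c::real_normed_vector \<Rightarrow> 'a"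
  assumes S: "smooth_on S f" "open S" "\<gamma> x \<in> S"
    and \<gamma>: "(\<gamma> has_derivative \<gamma>') (at x)" and y: "(y has_derivative y') (at x)"
  shows "((\<lambda>a. frechet_derivative f (at (\<gamma> a)) (y a)) has_derivative
     (\<lambda>h. frechet_derivative f (at (\<gamma> x)) (y' h) +
        frechet_derivative (\<lambda>z. frechet_derivative f (at z) (y x)) (at (\<gamma> x)) (\<gamma>' h))) (at x)"
proof -
  let ?D = "\<lambda>z. frechet_derivative f (at z)"
  have lin: "linear (?D z)" if "z \<in> S" for z
    using smooth_on_has_derivative[OF S(1) that] has_derivative_linear by blast
  have D2: "((\<lambda>z. ?D z v) has_derivative frechet_derivative (\<lambda>z. ?D z v) (at (\<gamma> x))) (at (\<gamma> x))" for v
    by (rule smooth_on_has_derivative[OF smooth_on_frechet_derivative[OF S(1)] S(3)])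
  have sum2: "((\<lambda>z. ?D z v) has_derivative (\<lambda>u. \<Sum>i\<in>Basis. (v \<bullet> i) *\<^sub>R frechet_derivative (\<lambda>z. ?D z i) (at (\<gamma> x)) u)) (at (\<gamma> x))" for v
  proof (rule has_derivative_transform_within_open[OF _ S(2,3)])
    show "((\<lambda>z. \<Sum>i\<in>Basis. (v \<bullet> i) *\<^sub>R ?D z i) has_derivative (\<lambda>u. \<Sum>i\<in>Basis. (v \<bullet> i) *\<^sub>R frechet_derivative (\<lambda>z. ?D z i) (at (\<gamma> x)) u)) (at (\<gamma> x))"
      by (intro has_derivative_sum has_derivative_scaleR_right D2)
  qed (simp add: linear_eq_sum_Basis[OF lin, symmetric])
  \<comment> \<open>Linearity of the second derivative in its inner direction; it folds the sum over
    the basis back into one term with direction \<open>y x\<close>.\<close>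
  have eq2: "frechet_derivative (\<lambda>z. ?D z v) (at (\<gamma> x)) u = (\<Sum>i\<in>Basis. (v \<bullet> i) *\<^sub>R frechet_derivative (\<lambda>z. ?D z i) (at (\<gamma> x)) u)" for v u
    using frechet_derivative_eqI[OF sum2] by metis
  have cont: "continuous (at x) \<gamma>" using \<gamma> has_derivative_continuous by blast
  obtain U where U: "open U" "x \<in> U" "\<gamma> ` U \<subseteq> S"
    using cont S(2,3) unfolding continuous_at_open by (metis image_subsetI)
  have "((\<lambda>a. \<Sum>i\<in>Basis. (y a \<bullet> i) *\<^sub>R ?D (\<gamma> a) i) has_derivative
     (\<lambda>h. \<Sum>i\<in>Basis. (y x \<bullet> i) *\<^sub>R frechet_derivative (\<lambda>z. ?D z i) (at (\<gamma> x)) (\<gamma>' h) + (y' h \<bullet> i) *\<^sub>R ?D (\<gamma> x) i)) (at x)"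
    by (intro has_derivative_sum has_derivative_scaleR has_derivative_inner_left y
        has_derivative_compose[OF \<gamma> D2])
  then have "((\<lambda>a. \<Sum>i\<in>Basis. (y a \<bullet> i) *\<^sub>R ?D (\<gamma> a) i) has_derivative
     (\<lambda>h. ?D (\<gamma> x) (y' h) + frechet_derivative (\<lambda>z. ?D z (y x)) (at (\<gamma> x)) (\<gamma>' h))) (at x)"
    by (simp add: sum.distrib eq2[of "y x"] linear_eq_sum_Basis[OF lin[OF S(3)], of "y' _"] add.commute)
  then show ?thesis
    by (rule has_derivative_transform_within_open[OF _ U(1,2)])
      (use U(3) in \<open>auto simp: linear_eq_sum_Basis[OF lin, symmetric]\<close>)
qed

section \<open>Hadamard's lemma and bump functions\<close>

text \<open>The powers of \<open>t\<close> make the family closed under differentiation in \<open>x\<close>.\<close>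

lemma times_cont_diff_on_radial_integral:
  fixes F :: "'a::euclidean_space \<Rightarrow> real"
  assumes "times_cont_diff_on n (ball 0 r) F"
  shows "times_cont_diff_on n (ball 0 r) (\<lambda>x. integral {0..1} (\<lambda>t. t ^ k * F (t *\<^sub>R x)))"
  using assms
proof (induction n arbitrary: F k)
  have sc: "t *\<^sub>R x \<in> ball 0 r" if "x \<in> ball 0 r" "t \<in> {0..1}" for x :: 'a and t :: real
    using that mult_right_mono[of t 1 "norm x"] by auto
  have cont: "continuous_on (ball 0 r \<times> {0..1}) (\<lambda>(x, t). t ^ k * F (t *\<^sub>R x))"
    if "continuous_on (ball 0 r) F" for F :: "'a \<Rightarrow> real" and k
    unfolding split_beta
    by (intro continuous_intros continuous_on_compose2[OF that]) (use sc in auto)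
  {
    case 0
    then show ?case
      using integral_continuous_on_param[of "ball 0 r" 0 1 "\<lambda>x t. t ^ k * F (t *\<^sub>R x)"] cont by simp
  next
    case (Suc n)
    obtain F' where F': "\<And>x. x \<in> ball 0 r \<Longrightarrow> (F has_derivative F' x) (at x)"
      "\<And>v. times_cont_diff_on n (ball 0 r) (\<lambda>x. F' x v)"
      using times_cont_diff_on_SucE[OF Suc.prems] by blast
    have contF: "continuous_on (ball 0 r) F"
      by (rule continuous_at_imp_continuous_on) (use has_derivative_continuous[OF F'(1)] in auto)
    have contF': "continuous_on (ball 0 r) (\<lambda>x. F' x v)" for v
    proof (cases n)
      case 0 then show ?thesis using F'(2)[of v] by simp
    next
      case (Suc m)
      then show ?thesis using F'(2)[of v]
        by (auto intro!: continuous_at_imp_continuous_on differentiable_imp_continuous_within)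
    qed
    \<comment> \<open>\<open>leibniz_rule\<close> takes the derivative as an element of the space of
      bounded linear maps. \<open>Blinfun\<close> gives a meaningful value only where the map is
      bounded linear, so \<open>B\<close> is evaluated only on the ball times
      \<open>{0..1}\<close>.\<close>
    define B where "B x t = Blinfun (\<lambda>v. t ^ Suc k * F' (t *\<^sub>R x) v)" for x and t :: real
    have bl: "bounded_linear (\<lambda>v. t ^ Suc k * F' (t *\<^sub>R x) v)" if "x \<in> ball 0 r" "t \<in> {0..1}" for x t
      by (intro bounded_linear_compose[OF bounded_linear_mult_right]
          has_derivative_bounded_linear[OF F'(1)[OF sc[OF that]]])
    have B: "blinfun_apply (B x t) v = t ^ Suc k * F' (t *\<^sub>R x) v" if "x \<in> ball 0 r" "t \<in> {0..1}" for x t v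
      unfolding B_def by (subst bounded_linear_Blinfun_apply) (use bl[OF that] in auto)
    have contB: "continuous_on (ball 0 r \<times> {0..1}) (\<lambda>(x, t). B x t)"
    proof (rule continuous_on_blinfun_componentwise)
      fix i :: 'a
      show "continuous_on (ball 0 r \<times> {0..1}) (\<lambda>p. blinfun_apply (case p of (x, t) \<Rightarrow> B x t) i)"
        by (rule continuous_on_eq[OF cont[OF contF', of "Suc k" i]]) (auto simp: B)
    qed
    have der: "((\<lambda>x. t ^ k * F (t *\<^sub>R x)) has_derivative blinfun_apply (B x t)) (at x within ball 0 r)"
      if "x \<in> ball 0 r" "t \<in> {0..1}" for x t
    proof -
      have lin: "linear (F' (t *\<^sub>R x))" using F'(1)[OF sc[OF that]] has_derivative_linear by blast
      have "((\<lambda>x. t ^ k * F (t *\<^sub>R x)) has_derivative (\<lambda>v. t ^ k * F' (t *\<^sub>R x) (t *\<^sub>R v))) (at x)"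
        by (intro has_derivative_mult_right has_derivative_compose[where f = "\<lambda>x. t *\<^sub>R x", OF _ F'(1)[OF sc[OF that]]])
          (auto intro!: derivative_eq_intros)
      then have "((\<lambda>x. t ^ k * F (t *\<^sub>R x)) has_derivative (\<lambda>v. blinfun_apply (B x t) v)) (at x)"
        by (simp add: B[OF that] linear_scale[OF lin] mult_ac)
      then show ?thesis by (rule has_derivative_at_withinI)
    qed
    show ?case
    proof (rule times_cont_diff_on_SucI)
      fix x assume x: "x \<in> ball (0::'a) r"
      have "((\<lambda>x. integral (cbox 0 1) (\<lambda>t. t ^ k * F (t *\<^sub>R x))) has_derivative
          blinfun_apply (integral (cbox 0 1) (B x))) (at x within ball 0 r)"
      proof (rule leibniz_rule)
        show "(\<lambda>t. t ^ k * F (t *\<^sub>R y)) integrable_on cbox 0 1" if "y \<in> ball 0 r" for y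
          unfolding cbox_interval
          by (intro integrable_continuous_real continuous_intros continuous_on_compose2[OF contF])
            (use sc[OF that] in auto)
        show "((\<lambda>y. t ^ k * F (t *\<^sub>R y)) has_derivative blinfun_apply (B y t)) (at y within ball 0 r)"
          if "y \<in> ball 0 r" "t \<in> cbox 0 1" for y t
          using der[of y t] that by (simp only: cbox_interval)
        show "continuous_on (ball 0 r \<times> cbox 0 1) (\<lambda>(x, t). B x t)"
          using contB by (simp only: cbox_interval)
      qed (use x in auto)
      moreover have "blinfun_apply (integral (cbox 0 1) (B x)) =
          (\<lambda>v. integral {0..1} (\<lambda>t. t ^ Suc k * F' (t *\<^sub>R x) v))"
      proof
        fix v
        have "B x integrable_on cbox 0 1"
          unfolding cbox_interval
          by (rule integrable_continuous_real, rule continuous_on_compose2[OF contB, where f = "Pair x", simplified])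
            (use x in \<open>auto intro!: continuous_intros\<close>)
        then have "blinfun_apply (integral (cbox 0 1) (B x)) v = integral (cbox 0 1) (\<lambda>t. blinfun_apply (B x t) v)"
          by (rule blinfun_apply_integral)
        also have "\<dots> = integral {0..1} (\<lambda>t. t ^ Suc k * F' (t *\<^sub>R x) v)"
          unfolding cbox_interval using x B by (intro integral_cong) auto
        finally show "blinfun_apply (integral (cbox 0 1) (B x)) v =
          integral {0..1} (\<lambda>t. t ^ Suc k * F' (t *\<^sub>R x) v)" .
      qed
      ultimately show "((\<lambda>x. integral {0..1} (\<lambda>t. t ^ k * F (t *\<^sub>R x))) has_derivative
          (\<lambda>v. integral {0..1} (\<lambda>t. t ^ Suc k * F' (t *\<^sub>R x) v))) (at x)"
        using at_within_open[OF x] by (simp only: cbox_interval open_ball)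
    next
      fix v
      show "times_cont_diff_on n (ball 0 r) (\<lambda>x. integral {0..1} (\<lambda>t. t ^ Suc k * F' (t *\<^sub>R x) v))"
        by (rule Suc.IH[OF F'(2)])
    qed simp
  }
qed

text \<open>Integrate the derivative of \<open>f\<close> along the segment from \<open>0\<close> to
  \<open>x\<close>. The \<open>g i\<close> are the integrals of the partial derivatives; at
  \<open>x = 0\<close> the integrand is constant.\<close>

lemma hadamard:
  fixes f :: "'a::euclidean_space \<Rightarrow> real"
  assumes f: "smooth_on (ball 0 r) f" and r: "r > 0"
  obtains g where "\<And>i. smooth_on (ball 0 r) (g i)"
    "\<And>i. g i 0 = frechet_derivative f (at 0) i"
    "\<And>x. x \<in> ball 0 r \<Longrightarrow> f x = f 0 + (\<Sum>i\<in>Basis. (x \<bullet> i) * g i x)"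
proof
  define g where "g i x = integral {0..1} (\<lambda>t. frechet_derivative f (at (t *\<^sub>R x)) i)" for i x
  show "smooth_on (ball 0 r) (g i)" for i
    using times_cont_diff_on_radial_integral[where k = 0] smooth_on_frechet_derivative[OF f]
    unfolding smooth_on_def g_def by (metis (no_types, lifting) ext mult_1 power_0)
  show "g i 0 = frechet_derivative f (at 0) i" for i by (simp add: g_def)
  fix x :: 'a assume x: "x \<in> ball 0 r"
  have sc: "t *\<^sub>R x \<in> ball 0 r" if "t \<in> {0..1}" for t :: real
    using that x mult_right_mono[of t 1 "norm x"] by auto
  have lin: "linear (frechet_derivative f (at (t *\<^sub>R x)))" if "t \<in> {0..1}" for t
    using smooth_on_has_derivative[OF f sc[OF that]] has_derivative_linear by blast
  have "((\<lambda>t. f (t *\<^sub>R x)) has_vector_derivative frechet_derivative f (at (t *\<^sub>R x)) x) (at t within {0..1})"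
    if "t \<in> {0..1}" for t
  proof -
    have "((\<lambda>t. f (t *\<^sub>R x)) has_derivative (\<lambda>h. frechet_derivative f (at (t *\<^sub>R x)) (h *\<^sub>R x))) (at t within {0..1})"
      by (rule has_derivative_compose[where f = "\<lambda>t. t *\<^sub>R x", OF _ smooth_on_has_derivative[OF f sc[OF that]]])
        (auto intro!: derivative_eq_intros)
    then show ?thesis
      unfolding has_vector_derivative_def using lin[OF that] by (simp add: linear_scale)
  qed
  then have "((\<lambda>t. frechet_derivative f (at (t *\<^sub>R x)) x) has_integral f (1 *\<^sub>R x) - f (0 *\<^sub>R x)) {0..1}"
    by (intro fundamental_theorem_of_calculus) auto
  then have "f x - f 0 = integral {0..1} (\<lambda>t. frechet_derivative f (at (t *\<^sub>R x)) x)"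
    by (simp add: integral_unique)
  also have "\<dots> = integral {0..1} (\<lambda>t. \<Sum>i\<in>Basis. (x \<bullet> i) * frechet_derivative f (at (t *\<^sub>R x)) i)"
    by (intro integral_cong) (use linear_eq_sum_Basis[OF lin] in auto)
  also have "\<dots> = (\<Sum>i\<in>Basis. integral {0..1} (\<lambda>t. (x \<bullet> i) * frechet_derivative f (at (t *\<^sub>R x)) i))"
  proof (intro integral_sum)
    fix i :: 'a
    show "(\<lambda>t. (x \<bullet> i) * frechet_derivative f (at (t *\<^sub>R x)) i) integrable_on {0..1}"
      by (intro integrable_continuous_real continuous_intros
          continuous_on_compose2[OF smooth_on_imp_continuous_on[OF smooth_on_frechet_derivative[OF f]]])
        (use sc in auto)
  qed simp
  finally show "f x = f 0 + (\<Sum>i\<in>Basis. (x \<bullet> i) * g i x)" by (simp add: g_def)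
qed

text \<open>The flat function exp(-1/t), continued by 0 to the left. The powers of 1/t make the
  family closed under differentiation up to linear combinations.\<close>

definition flat_exp :: "nat \<Rightarrow> real \<Rightarrow> real" where
  "flat_exp k t = (if t > 0 then inverse t ^ k * exp (- inverse t) else 0)"

lemma flat_exp_has_derivative:
  "(flat_exp k has_real_derivative flat_exp (k + 2) t - real k * flat_exp (k + 1) t) (at t)"
proof -
  consider "t > 0" | "t < 0" | "t = 0" by linarith
  then show ?thesis
  proof cases
    case 1
    have "((\<lambda>u. u ^ k * exp (- u)) has_real_derivative
        real k * u ^ (k - 1) * exp (- u) - u ^ k * exp (- u)) (at u)" for u :: real
      by (auto intro!: derivative_eq_intros)
    from DERIV_chain2[OF this DERIV_inverse[of t]]
    have "((\<lambda>t. inverse t ^ k * exp (- inverse t)) has_real_derivative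
        flat_exp (k + 2) t - real k * flat_exp (k + 1) t) (at t)"
      using 1 by (cases k) (auto simp: flat_exp_def power2_eq_square algebra_simps)
    then show ?thesis
      by (rule has_field_derivative_transform_within_open[where S = "{0<..}"])
        (use 1 in \<open>auto simp: flat_exp_def\<close>)
  next
    case 2
    have "((\<lambda>t. 0) has_real_derivative 0) (at t)" by simp
    then have "(flat_exp k has_real_derivative 0) (at t)"
      by (rule has_field_derivative_transform_within_open[where S = "{..<0}"])
        (use 2 in \<open>auto simp: flat_exp_def\<close>)
    then show ?thesis using 2 by (simp add: flat_exp_def)
  next
    case 3
    \<comment> \<open>With u = 1/h this says that u^(k+1) / exp u tends to 0; the extra power comes
      from the difference quotient.\<close>
    have "((\<lambda>h. inverse h ^ Suc k * exp (- inverse h)) \<longlongrightarrow> 0) (at_right (0::real))"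
      using filterlim_compose[OF tendsto_power_div_exp_0[of "Suc k"] filterlim_inverse_at_top_right]
      by (simp add: exp_minus divide_inverse del: power_Suc)
    then have "((\<lambda>h. flat_exp k h / h) \<longlongrightarrow> 0) (at_right 0)"
      by (rule Lim_transform_eventually)
        (auto simp: flat_exp_def field_simps eventually_at_right_field intro!: exI[of _ 1])
    moreover have "((\<lambda>h. flat_exp k h / h) \<longlongrightarrow> 0) (at_left 0)"
      by (rule Lim_transform_eventually[of "\<lambda>_. 0"])
        (auto simp: flat_exp_def eventually_at_left_field intro!: exI[of _ "-1"])
    ultimately have "(\<lambda>h. flat_exp k h / h) \<midarrow>0\<rightarrow> 0"
      by (rule filterlim_split_at[rotated])
    moreover have "flat_exp j 0 = 0" for j by (simp add: flat_exp_def)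
    ultimately show ?thesis using 3 by (simp add: DERIV_def)
  qed
qed

lemma smooth_on_flat_exp: "smooth_on UNIV (flat_exp k)"
  unfolding smooth_on_def
proof
  fix n show "times_cont_diff_on n UNIV (flat_exp k)"
  proof (induction n arbitrary: k)
    case 0
    then show ?case
      by (auto intro!: continuous_at_imp_continuous_on DERIV_isCont[OF flat_exp_has_derivative])
  next
    case (Suc n)
    have "times_cont_diff_on n UNIV (\<lambda>t. (flat_exp (k + 2) t + (- real k) * flat_exp (k + 1) t) * v)" for v
      by (intro times_cont_diff_on_bilinear[OF bounded_bilinear_mult] times_cont_diff_on_add Suc
          times_cont_diff_on_const) auto
    then show ?case
      using flat_exp_has_derivative[of k]
      by (intro times_cont_diff_on_SucI[where f' = "\<lambda>t v. (flat_exp (k + 2) t + (- real k) * flat_exp (k + 1) t) * v"])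
        (auto simp: has_field_derivative_def)
  qed
qed

text \<open>Compose \<open>flat_exp 0\<close> with \<open>r\<^sup>2 - x \<bullet> x\<close>, which
  is positive exactly inside the ball and has a critical point at the centre.\<close>

lemma bump_function:
  assumes "r > 0"
  obtains \<beta> :: "'a::euclidean_space \<Rightarrow> real"
  where "smooth_on UNIV \<beta>" "\<beta> 0 > 0" "\<And>x. norm x \<ge> r \<Longrightarrow> \<beta> x = 0"
    "(\<beta> has_derivative (\<lambda>_. 0)) (at 0)"
proof
  define \<beta> :: "'a \<Rightarrow> real" where "\<beta> x = flat_exp 0 (r\<^sup>2 - x \<bullet> x)" for x
  have "smooth_on UNIV (\<lambda>x::'a. r\<^sup>2 - x \<bullet> x)"
    by (intro smooth_on_diff smooth_on_inner smooth_on_const smooth_on_id) auto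
  from smooth_on_compose[OF _ this smooth_on_flat_exp[of 0]]
  show "smooth_on UNIV \<beta>" by (simp add: \<beta>_def[abs_def])
  show "\<beta> 0 > 0" using assms by (simp add: \<beta>_def flat_exp_def)
  show "\<beta> x = 0" if "norm x \<ge> r" for x
    using power_mono[OF that, of 2] assms by (simp add: \<beta>_def flat_exp_def dot_square_norm not_less)
  have "((\<lambda>x. r\<^sup>2 - x \<bullet> x) has_derivative (\<lambda>h. 0)) (at (0::'a))"
    by (auto intro!: derivative_eq_intros)
  from has_derivative_compose[OF this flat_exp_has_derivative[of 0, unfolded has_field_derivative_def]]
  have "((\<lambda>x. flat_exp 0 (r\<^sup>2 - x \<bullet> x)) has_derivative (\<lambda>h. 0)) (at (0::'a))" by simp
  then show "(\<beta> has_derivative (\<lambda>_. 0)) (at 0)" by (simp add: \<beta>_def[abs_def])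
qed

section \<open>Left-invariant vector fields in a chart at the identity\<close>

lemma chart_onD:
  assumes "chart_on X U \<phi>"
  shows "openin X U" "open (\<phi> ` U)" "inj_on \<phi> U" "U \<subseteq> topspace X"
    "continuous_map (subtopology X U) euclidean \<phi>"
    "continuous_map (top_of_set (\<phi> ` U)) X (inv_into U \<phi>)"
    "\<And>W. openin X W \<Longrightarrow> W \<subseteq> U \<Longrightarrow> open (\<phi> ` W)"
proof -
  have hom: "homeomorphic_map (subtopology X U) (top_of_set (\<phi> ` U)) \<phi>"
    using assms by (simp add: chart_on_def)
  show op: "openin X U" "open (\<phi> ` U)" using assms by (simp_all add: chart_on_def)
  then show sub: "U \<subseteq> topspace X" using openin_subset by blast
  then have top: "topspace (subtopology X U) = U" by (simp add: topspace_subtopology Int_absorb1)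
  show inj: "inj_on \<phi> U"
    using homeomorphic_imp_injective_map[OF hom] top by simp
  show "continuous_map (subtopology X U) euclidean \<phi>"
    using homeomorphic_imp_continuous_map[OF hom] continuous_map_in_subtopology by blast
  obtain g where g: "homeomorphic_maps (subtopology X U) (top_of_set (\<phi> ` U)) \<phi> g"
    using hom homeomorphic_map_maps by blast
  then have "continuous_map (top_of_set (\<phi> ` U)) X g"
    using continuous_map_in_subtopology unfolding homeomorphic_maps_def by blast
  then show "continuous_map (top_of_set (\<phi> ` U)) X (inv_into U \<phi>)"
  proof (rule continuous_map_eq)
    fix y assume "y \<in> topspace (top_of_set (\<phi> ` U))"
    then obtain x where "x \<in> U" "y = \<phi> x" by auto
    then show "g y = inv_into U \<phi> y"
      using g inj top by (simp add: homeomorphic_maps_def inv_into_f_f)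
  qed
  fix W assume W: "openin X W" "W \<subseteq> U"
  then have "openin (subtopology X U) W" using op openin_open_subtopology by blast
  then have "openin (top_of_set (\<phi> ` U)) (\<phi> ` W)"
    using homeomorphic_map_openness_eq[OF hom] by blast
  then show "open (\<phi> ` W)" using op openin_open_eq by blast
qed

lemma open_continuous_map_preimage:
  assumes "open S" "continuous_map (top_of_set S) X g" "openin X V"
  shows "open {p \<in> S. g p \<in> V}"
  using openin_continuous_map_preimage[OF assms(2,3)] assms(1)
  by (simp add: openin_open_eq)

lemma chart_on_prod:
  assumes "chart_on X U \<phi>" "chart_on Y V \<psi>"
  shows "chart_on (prod_topology X Y) (U \<times> V) (map_prod \<phi> \<psi>)"
proof -
  obtain f where f: "homeomorphic_maps (subtopology X U) (top_of_set (\<phi> ` U)) \<phi> f"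
    using assms(1) homeomorphic_map_maps unfolding chart_on_def by blast
  obtain g where g: "homeomorphic_maps (subtopology Y V) (top_of_set (\<psi> ` V)) \<psi> g"
    using assms(2) homeomorphic_map_maps unfolding chart_on_def by blast
  have *: "map_prod \<phi> \<psi> = (\<lambda>(x, y). (\<phi> x, \<psi> y))" by auto
  have "homeomorphic_maps (prod_topology (subtopology X U) (subtopology Y V))
     (prod_topology (top_of_set (\<phi> ` U)) (top_of_set (\<psi> ` V))) (map_prod \<phi> \<psi>) (\<lambda>(x, y). (f x, g y))"
    unfolding * using f g homeomorphic_maps_prod by blast
  then have "homeomorphic_map (subtopology (prod_topology X Y) (U \<times> V))
     (top_of_set (\<phi> ` U \<times> \<psi> ` V)) (map_prod \<phi> \<psi>)"
    unfolding homeomorphic_map_maps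
    by (auto simp: subtopology_Times subtopology_Times[of euclidean euclidean, simplified euclidean_product_topology])
  moreover have "map_prod \<phi> \<psi> ` (U \<times> V) = \<phi> ` U \<times> \<psi> ` V" by auto
  ultimately show ?thesis
    using assms by (simp add: chart_on_def openin_prod_Times_iff open_Times)
qed

lemma inv_into_map_prod:
  assumes "inj_on \<phi> U" "inj_on \<psi> V" "a \<in> \<phi> ` U" "b \<in> \<psi> ` V"
  shows "inv_into (U \<times> V) (map_prod \<phi> \<psi>) (a, b) = (inv_into U \<phi> a, inv_into V \<psi> b)"
proof -
  have "inj_on (map_prod \<phi> \<psi>) (U \<times> V)" using assms(1,2) by (rule map_prod_inj_on)
  moreover have "map_prod \<phi> \<psi> (inv_into U \<phi> a, inv_into V \<psi> b) = (a, b)"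
    using assms by (simp add: f_inv_into_f)
  moreover have "(inv_into U \<phi> a, inv_into V \<psi> b) \<in> U \<times> V"
    using assms by (simp add: inv_into_into)
  ultimately show ?thesis by (metis inv_into_f_f)
qed

lemma smooth_atlas_cover:
  assumes "smooth_atlas X A" "x \<in> topspace X"
  obtains U \<phi> where "(U, \<phi>) \<in> A" "x \<in> U" "chart_on X U \<phi>"
proof -
  have "x \<in> (\<Union>(U, \<phi>)\<in>A. U)" using assms by (simp add: smooth_atlas_def)
  then obtain U \<phi> where "(U, \<phi>) \<in> A" "x \<in> U" by auto
  moreover from this have "chart_on X U \<phi>" using assms(1) by (auto simp: smooth_atlas_def)
  ultimately show thesis using that by blast
qed

lemma smooth_functionsD:
  assumes "f \<in> smooth_functions X A"
  shows "continuous_map X euclideanreal f" "\<And>x. x \<notin> topspace X \<Longrightarrow> f x = 0"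
    "\<And>U \<phi>. (U, \<phi>) \<in> A \<Longrightarrow> smooth_on (\<phi> ` U) (\<lambda>a. f (inv_into U \<phi> a))"
  using assms by (auto simp: smooth_functions_def smooth_map_def)

text \<open>Smoothness in every chart already forces global continuity, by pasting over the open
  cover of chart domains.\<close>

lemma smooth_functionsI:
  assumes A: "smooth_atlas X A"
    and sm: "\<And>U \<phi>. (U, \<phi>) \<in> A \<Longrightarrow> smooth_on (\<phi> ` U) (\<lambda>a. f (inv_into U \<phi> a))"
    and off: "\<And>x. x \<notin> topspace X \<Longrightarrow> f x = 0"
  shows "f \<in> smooth_functions X A"
proof -
  have "continuous_map X euclideanreal f"
  proof (rule pasting_lemma[where I = A and T = fst and f = "\<lambda>_. f"])
    fix c assume c: "c \<in> A"
    obtain U \<phi> where [simp]: "c = (U, \<phi>)" by (cases c)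
    have ch: "chart_on X U \<phi>" using A c by (auto simp: smooth_atlas_def)
    show "openin X (fst c)" using chart_onD(1)[OF ch] by simp
    have "continuous_map (top_of_set (\<phi> ` U)) euclideanreal (\<lambda>a. f (inv_into U \<phi> a))"
      using smooth_on_imp_continuous_on[OF sm] c by simp
    moreover have "continuous_map (subtopology X U) (top_of_set (\<phi> ` U)) \<phi>"
      using chart_onD(5)[OF ch] chart_onD(4)[OF ch] by (auto simp: continuous_map_in_subtopology)
    ultimately have "continuous_map (subtopology X U) euclideanreal ((\<lambda>a. f (inv_into U \<phi> a)) \<circ> \<phi>)"
      by (rule continuous_map_compose[rotated])
    then show "continuous_map (subtopology X (fst c)) euclideanreal f"
      using chart_onD(3,4)[OF ch] by (auto simp: elim!: continuous_map_eq)
  next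
    fix x assume "x \<in> topspace X"
    then show "\<exists>j. j \<in> A \<and> x \<in> fst j \<and> f x = f x"
      using smooth_atlas_cover[OF A] by (metis fst_conv)
  qed auto
  then show ?thesis
    using sm off by (auto simp: smooth_functions_def smooth_map_def)
qed

text \<open>Near a point, a chart \<open>\<omega>\<close> around its image splits the function into
  \<open>f\<close> read in \<open>\<omega>\<close> after \<open>g\<close> read in the two charts,
  and both are smooth by definition.\<close>

lemma smooth_on_chart_compose:
  assumes g: "smooth_map X A Y B g" and B: "smooth_atlas Y B"
    and U: "(U, \<phi>) \<in> A" "chart_on X U \<phi>" and f: "f \<in> smooth_functions Y B"
  shows "smooth_on (\<phi> ` U) (\<lambda>a. f (g (inv_into U \<phi> a)))"
proof (rule smooth_on_local)
  fix a assume "a \<in> \<phi> ` U"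
  then obtain x where x: "x \<in> U" "a = \<phi> x" by auto
  have gc: "continuous_map X Y g" using g by (simp add: smooth_map_def)
  then have "g x \<in> topspace Y" using x chart_onD(4)[OF U(2)] by (auto simp: continuous_map_def)
  then obtain W \<omega> where W: "(W, \<omega>) \<in> B" "g x \<in> W" and chW: "chart_on Y W \<omega>"
    using smooth_atlas_cover[OF B] by metis
  let ?T = "\<phi> ` (U \<inter> g -` W)"
  have "openin X (U \<inter> {x \<in> topspace X. g x \<in> W})"
    using chart_onD(1)[OF U(2)] openin_continuous_map_preimage[OF gc chart_onD(1)[OF chW]] by blast
  moreover have "U \<inter> {x \<in> topspace X. g x \<in> W} = U \<inter> g -` W"
    using chart_onD(4)[OF U(2)] by auto
  ultimately have op: "open ?T" using chart_onD(7)[OF U(2)] by simp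
  have 1: "smooth_on ?T (\<lambda>x. \<omega> (g (inv_into U \<phi> x)))"
    using g U(1) W(1) by (auto simp: smooth_map_def)
  have "smooth_on ?T (\<lambda>a. f (inv_into W \<omega> (\<omega> (g (inv_into U \<phi> a)))))"
    by (rule smooth_on_compose[OF op 1 smooth_functionsD(3)[OF f W(1)]])
      (use chart_onD(3)[OF U(2)] in auto)
  then have "smooth_on ?T (\<lambda>a. f (g (inv_into U \<phi> a)))"
    by (rule smooth_on_cong[OF _ op]) (use chart_onD(3)[OF U(2)] chart_onD(3)[OF chW] in auto)
  then show "\<exists>T. open T \<and> a \<in> T \<and> smooth_on T (\<lambda>a. f (g (inv_into U \<phi> a)))"
    using op x W(2) by blast
qed

section \<open>A Lie group with a fixed chart at the identity\<close>

locale lie_group_chart = group G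
  for G :: "('g, 'm) monoid_scheme" (structure) +
  fixes X :: "'g topology" and A :: "('g, 'e::euclidean_space) atlas"
    and V :: "'g set" and \<psi> :: "'g \<Rightarrow> 'e"
  assumes lie: "lie_group G X A" and V_in: "(V, \<psi>) \<in> A" and one_in_V: "\<one> \<in> V"
begin

abbreviation Cinf :: "('g \<Rightarrow> real) set" where "Cinf \<equiv> smooth_functions X A"

text \<open>The chart is translated so that \<open>\<one>\<close> has coordinate \<open>0\<close>;
  \<open>par\<close> is the local parametrisation and \<open>coord\<close> its inverse.\<close>

definition cdom :: "'e set" where "cdom = {b. b + \<psi> \<one> \<in> \<psi> ` V}"
definition par :: "'e \<Rightarrow> 'g" where "par b = inv_into V \<psi> (b + \<psi> \<one>)"
definition coord :: "'g \<Rightarrow> 'e" where "coord x = \<psi> x - \<psi> \<one>"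

lemma atlas: "smooth_atlas X A" and Hausdorff: "Hausdorff_space X"
  and carrier_eq: "topspace X = carrier G"
  and smooth_mult: "smooth_map (prod_topology X X) (prod_atlas A A) X A (\<lambda>(x, y). x \<otimes> y)"
  and smooth_inv: "smooth_map X A X A (\<lambda>x. inv x)"
  using lie by (auto simp: lie_group_def smooth_manifold_def)

lemma atlas_chart: "(U, \<phi>) \<in> A \<Longrightarrow> chart_on X U \<phi>"
  using atlas by (auto simp: smooth_atlas_def)

lemma open_chart: "(U, \<phi>) \<in> A \<Longrightarrow> open (\<phi> ` U)"
  using chart_onD(2)[OF atlas_chart] .

lemmas V_chart = atlas_chart[OF V_in]

lemma V_subset: "V \<subseteq> carrier G" using chart_onD(4)[OF V_chart] carrier_eq by simp

lemma cont_mult: "continuous_map (prod_topology X X) X (\<lambda>(x, y). x \<otimes> y)"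
  and cont_inv: "continuous_map X X (\<lambda>x. inv x)"
  using smooth_mult smooth_inv by (auto simp: smooth_map_def)

lemma cont_mult2:
  assumes "continuous_map T X f" "continuous_map T X g"
  shows "continuous_map T X (\<lambda>x. f x \<otimes> g x)"
  using continuous_map_compose[OF continuous_map_pairedI[OF assms] cont_mult] by (simp add: o_def)

lemma cont_inv2: "continuous_map T X f \<Longrightarrow> continuous_map T X (\<lambda>x. inv (f x))"
  using continuous_map_compose[OF _ cont_inv] by (auto simp: o_def)

lemma open_cdom: "open cdom"
proof -
  have "b \<in> (\<lambda>b. b - \<psi> \<one>) ` (\<psi> ` V)" if "b + \<psi> \<one> \<in> \<psi> ` V" for b
    using imageI[OF that, of "\<lambda>b. b - \<psi> \<one>"] by simp
  then have "cdom = (\<lambda>b. b - \<psi> \<one>) ` (\<psi> ` V)" unfolding cdom_def by auto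
  then show ?thesis using open_translation_subtract[OF chart_onD(2)[OF V_chart]] by simp
qed

lemma zero_in_cdom: "0 \<in> cdom" using one_in_V by (simp add: cdom_def)

lemma par_in_V: "b \<in> cdom \<Longrightarrow> par b \<in> V"
  by (simp add: cdom_def par_def inv_into_into)

lemma par_in_carrier: "b \<in> cdom \<Longrightarrow> par b \<in> carrier G"
  using par_in_V V_subset by blast

lemma coord_par: "b \<in> cdom \<Longrightarrow> coord (par b) = b"
  by (simp add: cdom_def par_def coord_def f_inv_into_f)

lemma par_coord: "x \<in> V \<Longrightarrow> par (coord x) = x"
  using chart_onD(3)[OF V_chart] by (simp add: par_def coord_def)

lemma coord_in_cdom: "x \<in> V \<Longrightarrow> coord x \<in> cdom"
  by (simp add: cdom_def coord_def)

lemma coord_one: "coord \<one> = 0" by (simp add: coord_def)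

lemma par_zero: "par 0 = \<one>" using par_coord[OF one_in_V] coord_one by simp

lemma cont_par: "continuous_map (top_of_set cdom) X par"
proof -
  have "continuous_map (top_of_set cdom) (top_of_set (\<psi> ` V)) (\<lambda>b. b + \<psi> \<one>)"
    by (auto simp: continuous_map_in_subtopology cdom_def intro!: continuous_intros)
  from continuous_map_compose[OF this chart_onD(6)[OF V_chart]]
  show ?thesis by (simp add: par_def[abs_def] o_def)
qed

lemma cont_coord: "continuous_map (subtopology X V) euclidean coord"
  using continuous_map_diff[OF chart_onD(5)[OF V_chart] continuous_map_const[THEN iffD2], of "\<psi> \<one>"]
  by (simp add: coord_def[abs_def])

lemma openin_par_image:
  assumes "open T" "T \<subseteq> cdom" shows "openin X (par ` T)"
proof -
  have "openin (subtopology X V) {x \<in> topspace (subtopology X V). coord x \<in> T}"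
    using cont_coord assms(1) openin_continuous_map_preimage by fastforce
  moreover have "{x \<in> topspace (subtopology X V). coord x \<in> T} = par ` T"
    using assms(2) par_in_V par_in_carrier coord_par par_coord carrier_eq by force
  ultimately show ?thesis
    using openin_open_subtopology[OF chart_onD(1)[OF V_chart]] by simp
qed

lemma smooth_on_shift:
  fixes h :: "'e \<Rightarrow> 'b::euclidean_space"
  assumes "smooth_on (\<psi> ` S) h" "S \<subseteq> V" "T \<subseteq> cdom" "\<And>b. b \<in> T \<Longrightarrow> par b \<in> S" "open T"
  shows "smooth_on T (\<lambda>b. h (b + \<psi> \<one>))"
proof (rule smooth_on_compose[OF assms(5) _ assms(1)])
  show "smooth_on T (\<lambda>b. b + \<psi> \<one>)"
    by (intro smooth_on_add smooth_on_id smooth_on_const assms)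
  show "(\<lambda>b. b + \<psi> \<one>) ` T \<subseteq> \<psi> ` S"
  proof clarify
    fix b assume b: "b \<in> T"
    then have "\<psi> (par b) = b + \<psi> \<one>" using coord_par[of b] assms(3) by (auto simp: coord_def algebra_simps)
    then show "b + \<psi> \<one> \<in> \<psi> ` S" using assms(4)[OF b] by (metis imageI)
  qed
qed

lemma smooth_on_mult_chart:
  assumes f: "f \<in> Cinf" and U: "(U, \<phi>) \<in> A" and W: "(W, \<omega>) \<in> A"
  shows "smooth_on (\<phi> ` U \<times> \<omega> ` W) (\<lambda>(a, b). f (inv_into U \<phi> a \<otimes> inv_into W \<omega> b))"
proof -
  note ch = atlas_chart[OF U] atlas_chart[OF W]
  have *: "map_prod \<phi> \<omega> ` (U \<times> W) = \<phi> ` U \<times> \<omega> ` W" by auto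
  have "(U \<times> W, map_prod \<phi> \<omega>) \<in> prod_atlas A A" using U W by (auto simp: prod_atlas_def)
  from smooth_on_chart_compose[OF smooth_mult atlas this chart_on_prod[OF ch] f]
  have "smooth_on (\<phi> ` U \<times> \<omega> ` W) (\<lambda>p. f (case inv_into (U \<times> W) (map_prod \<phi> \<omega>) p of (x, y) \<Rightarrow> x \<otimes> y))"
    unfolding * .
  then show ?thesis
    by (rule smooth_on_cong)
      (use chart_onD(2,3)[OF ch(1)] chart_onD(2,3)[OF ch(2)] in
        \<open>auto simp: inv_into_map_prod open_Times simp del: map_prod_simp\<close>)
qed

text \<open>Smoothness jointly in the base point and the increment: a derivative taken in the
  increment alone then stays smooth in the base point, which is why \<open>inv_field\<close>
  preserves \<open>Cinf\<close>.\<close>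

lemma smooth_on_mult_par:
  assumes f: "f \<in> Cinf" and U: "(U, \<phi>) \<in> A"
  shows "smooth_on (\<phi> ` U \<times> cdom) (\<lambda>(a, b). f (inv_into U \<phi> a \<otimes> par b))"
proof -
  have op: "open (\<phi> ` U \<times> cdom)"
    using chart_onD(2)[OF atlas_chart[OF U]] open_cdom open_Times by blast
  have s: "smooth_on (\<phi> ` U \<times> cdom) (\<lambda>p. (fst p, snd p + \<psi> \<one>))"
    by (intro smooth_on_Pair smooth_on_add op smooth_on_linear bounded_linear_fst bounded_linear_snd
        smooth_on_const)
  have "smooth_on (\<phi> ` U \<times> cdom) (\<lambda>p. (\<lambda>(a, b). f (inv_into U \<phi> a \<otimes> inv_into V \<psi> b)) (fst p, snd p + \<psi> \<one>))"
    by (rule smooth_on_compose[OF op s smooth_on_mult_chart[OF f U V_in]]) (auto simp: cdom_def)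
  then show ?thesis by (simp add: par_def split_beta')
qed

lemma smooth_on_translate_par:
  assumes f: "f \<in> Cinf" and x: "x \<in> carrier G"
  shows "smooth_on cdom (\<lambda>b. f (x \<otimes> par b))"
proof -
  obtain U \<phi> where U: "(U, \<phi>) \<in> A" "x \<in> U"
    using smooth_atlas_cover[OF atlas] x carrier_eq by metis
  have "smooth_on cdom (\<lambda>b. (\<lambda>(a, b). f (inv_into U \<phi> a \<otimes> par b)) (\<phi> x, b))"
    by (rule smooth_on_compose[OF open_cdom _ smooth_on_mult_par[OF f U(1)]])
      (use U in \<open>auto intro!: smooth_on_Pair open_cdom smooth_on_const smooth_on_id\<close>)
  then show ?thesis
    using chart_onD(3)[OF atlas_chart[OF U(1)]] U(2) by simp
qed

lemma smooth_on_par: "f \<in> Cinf \<Longrightarrow> smooth_on cdom (\<lambda>b. f (par b))"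
  by (rule smooth_on_cong[OF smooth_on_translate_par[OF _ one_closed] open_cdom])
    (auto simp: par_in_carrier)

section \<open>The algebra of smooth functions and the left-invariant fields\<close>

lemma Cinf_add: "f \<in> Cinf \<Longrightarrow> g \<in> Cinf \<Longrightarrow> (\<lambda>x. f x + g x) \<in> Cinf"
  by (intro smooth_functionsI[OF atlas] smooth_on_add smooth_functionsD(3) open_chart)
    (auto simp: smooth_functionsD(2))

lemma Cinf_mult: "f \<in> Cinf \<Longrightarrow> g \<in> Cinf \<Longrightarrow> (\<lambda>x. f x * g x) \<in> Cinf"
  by (intro smooth_functionsI[OF atlas] smooth_on_mult smooth_functionsD(3) open_chart)
    (auto simp: smooth_functionsD(2))

lemma Cinf_scale: "f \<in> Cinf \<Longrightarrow> (\<lambda>x. c * f x) \<in> Cinf"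
  by (intro smooth_functionsI[OF atlas] smooth_on_mult[where f = "\<lambda>_. c"] smooth_on_const open_chart)
    (auto simp: smooth_functionsD(2,3))

lemma Cinf_zero: "(\<lambda>_. 0) \<in> Cinf"
  by (intro smooth_functionsI[OF atlas] smooth_on_const) auto

lemma Cinf_const_on: "(\<lambda>x. if x \<in> carrier G then c else 0) \<in> Cinf"
proof (intro smooth_functionsI[OF atlas])
  fix U \<phi> assume U: "(U, \<phi>) \<in> A"
  show "smooth_on (\<phi> ` U) (\<lambda>a. if inv_into U \<phi> a \<in> carrier G then c else 0)"
    by (rule smooth_on_cong[OF smooth_on_const[of _ c] chart_onD(2)[OF atlas_chart[OF U]]])
      (use chart_onD(4)[OF atlas_chart[OF U]] carrier_eq in \<open>auto simp: inv_into_into subset_iff\<close>)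
qed (simp add: carrier_eq)

lemma Cinf_left_translate:
  assumes f: "f \<in> Cinf" and g: "g \<in> carrier G"
  shows "left_translate G g f \<in> Cinf"
proof (intro smooth_functionsI[OF atlas])
  fix W \<omega> assume W: "(W, \<omega>) \<in> A"
  note ch = atlas_chart[OF W]
  obtain U \<phi> where U: "(U, \<phi>) \<in> A" "g \<in> U"
    using smooth_atlas_cover[OF atlas] g carrier_eq by metis
  have "smooth_on (\<omega> ` W) (\<lambda>b. (\<lambda>(a, b). f (inv_into U \<phi> a \<otimes> inv_into W \<omega> b)) (\<phi> g, b))"
    by (rule smooth_on_compose[OF chart_onD(2)[OF ch] _ smooth_on_mult_chart[OF f U(1) W]])
      (use U chart_onD(2)[OF ch] in \<open>auto intro!: smooth_on_Pair smooth_on_const smooth_on_id\<close>)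
  then show "smooth_on (\<omega> ` W) (\<lambda>b. left_translate G g f (inv_into W \<omega> b))"
    by (rule smooth_on_cong[OF _ chart_onD(2)[OF ch]])
      (use chart_onD(3)[OF atlas_chart[OF U(1)]] U(2) chart_onD(4)[OF ch] carrier_eq in
        \<open>auto simp: left_translate_def subset_iff inv_into_into\<close>)
qed (simp add: carrier_eq left_translate_def)

text \<open>The left-invariant vector field with value \<open>v\<close> at \<open>\<one>\<close>: at
  \<open>x\<close> the function is differentiated along the left translate by \<open>x\<close> of
  the parametrisation. The default 0 follows the normalisation in \<open>vector_field\<close>, so
  that equality of fields is equality of operators.\<close>

definition inv_field :: "'e \<Rightarrow> ('g \<Rightarrow> real) \<Rightarrow> 'g \<Rightarrow> real" where
  "inv_field v f x =
    (if f \<in> Cinf \<and> x \<in> carrier G then frechet_derivative (\<lambda>b. f (x \<otimes> par b)) (at 0) v else 0)"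

lemma inv_field_translate_has_derivative:
  "f \<in> Cinf \<Longrightarrow> x \<in> carrier G \<Longrightarrow>
    ((\<lambda>b. f (x \<otimes> par b)) has_derivative (\<lambda>v. inv_field v f x)) (at 0)"
  using smooth_on_has_derivative[OF smooth_on_translate_par zero_in_cdom, of f x]
  by (simp add: inv_field_def)

lemma inv_field_eqI:
  assumes "f \<in> Cinf" "x \<in> carrier G" "((\<lambda>b. f (x \<otimes> par b)) has_derivative F) (at 0)"
  shows "inv_field v f x = F v"
  using frechet_derivative_eqI[OF assms(3)] assms(1,2) by (simp add: inv_field_def)

lemma inv_field_linear: "f \<in> Cinf \<Longrightarrow> x \<in> carrier G \<Longrightarrow> linear (\<lambda>v. inv_field v f x)"
  using inv_field_translate_has_derivative has_derivative_linear by blast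

lemma inv_field_add_vec: "inv_field (v + w) f x = inv_field v f x + inv_field w f x"
  using linear_add[OF inv_field_linear] by (cases "f \<in> Cinf \<and> x \<in> carrier G") (auto simp: inv_field_def)

lemma inv_field_scale_vec: "inv_field (c *\<^sub>R v) f x = c * inv_field v f x"
  using linear_scale[OF inv_field_linear] by (cases "f \<in> Cinf \<and> x \<in> carrier G") (auto simp: inv_field_def)

lemma inv_field_zero_vec: "inv_field 0 f x = 0"
  using inv_field_scale_vec[of 0 0 f x] by simp

lemma Cinf_inv_field:
  assumes f: "f \<in> Cinf"
  shows "inv_field v f \<in> Cinf"
proof (intro smooth_functionsI[OF atlas])
  fix U \<phi> assume U: "(U, \<phi>) \<in> A"
  note ch = atlas_chart[OF U]
  let ?F = "\<lambda>(a, b). f (inv_into U \<phi> a \<otimes> par b)"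
  have "smooth_on (\<phi> ` U) (\<lambda>a. frechet_derivative ?F (at (a, 0)) (0, v))"
    by (rule smooth_on_compose[where f = "\<lambda>a. (a, 0)" and g = "\<lambda>p. frechet_derivative ?F (at p) (0, v)",
          OF chart_onD(2)[OF ch] _ smooth_on_frechet_derivative[OF smooth_on_mult_par[OF f U]]])
      (use zero_in_cdom chart_onD(2)[OF ch] in \<open>auto intro!: smooth_on_Pair smooth_on_id smooth_on_const\<close>)
  then show "smooth_on (\<phi> ` U) (\<lambda>a. inv_field v f (inv_into U \<phi> a))"
  proof (rule smooth_on_cong[OF _ chart_onD(2)[OF ch]])
    fix a assume a: "a \<in> \<phi> ` U"
    have "(?F has_derivative frechet_derivative ?F (at (a, 0))) (at (a, 0))"
      by (rule smooth_on_has_derivative[OF smooth_on_mult_par[OF f U]]) (use a zero_in_cdom in auto)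
    moreover have "((\<lambda>b. (a, b)) has_derivative (\<lambda>h. (0, h))) (at 0)"
      by (intro has_derivative_Pair has_derivative_const has_derivative_ident)
    ultimately
    have "((\<lambda>b. f (inv_into U \<phi> a \<otimes> par b)) has_derivative (\<lambda>v. frechet_derivative ?F (at (a, 0)) (0, v))) (at 0)"
      using has_derivative_compose[of "Pair a" "Pair 0" 0 UNIV ?F] by simp
    then show "frechet_derivative ?F (at (a, 0)) (0, v) = inv_field v f (inv_into U \<phi> a)"
      using inv_field_eqI[OF f] a chart_onD(4)[OF ch] carrier_eq by (metis inv_into_into subsetD)
  qed
qed (simp add: carrier_eq inv_field_def)

lemma vector_field_inv_field: "vector_field X A (inv_field v)"
proof -
  note d = inv_field_translate_has_derivative
  have "inv_field v (\<lambda>x. f x + g x) x = inv_field v f x + inv_field v g x" if "f \<in> Cinf" "g \<in> Cinf" for f g x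
    using inv_field_eqI[OF Cinf_add[OF that] _ has_derivative_add[OF d[OF that(1)] d[OF that(2)]], where x = x and v = v]
    by (cases "x \<in> carrier G") (auto simp: inv_field_def)
  moreover have "inv_field v (\<lambda>x. c * f x) x = c * inv_field v f x" if "f \<in> Cinf" for f c x
    using inv_field_eqI[OF Cinf_scale[OF that] _ has_derivative_mult_right[OF d[OF that]], where x = x and v = v]
    by (cases "x \<in> carrier G") (auto simp: inv_field_def)
  moreover have "inv_field v (\<lambda>x. f x * g x) x = f x * inv_field v g x + g x * inv_field v f x"
    if "f \<in> Cinf" "g \<in> Cinf" for f g x
    using inv_field_eqI[OF Cinf_mult[OF that] _ has_derivative_mult[OF d[OF that(1)] d[OF that(2)]], where x = x and v = v]
    by (cases "x \<in> carrier G") (auto simp: inv_field_def par_zero algebra_simps)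
  ultimately show ?thesis
    unfolding vector_field_def by (auto simp: Cinf_inv_field fun_eq_iff) (auto simp: inv_field_def)
qed

text \<open>Associativity moves the translation by \<open>g\<close> from the function to the base
  point.\<close>

lemma inv_field_left_translate:
  assumes "g \<in> carrier G" "f \<in> Cinf"
  shows "inv_field v (left_translate G g f) = left_translate G g (inv_field v f)"
proof
  fix x
  show "inv_field v (left_translate G g f) x = left_translate G g (inv_field v f) x"
  proof (cases "x \<in> carrier G")
    case True
    have "((\<lambda>b. f (g \<otimes> x \<otimes> par b)) has_derivative (\<lambda>v. inv_field v f (g \<otimes> x))) (at 0)"
      using inv_field_translate_has_derivative assms True by simp
    then have "((\<lambda>b. left_translate G g f (x \<otimes> par b)) has_derivative (\<lambda>v. inv_field v f (g \<otimes> x))) (at 0)"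
      by (rule has_derivative_transform_within_open[OF _ open_cdom zero_in_cdom])
        (use assms True in \<open>simp add: left_translate_def par_in_carrier m_assoc\<close>)
    then show ?thesis
      using inv_field_eqI[OF Cinf_left_translate[OF assms(2,1)] True] True by (simp add: left_translate_def)
  qed (simp add: inv_field_def left_translate_def)
qed

lemma inv_field_in_lie_algebra: "inv_field v \<in> lie_algebra G X A"
  using vector_field_inv_field inv_field_left_translate by (simp add: lie_algebra_def)

end

section \<open>The Lie algebra as the tangent space at the identity\<close>

context lie_group_chart
begin

section \<open>Cut-offs and derivations at the identity\<close>

lemma smooth_on_transition:
  assumes "(W, \<omega>) \<in> A"
  shows "smooth_on (\<omega> ` (W \<inter> V)) (\<lambda>y. coord (inv_into W \<omega> y))" "open (\<omega> ` (W \<inter> V))"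
proof -
  show op: "open (\<omega> ` (W \<inter> V))"
    using chart_onD(7)[OF atlas_chart[OF assms], of "W \<inter> V"] chart_onD(1)[OF atlas_chart[OF assms]]
      chart_onD(1)[OF V_chart] by blast
  have "smooth_on (\<omega> ` (W \<inter> V)) (\<lambda>y. \<psi> (inv_into W \<omega> y))"
    using atlas assms V_in by (auto simp: smooth_atlas_def)
  then show "smooth_on (\<omega> ` (W \<inter> V)) (\<lambda>y. coord (inv_into W \<omega> y))"
    unfolding coord_def by (intro smooth_on_diff op smooth_on_const)
qed

text \<open>Derivations act on global functions only; this turns a function given on a coordinate
  ball into a global one.\<close>

definition cutoff :: "real \<Rightarrow> ('e \<Rightarrow> real) \<Rightarrow> ('e \<Rightarrow> real) \<Rightarrow> 'g \<Rightarrow> real" where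
  "cutoff r \<beta> g x = (if x \<in> V \<and> coord x \<in> ball 0 r then \<beta> (coord x) * g (coord x) else 0)"

text \<open>Take \<open>\<beta>\<close> supported in half the radius. The image \<open>K\<close> of
  the closed half ball is compact, hence closed in a Hausdorff space, so the group is covered by two
  open sets: the image of the full ball, where the product is smooth in coordinates, and the
  complement of \<open>K\<close>, where it vanishes. The choice of \<open>r\<close> and
  \<open>\<beta>\<close> does not depend on \<open>g\<close>.\<close>

lemma smooth_cutoff:
  "\<exists>r \<beta>. r > 0 \<and> ball 0 r \<subseteq> cdom \<and> smooth_on UNIV \<beta> \<and> \<beta> 0 > (0::real) \<and>
    (\<beta> has_derivative (\<lambda>_. 0)) (at 0) \<and> (\<forall>g. smooth_on (ball 0 r) g \<longrightarrow> cutoff r \<beta> g \<in> Cinf)"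
proof -
  obtain r where r: "r > 0" "ball 0 r \<subseteq> cdom"
    using open_cdom zero_in_cdom openE by blast
  obtain \<beta> :: "'e \<Rightarrow> real" where \<beta>: "smooth_on UNIV \<beta>" "\<beta> 0 > 0" "\<And>x. norm x \<ge> r / 2 \<Longrightarrow> \<beta> x = 0"
    "(\<beta> has_derivative (\<lambda>_. 0)) (at 0)"
    using bump_function[of "r / 2"] r(1) by auto
  define K where "K = par ` cball 0 (r / 2)"
  have half: "cball 0 (r / 2) \<subseteq> ball (0::'e) r" using r(1) by auto
  have "compactin X K"
    unfolding K_def
  proof (rule image_compactin)
    show "compactin (top_of_set cdom) (cball 0 (r / 2))"
      using half r(2) by (auto simp: compactin_subtopology)
  qed (rule cont_par)
  then have K: "closedin X K" using compactin_imp_closedin Hausdorff by blast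
  have "cutoff r \<beta> g \<in> Cinf" (is "?h \<in> _") if g: "smooth_on (ball 0 r) g" for g
  proof (rule smooth_functionsI[OF atlas])
    fix W \<omega> assume W: "(W, \<omega>) \<in> A"
    note ch = atlas_chart[OF W]
    show "smooth_on (\<omega> ` W) (\<lambda>y. ?h (inv_into W \<omega> y))"
    proof (rule smooth_on_local)
      fix y assume "y \<in> \<omega> ` W"
      then obtain x where x: "x \<in> W" "y = \<omega> x" by auto
      show "\<exists>T. open T \<and> y \<in> T \<and> smooth_on T (\<lambda>y. ?h (inv_into W \<omega> y))"
      proof (cases "x \<in> K")
        case True
        let ?T = "\<omega> ` (W \<inter> par ` ball 0 r)"
        have "openin X (W \<inter> par ` ball 0 r)"
          using openin_par_image[OF _ r(2)] chart_onD(1)[OF ch] by blast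
        then have op: "open ?T" using chart_onD(7)[OF ch] by simp
        have sub: "par ` ball 0 r \<subseteq> V" using r(2) par_in_V by blast
        have "smooth_on ?T (\<lambda>y. coord (inv_into W \<omega> y))"
          by (rule smooth_on_subset[OF smooth_on_transition(1)[OF W]]) (use sub in blast)
        then have "smooth_on ?T (\<lambda>y. (\<lambda>b. \<beta> b * g b) (coord (inv_into W \<omega> y)))"
          by (rule smooth_on_compose[OF op _ smooth_on_mult[OF open_ball smooth_on_subset[OF \<beta>(1)] g]])
            (use chart_onD(3)[OF ch] r(2) in \<open>auto simp: coord_par subset_iff\<close>)
        then have "smooth_on ?T (\<lambda>y. ?h (inv_into W \<omega> y))"
          by (rule smooth_on_cong[OF _ op])
            (use chart_onD(3)[OF ch] r(2) par_in_V in \<open>auto simp: cutoff_def coord_par subset_iff\<close>)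
        moreover have "y \<in> ?T" using True x half by (auto simp: K_def)
        ultimately show ?thesis using op by blast
      next
        case False
        let ?T = "\<omega> ` (W - K)"
        have "openin X (W - K)" using openin_diff[OF chart_onD(1)[OF ch] K] .
        then have op: "open ?T" using chart_onD(7)[OF ch] by simp
        have "?h z = 0" if z: "z \<notin> K" for z
        proof (cases "z \<in> V \<and> coord z \<in> ball 0 r")
          case True
          then have "coord z \<notin> cball 0 (r / 2)" using z par_coord unfolding K_def by (metis imageI)
          then have "\<beta> (coord z) = 0" using \<beta>(3) by simp
          then show ?thesis by (simp add: cutoff_def)
        qed (auto simp: cutoff_def)
        then have "smooth_on ?T (\<lambda>y. ?h (inv_into W \<omega> y))"
          by (intro smooth_on_cong[OF smooth_on_const op]) (use chart_onD(3)[OF ch] in auto)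
        moreover have "y \<in> ?T" using False x by auto
        ultimately show ?thesis using op by blast
      qed
    qed
  next
    fix x assume "x \<notin> topspace X"
    then show "?h x = 0" using V_subset carrier_eq by (auto simp: cutoff_def)
  qed
  with r \<beta>(1,2,4) show ?thesis by blast
qed

text \<open>By Hadamard's lemma a derivation at \<open>\<one>\<close> only sees the first-order part of a function; the
  two copies of the cut-off \<open>\<beta>\<close> make both factors of each Hadamard summand global.\<close>

lemma derivation_at_one:
  assumes D: "vector_field X A D"
  obtains v where "\<And>f. f \<in> Cinf \<Longrightarrow> D f \<one> = inv_field v f \<one>"
proof -
  obtain r \<beta> where r: "r > 0" "ball 0 r \<subseteq> cdom" and \<beta>: "smooth_on UNIV \<beta>" "\<beta> 0 > 0"
    "(\<beta> has_derivative (\<lambda>_. 0)) (at 0)"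
    and cut: "\<forall>g. smooth_on (ball 0 r) g \<longrightarrow> cutoff r \<beta> g \<in> Cinf"
    using smooth_cutoff by (elim exE conjE)
  define ext where "ext = cutoff r \<beta>"
  have ext: "ext g \<in> Cinf" if "smooth_on (ball 0 r) g" for g
    using cut that by (simp add: ext_def)
  have ext1: "ext g \<one> = \<beta> 0 * g 0" for g
    using r(1) one_in_V by (simp add: ext_def cutoff_def coord_one)
  have Dadd: "D (\<lambda>x. f x + g x) x = D f x + D g x" if "f \<in> Cinf" "g \<in> Cinf" for f g x
    using D that unfolding vector_field_def by metis
  have Dscale: "D (\<lambda>x. c * f x) x = c * D f x" if "f \<in> Cinf" for f c x
    using D that unfolding vector_field_def by metis
  have Dmult: "D (\<lambda>x. f x * g x) x = f x * D g x + g x * D f x" if "f \<in> Cinf" "g \<in> Cinf" for f g x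
    using D that unfolding vector_field_def by metis
  have D0: "D (\<lambda>_. 0) x = 0" for x using Dscale[OF Cinf_zero, of 0 x] by simp
  have Dsum: "(\<lambda>x. \<Sum>i\<in>I. f i x) \<in> Cinf \<and> D (\<lambda>x. \<Sum>i\<in>I. f i x) x = (\<Sum>i\<in>I. D (f i) x)"
    if "\<And>i. f i \<in> Cinf" for f x and I :: "'e set"
    by (induction I rule: infinite_finite_induct) (use that in \<open>auto simp: D0 Cinf_zero Dadd Cinf_add\<close>)
  have sm: "smooth_on (ball 0 r) (\<lambda>b. b \<bullet> i)" for i :: 'e
    by (intro smooth_on_linear bounded_linear_inner_left)
  have smc: "smooth_on (ball (0::'e) r) (\<lambda>b. 1::real)" by (rule smooth_on_const)
  have central: "D f \<one> = (\<Sum>i\<in>Basis. inv_field i f \<one> * D (ext (\<lambda>b. b \<bullet> i)) \<one>) / \<beta> 0"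
    if f: "f \<in> Cinf" and f1: "f \<one> = 0" for f
  proof -
    have fs: "smooth_on (ball 0 r) (\<lambda>b. f (par b))"
      using smooth_on_subset[OF smooth_on_par[OF f] r(2)] .
    obtain g where g: "\<And>i. smooth_on (ball 0 r) (g i)"
      "\<And>i. g i 0 = frechet_derivative (\<lambda>b. f (par b)) (at 0) i"
      "\<And>x. x \<in> ball 0 r \<Longrightarrow> f (par x) = f (par 0) + (\<Sum>i\<in>Basis. (x \<bullet> i) * g i x)"
      using hadamard[OF fs r(1)] by blast
    have g0: "g i 0 = inv_field i f \<one>" for i
    proof -
      have "frechet_derivative (\<lambda>b. f (par b)) (at 0) = frechet_derivative (\<lambda>b. f (\<one> \<otimes> par b)) (at 0)"
        by (rule frechet_derivative_cong_open[OF open_cdom zero_in_cdom]) (simp add: par_in_carrier)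
      then show ?thesis using g(2) f by (simp add: inv_field_def)
    qed
    let ?e = "ext (\<lambda>_. 1)"
    have eq: "(\<lambda>x. (?e x * ?e x) * f x) = (\<lambda>x. \<Sum>i\<in>Basis. ext (\<lambda>b. b \<bullet> i) x * ext (g i) x)"
    proof
      fix x
      show "(?e x * ?e x) * f x = (\<Sum>i\<in>Basis. ext (\<lambda>b. b \<bullet> i) x * ext (g i) x)"
      proof (cases "x \<in> V \<and> coord x \<in> ball 0 r")
        case True
        then have "f x = (\<Sum>i\<in>Basis. (coord x \<bullet> i) * g i (coord x))"
          using g(3)[of "coord x"] par_coord[of x] f1 by (simp add: par_zero)
        then show ?thesis using True by (simp add: ext_def cutoff_def sum_distrib_left mult_ac)
      qed (auto simp: ext_def cutoff_def)
    qed
    have ee: "(\<lambda>x. ?e x * ?e x) \<in> Cinf" using Cinf_mult[OF ext[OF smc] ext[OF smc]] .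
    have "\<beta> 0 * \<beta> 0 * D f \<one> = D (\<lambda>x. (?e x * ?e x) * f x) \<one>"
      using Dmult[OF ee f, of \<one>] f1 by (simp add: ext1)
    also have "\<dots> = (\<Sum>i\<in>Basis. D (\<lambda>x. ext (\<lambda>b. b \<bullet> i) x * ext (g i) x) \<one>)"
      unfolding eq by (rule Dsum[THEN conjunct2]) (intro Cinf_mult ext sm g(1))
    also have "\<dots> = (\<Sum>i\<in>Basis. \<beta> 0 * (inv_field i f \<one> * D (ext (\<lambda>b. b \<bullet> i)) \<one>))"
      by (rule sum.cong) (simp_all add: Dmult[OF ext[OF sm] ext[OF g(1)]] ext1 g0)
    also have "\<dots> = \<beta> 0 * (\<Sum>i\<in>Basis. inv_field i f \<one> * D (ext (\<lambda>b. b \<bullet> i)) \<one>)"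
      by (simp add: sum_distrib_left)
    finally show ?thesis using \<beta>(2) by (simp add: field_simps)
  qed
  \<comment> \<open>Derivations kill constants: \<open>u * u = u\<close> gives
    \<open>D u \<one> = 2 * D u \<one>\<close>. Subtracting \<open>f \<one>\<close> times
    \<open>u\<close> therefore reduces to functions vanishing at \<open>\<one>\<close>, the case
    \<open>central\<close>.\<close>
  define u where "u = (\<lambda>x. if x \<in> carrier G then 1 else 0 :: real)"
  have u: "u \<in> Cinf" unfolding u_def by (rule Cinf_const_on)
  have "(\<lambda>x. u x * u x) = u" by (auto simp: u_def)
  then have Du: "D u \<one> = 0" using Dmult[OF u u, of \<one>] by (simp add: u_def)
  \<comment> \<open>A field with vector \<open>v\<close> takes the value
    \<open>\<beta> 0 * (v \<bullet> i)\<close> at \<open>\<one>\<close> on the cut-off i-th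
    coordinate function, which dictates the coordinates of \<open>v\<close>.\<close>
  define v where "v = (\<Sum>i\<in>Basis. (D (ext (\<lambda>b. b \<bullet> i)) \<one> / \<beta> 0) *\<^sub>R i)"
  have "D f \<one> = inv_field v f \<one>" if f: "f \<in> Cinf" for f
  proof -
    let ?f = "\<lambda>x. f x + (- f \<one>) * u x"
    have cu: "(\<lambda>x. (- f \<one>) * u x) \<in> Cinf" by (rule Cinf_scale[OF u])
    have f': "?f \<in> Cinf" "?f \<one> = 0" using Cinf_add[OF f cu] by (auto simp: u_def)
    have "D ?f \<one> = D f \<one> + D (\<lambda>x. (- f \<one>) * u x) \<one>" by (rule Dadd[OF f cu])
    also have "\<dots> = D f \<one>" by (simp only: Dscale[OF u] Du mult_zero_right add_0_right)
    finally have "D ?f \<one> = D f \<one>" .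
    moreover have "inv_field i ?f \<one> = inv_field i f \<one>" for i
    proof (rule inv_field_eqI[OF f'(1) one_closed])
      have "((\<lambda>b. f (\<one> \<otimes> par b) + - f \<one>) has_derivative (\<lambda>v. inv_field v f \<one> + 0)) (at 0)"
        by (intro has_derivative_add inv_field_translate_has_derivative f) auto
      then have "((\<lambda>b. ?f (\<one> \<otimes> par b)) has_derivative (\<lambda>v. inv_field v f \<one> + 0)) (at 0)"
        by (rule has_derivative_transform_within_open[OF _ open_cdom zero_in_cdom])
          (simp add: u_def par_in_carrier)
      then show "((\<lambda>b. ?f (\<one> \<otimes> par b)) has_derivative (\<lambda>v. inv_field v f \<one>)) (at 0)"
        by (simp only: add_0_right)
    qed
    ultimately have "D f \<one> = (\<Sum>i\<in>Basis. inv_field i f \<one> * D (ext (\<lambda>b. b \<bullet> i)) \<one>) / \<beta> 0"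
      using central[OF f'] by simp
    also have "\<dots> = inv_field v f \<one>"
      unfolding v_def
      by (simp add: linear_sum[OF inv_field_linear[OF f one_closed]] inv_field_scale_vec sum_divide_distrib mult_ac)
    finally show ?thesis .
  qed
  then show thesis using that by blast
qed

lemma left_translate_at_one: "x \<in> carrier G \<Longrightarrow> left_translate G x f \<one> = f x"
  by (simp add: left_translate_def)

text \<open>Left invariance turns the value at \<open>x\<close> into the value at
  \<open>\<one>\<close> on a translated function.\<close>

lemma left_invariant_eqI:
  assumes D: "D \<in> lie_algebra G X A" and E: "E \<in> lie_algebra G X A"
    and eq: "\<And>f. f \<in> Cinf \<Longrightarrow> D f \<one> = E f \<one>"
  shows "D = E"
proof (intro ext)
  fix f x
  show "D f x = E f x"
  proof (cases "f \<in> Cinf")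
    case True
    have D': "D f \<in> Cinf" "E f \<in> Cinf"
      using D E True by (auto simp: lie_algebra_def vector_field_def)
    show ?thesis
    proof (cases "x \<in> carrier G")
      case x: True
      have "D f x = D (left_translate G x f) \<one>" "E f x = E (left_translate G x f) \<one>"
        using D E True x by (simp_all add: lie_algebra_def left_translate_at_one)
      then show ?thesis using eq[OF Cinf_left_translate[OF True x]] by simp
    next
      case False
      then show ?thesis using D' by (simp add: smooth_functionsD(2) carrier_eq)
    qed
  next
    case False
    then show ?thesis using D E by (simp add: lie_algebra_def vector_field_def)
  qed
qed

lemma lie_algebra_eq: "lie_algebra G X A = range inv_field"
proof (intro equalityI subsetI)
  fix D assume D: "D \<in> lie_algebra G X A"
  then have "vector_field X A D" by (simp add: lie_algebra_def)
  then obtain v where "\<And>f. f \<in> Cinf \<Longrightarrow> D f \<one> = inv_field v f \<one>"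
    using derivation_at_one by blast
  then have "D = inv_field v" by (intro left_invariant_eqI D inv_field_in_lie_algebra)
  then show "D \<in> range inv_field" by blast
qed (use inv_field_in_lie_algebra in auto)

text \<open>Test on the cut-off of the linear function \<open>\<lambda>b. b \<bullet> v\<close>,
  where the field takes the value \<open>\<beta> 0 * (v \<bullet> v)\<close> at
  \<open>\<one>\<close>.\<close>

lemma inv_field_eq_zero:
  assumes "inv_field v = (\<lambda>f x. 0)"
  shows "v = 0"
proof -
  obtain r \<beta> where r: "r > 0" "ball 0 r \<subseteq> cdom" and \<beta>: "smooth_on UNIV \<beta>" "\<beta> 0 > 0"
    "(\<beta> has_derivative (\<lambda>_. 0)) (at 0)"
    and cut: "\<forall>g. smooth_on (ball 0 r) g \<longrightarrow> cutoff r \<beta> g \<in> Cinf"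
    using smooth_cutoff by (elim exE conjE)
  let ?f = "cutoff r \<beta> (\<lambda>b. b \<bullet> v)"
  have f: "?f \<in> Cinf"
    by (intro cut[rule_format] smooth_on_linear bounded_linear_inner_left)
  have "((\<lambda>b. \<beta> b * (b \<bullet> v)) has_derivative (\<lambda>h. \<beta> 0 * (h \<bullet> v) + 0 * (0 \<bullet> v))) (at 0)"
    by (intro has_derivative_mult \<beta>(3)) (auto intro!: derivative_eq_intros)
  then have "((\<lambda>b. \<beta> b * (b \<bullet> v)) has_derivative (\<lambda>h. \<beta> 0 * (h \<bullet> v))) (at 0)" by simp
  then have "((\<lambda>b. ?f (\<one> \<otimes> par b)) has_derivative (\<lambda>h. \<beta> 0 * (h \<bullet> v))) (at 0)"
    by (rule has_derivative_transform_within_open[OF _ open_ball centre_in_ball[THEN iffD2, OF r(1)]])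
      (use r(2) in \<open>auto simp: cutoff_def par_in_V par_in_carrier coord_par subset_iff\<close>)
  from inv_field_eqI[OF f one_closed this, of v] assms
  show "v = 0" using \<beta>(2) by simp
qed

lemma inv_field_inject: "inv_field v = inv_field w \<Longrightarrow> v = w"
proof -
  assume "inv_field v = inv_field w"
  then have "inv_field (v + (-1) *\<^sub>R w) = (\<lambda>f x. 0)"
    unfolding fun_eq_iff inv_field_add_vec inv_field_scale_vec by simp
  from inv_field_eq_zero[OF this] show "v = w" by simp
qed

end

section \<open>The bracket in coordinates\<close>

context lie_group_chart
begin

text \<open>The group operations in coordinates, each on the open set where all intermediate results
  stay in the chart; outside it \<open>par\<close> and \<open>coord\<close> are not inverse to each
  other.\<close>

definition mul_dom :: "('e \<times> 'e) set" where
  "mul_dom = {p \<in> cdom \<times> cdom. par (fst p) \<otimes> par (snd p) \<in> V}"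
definition mul :: "'e \<times> 'e \<Rightarrow> 'e" where "mul p = coord (par (fst p) \<otimes> par (snd p))"
definition inv_dom :: "'e set" where "inv_dom = {a \<in> cdom. inv (par a) \<in> V}"
definition minv :: "'e \<Rightarrow> 'e" where "minv a = coord (inv (par a))"
definition conj_dom :: "('e \<times> 'e) set" where
  "conj_dom = {p \<in> mul_dom. fst p \<in> inv_dom \<and> (mul p, minv (fst p)) \<in> mul_dom}"
definition conj_map :: "'e \<times> 'e \<Rightarrow> 'e" where "conj_map p = mul (mul p, minv (fst p))"

lemma cont_par_mult: "continuous_map (top_of_set (cdom \<times> cdom)) X (\<lambda>p. par (fst p) \<otimes> par (snd p))"
  by (intro cont_mult2 continuous_map_compose[OF _ cont_par, unfolded o_def])
    (auto simp: continuous_map_in_subtopology intro!: continuous_intros)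

lemma open_mul_dom: "open mul_dom"
  unfolding mul_dom_def
  by (rule open_continuous_map_preimage[OF _ cont_par_mult chart_onD(1)[OF V_chart]])
    (simp add: open_Times open_cdom)

lemma open_inv_dom: "open inv_dom"
  unfolding inv_dom_def
  by (rule open_continuous_map_preimage[OF open_cdom cont_inv2[OF cont_par] chart_onD(1)[OF V_chart]])

lemma smooth_mul: "smooth_on mul_dom mul"
proof -
  let ?m = "\<lambda>(x, y). x \<otimes> y"
  let ?S = "map_prod \<psi> \<psi> ` ((V \<times> V) \<inter> ?m -` V)"
  have "(V \<times> V, map_prod \<psi> \<psi>) \<in> prod_atlas A A" using V_in by (auto simp: prod_atlas_def)
  then have s: "smooth_on ?S (\<lambda>p. \<psi> (?m (inv_into (V \<times> V) (map_prod \<psi> \<psi>) p)))"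
    using smooth_mult V_in unfolding smooth_map_def by fast
  have sh: "smooth_on mul_dom (\<lambda>p. (fst p + \<psi> \<one>, snd p + \<psi> \<one>))"
    by (intro smooth_on_Pair smooth_on_add open_mul_dom smooth_on_linear bounded_linear_fst
        bounded_linear_snd smooth_on_const)
  have inj: "inj_on \<psi> V" by (rule chart_onD(3)[OF V_chart])
  have pp: "\<psi> (par a) = a + \<psi> \<one>" if "a \<in> cdom" for a
    using coord_par[OF that] by (simp add: coord_def algebra_simps)
  have "smooth_on mul_dom (\<lambda>p. \<psi> (?m (inv_into (V \<times> V) (map_prod \<psi> \<psi>) (fst p + \<psi> \<one>, snd p + \<psi> \<one>))))"
  proof (rule smooth_on_compose[OF open_mul_dom sh s])
    show "(\<lambda>p. (fst p + \<psi> \<one>, snd p + \<psi> \<one>)) ` mul_dom \<subseteq> ?S"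
    proof clarify
      fix a b assume ab: "(a, b) \<in> mul_dom"
      then have "(par a, par b) \<in> (V \<times> V) \<inter> ?m -` V" by (auto simp: mul_dom_def par_in_V)
      then have "map_prod \<psi> \<psi> (par a, par b) \<in> ?S" by (rule imageI)
      then show "(fst (a, b) + \<psi> \<one>, snd (a, b) + \<psi> \<one>) \<in> ?S"
        using ab by (simp add: mul_dom_def pp)
    qed
  qed
  then have "smooth_on mul_dom (\<lambda>p. \<psi> (?m (inv_into (V \<times> V) (map_prod \<psi> \<psi>) (fst p + \<psi> \<one>, snd p + \<psi> \<one>))) - \<psi> \<one>)"
    by (intro smooth_on_diff open_mul_dom smooth_on_const)
  then show ?thesis
    by (rule smooth_on_cong[OF _ open_mul_dom])
      (auto simp: mul_def coord_def mul_dom_def cdom_def par_def inv_into_map_prod[OF inj inj])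
qed

lemma smooth_minv: "smooth_on inv_dom minv"
proof -
  let ?S = "\<psi> ` (V \<inter> (\<lambda>x. inv x) -` V)"
  have s: "smooth_on ?S (\<lambda>a. \<psi> (inv (inv_into V \<psi> a)))"
    using smooth_inv V_in unfolding smooth_map_def by fast
  have "smooth_on inv_dom (\<lambda>a. \<psi> (inv (inv_into V \<psi> (a + \<psi> \<one>))))"
    by (rule smooth_on_shift[OF s _ _ _ open_inv_dom]) (auto simp: inv_dom_def par_in_V)
  then have "smooth_on inv_dom (\<lambda>a. \<psi> (inv (inv_into V \<psi> (a + \<psi> \<one>))) - \<psi> \<one>)"
    by (intro smooth_on_diff open_inv_dom smooth_on_const)
  then show ?thesis by (simp add: minv_def[abs_def] coord_def par_def)
qed

lemma par_mul: "p \<in> mul_dom \<Longrightarrow> par (mul p) = par (fst p) \<otimes> par (snd p)"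
  by (simp add: mul_def mul_dom_def par_coord)

lemma mul_in_cdom: "p \<in> mul_dom \<Longrightarrow> mul p \<in> cdom"
  by (simp add: mul_def mul_dom_def coord_in_cdom)

lemma par_minv: "a \<in> inv_dom \<Longrightarrow> par (minv a) = inv (par a)"
  by (simp add: minv_def inv_dom_def par_coord)

lemma minv_in_cdom: "a \<in> inv_dom \<Longrightarrow> minv a \<in> cdom"
  by (simp add: minv_def inv_dom_def coord_in_cdom)

lemma par_conj: "p \<in> conj_dom \<Longrightarrow> par (conj_map p) = par (fst p) \<otimes> par (snd p) \<otimes> inv (par (fst p))"
  by (simp add: conj_map_def conj_dom_def par_mul par_minv)

lemma conj_in_cdom: "p \<in> conj_dom \<Longrightarrow> conj_map p \<in> cdom"
  by (simp add: conj_map_def conj_dom_def mul_in_cdom)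

lemma open_conj_dom: "open conj_dom"
proof -
  let ?S = "mul_dom \<inter> inv_dom \<times> UNIV"
  have op: "open ?S" by (simp add: open_Int open_mul_dom open_Times open_inv_dom)
  have "continuous_on ?S (\<lambda>p. (mul p, minv (fst p)))"
    by (intro continuous_intros continuous_on_subset[OF smooth_on_imp_continuous_on[OF smooth_mul]]
        continuous_on_compose2[OF smooth_on_imp_continuous_on[OF smooth_minv]]) auto
  then have "open (?S \<inter> (\<lambda>p. (mul p, minv (fst p))) -` mul_dom)"
    by (rule continuous_open_preimage[OF _ op open_mul_dom])
  also have "?S \<inter> (\<lambda>p. (mul p, minv (fst p))) -` mul_dom = conj_dom"
    by (auto simp: conj_dom_def)
  finally show ?thesis .
qed

lemma smooth_conj: "smooth_on conj_dom conj_map"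
  unfolding conj_map_def[abs_def]
proof (rule smooth_on_compose[OF open_conj_dom _ smooth_mul])
  show "smooth_on conj_dom (\<lambda>p. (mul p, minv (fst p)))"
    by (intro smooth_on_Pair open_conj_dom smooth_on_subset[OF smooth_mul]
        smooth_on_compose[OF open_conj_dom _ smooth_minv] smooth_on_linear bounded_linear_fst)
      (auto simp: conj_dom_def)
qed (auto simp: conj_dom_def)

lemma zero_in_inv_dom: "0 \<in> inv_dom"
  using zero_in_cdom one_in_V by (simp add: inv_dom_def par_zero)

lemma inv_dom_subset: "inv_dom \<subseteq> cdom" by (auto simp: inv_dom_def)

lemma mul_zero_right: "a \<in> cdom \<Longrightarrow> (a, 0) \<in> mul_dom \<and> mul (a, 0) = a"
  by (simp add: mul_dom_def mul_def zero_in_cdom par_zero par_in_carrier par_in_V coord_par)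

lemma mul_zero_left: "a \<in> cdom \<Longrightarrow> (0, a) \<in> mul_dom \<and> mul (0, a) = a"
  by (simp add: mul_dom_def mul_def zero_in_cdom par_zero par_in_carrier par_in_V coord_par)

lemma mul_minv: "a \<in> inv_dom \<Longrightarrow> (a, minv a) \<in> mul_dom \<and> mul (a, minv a) = 0"
  using par_in_carrier[of a]
  by (auto simp: mul_dom_def mul_def minv_in_cdom par_minv one_in_V coord_one inv_dom_def)

lemma minv_zero: "minv 0 = 0"
  by (simp add: minv_def par_zero coord_one)

lemma conj_zero_right: "a \<in> inv_dom \<Longrightarrow> (a, 0) \<in> conj_dom \<and> conj_map (a, 0) = 0"
  using mul_zero_right[of a] mul_minv[of a] inv_dom_subset by (auto simp: conj_dom_def conj_map_def)

lemma conj_zero_left: "(0, b) \<in> conj_dom \<Longrightarrow> conj_map (0, b) = b"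
  using mul_zero_left[of b] mul_zero_right[of b]
  by (auto simp: conj_dom_def conj_map_def mul_dom_def minv_zero)

text \<open>Cancellation in the group. The relation ties conjugation to \<open>mul\<close> alone, so
  that \<open>ad\<close> can be read off from second derivatives of \<open>mul\<close>.\<close>

lemma mul_conj:
  assumes "(a, b) \<in> conj_dom"
  shows "(conj_map (a, b), a) \<in> mul_dom" "mul (conj_map (a, b), a) = mul (a, b)"
proof -
  have ab: "a \<in> cdom" "b \<in> cdom" "par a \<otimes> par b \<in> V" using assms by (auto simp: conj_dom_def mul_dom_def)
  have "par (conj_map (a, b)) \<otimes> par a = par a \<otimes> par b"
    using par_conj[OF assms] ab par_in_carrier by (simp add: m_assoc)
  then show "(conj_map (a, b), a) \<in> mul_dom" "mul (conj_map (a, b), a) = mul (a, b)"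
    using ab conj_in_cdom[OF assms] by (simp_all add: mul_dom_def mul_def)
qed

text \<open>\<open>Ad a\<close> is the differential at \<open>\<one>\<close> of conjugation by
  \<open>par a\<close>, and \<open>ad\<close> is its derivative in \<open>a\<close>.
  \<open>mul2\<close> is the mixed second-order term of the multiplication: a b = a + b +
  \<open>mul2 a b\<close> up to third order.\<close>

definition Ad :: "'e \<Rightarrow> 'e \<Rightarrow> 'e" where "Ad a v = frechet_derivative conj_map (at (a, 0)) (0, v)"
definition ad :: "'e \<Rightarrow> 'e \<Rightarrow> 'e" where "ad w v = frechet_derivative (\<lambda>a. Ad a v) (at 0) w"
definition mul2 :: "'e \<Rightarrow> 'e \<Rightarrow> 'e" where
  "mul2 w v = frechet_derivative (\<lambda>z. frechet_derivative mul (at z) (0, v)) (at (0, 0)) (w, 0)"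

lemma has_derivative_Pair_const:
  "((\<lambda>b. (a, b)) has_derivative (\<lambda>h. (0, h))) (at x within S)" "((\<lambda>b. (b, a)) has_derivative (\<lambda>h. (h, 0))) (at x within S)"
proof -
  show "((\<lambda>b. (a, b)) has_derivative (\<lambda>h. (0, h))) (at x within S)"
    by (intro has_derivative_Pair has_derivative_const has_derivative_ident)
  show "((\<lambda>b. (b, a)) has_derivative (\<lambda>h. (h, 0))) (at x within S)"
    by (intro has_derivative_Pair has_derivative_const has_derivative_ident)
qed

lemma Ad_has_derivative:
  assumes "a \<in> inv_dom"
  shows "((\<lambda>b. conj_map (a, b)) has_derivative Ad a) (at 0)"
proof -
  have "(conj_map has_derivative frechet_derivative conj_map (at (a, 0))) (at (a, 0))"
    using smooth_on_has_derivative[OF smooth_conj] conj_zero_right[OF assms] by blast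
  from has_derivative_compose[OF has_derivative_Pair_const(1) this]
  show ?thesis by (simp add: Ad_def[abs_def])
qed

lemma linear_Ad: "a \<in> inv_dom \<Longrightarrow> linear (Ad a)"
  using Ad_has_derivative has_derivative_linear by blast

lemma smooth_Ad: "smooth_on inv_dom (\<lambda>a. Ad a v)"
  unfolding Ad_def
  by (rule smooth_on_compose[where f = "\<lambda>a. (a, 0)" and g = "\<lambda>p. frechet_derivative conj_map (at p) (0, v)",
        OF open_inv_dom _ smooth_on_frechet_derivative[OF smooth_conj]])
    (use conj_zero_right in \<open>auto intro!: smooth_on_Pair open_inv_dom smooth_on_id smooth_on_const\<close>)

lemma Ad_zero: "Ad 0 v = v"
proof -
  have "open {b. (0, b) \<in> conj_dom}"
    using continuous_open_preimage[of UNIV "\<lambda>b. (0, b)", OF _ open_UNIV open_conj_dom]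
    by (simp add: vimage_def continuous_on_Pair)
  from has_derivative_transform_within_open[OF Ad_has_derivative[OF zero_in_inv_dom] this]
  have "((\<lambda>b. b) has_derivative Ad 0) (at 0)"
    using conj_zero_right[OF zero_in_inv_dom] conj_zero_left by auto
  then show ?thesis using has_derivative_unique[OF _ has_derivative_ident] by metis
qed

lemma mul_has_derivative: "p \<in> mul_dom \<Longrightarrow> (mul has_derivative frechet_derivative mul (at p)) (at p)"
  by (rule smooth_on_has_derivative[OF smooth_mul])

lemma mul_derivative_zero_right: "frechet_derivative mul (at (0, 0)) (u, 0) = u"
proof -
  have "(mul has_derivative frechet_derivative mul (at (0, 0))) (at (0, 0))"
    using mul_has_derivative mul_zero_right zero_in_cdom by blast
  from has_derivative_compose[OF has_derivative_Pair_const(2) this]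
  have "((\<lambda>b. mul (b, 0)) has_derivative (\<lambda>h. frechet_derivative mul (at (0, 0)) (h, 0))) (at 0)" .
  from has_derivative_transform_within_open[OF this open_cdom zero_in_cdom, of "\<lambda>b. b"]
  show ?thesis
    using mul_zero_right has_derivative_unique[OF _ has_derivative_ident] by metis
qed

lemma mul_derivative_zero_left: "frechet_derivative mul (at (0, 0)) (0, u) = u"
proof -
  have "(mul has_derivative frechet_derivative mul (at (0, 0))) (at (0, 0))"
    using mul_has_derivative mul_zero_right zero_in_cdom by blast
  from has_derivative_compose[OF has_derivative_Pair_const(1) this]
  have "((\<lambda>b. mul (0, b)) has_derivative (\<lambda>h. frechet_derivative mul (at (0, 0)) (0, h))) (at 0)" .
  from has_derivative_transform_within_open[OF this open_cdom zero_in_cdom, of "\<lambda>b. b"]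
  show ?thesis
    using mul_zero_left has_derivative_unique[OF _ has_derivative_ident] by metis
qed

text \<open>Differentiate \<open>(a b a\<^sup>-\<^sup>1) a = a b\<close> first in \<open>b\<close>, then in \<open>a\<close>, at \<open>0\<close>.\<close>

lemma ad_eq: "ad w v = mul2 w v - mul2 v w"
proof -
  let ?D = "\<lambda>z. frechet_derivative mul (at z)"
  have z0: "(0, 0) \<in> mul_dom" using mul_zero_right zero_in_cdom by blast
  \<comment> \<open>The result of differentiating in \<open>b\<close>. The left factor passes
    through \<open>0\<close> at \<open>b = 0\<close>, so \<open>mul\<close> is differentiated at
    \<open>(0, a)\<close> in its first slot, along \<open>Ad a v\<close>.\<close>
  have eq: "?D (0, a) (Ad a v, 0) = ?D (a, 0) (0, v)" if a: "a \<in> inv_dom" for a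
  proof -
    have a': "a \<in> cdom" using a inv_dom_subset by blast
    have op: "open {b. (a, b) \<in> conj_dom}"
      using continuous_open_preimage[of UNIV "\<lambda>b. (a, b)", OF _ open_UNIV open_conj_dom]
      by (simp add: vimage_def continuous_on_Pair)
    have "((\<lambda>b. (conj_map (a, b), a)) has_derivative (\<lambda>h. (Ad a h, 0))) (at 0)"
      by (intro has_derivative_Pair Ad_has_derivative a has_derivative_const)
    moreover have "(mul has_derivative ?D (0, a)) (at (conj_map (a, 0), a))"
      using mul_has_derivative mul_zero_left[OF a'] conj_zero_right[OF a] by simp
    ultimately have "((\<lambda>b. mul (conj_map (a, b), a)) has_derivative (\<lambda>h. ?D (0, a) (Ad a h, 0))) (at 0)"
      by (rule has_derivative_compose)
    from has_derivative_transform_within_open[OF this op, of "\<lambda>b. mul (a, b)"]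
    have "((\<lambda>b. mul (a, b)) has_derivative (\<lambda>h. ?D (0, a) (Ad a h, 0))) (at 0)"
      using mul_conj(2) conj_zero_right[OF a] by auto
    moreover have "((\<lambda>b. mul (a, b)) has_derivative (\<lambda>h. ?D (a, 0) (0, h))) (at 0)"
      by (rule has_derivative_compose[OF has_derivative_Pair_const(1)])
        (use mul_has_derivative mul_zero_right[OF a'] in blast)
    ultimately show ?thesis using has_derivative_unique by metis
  qed
  have Adv: "((\<lambda>a. Ad a v) has_derivative (\<lambda>h. ad h v)) (at 0)"
    using smooth_on_has_derivative[OF smooth_Ad zero_in_inv_dom] by (simp add: ad_def)
  have "((\<lambda>a. ?D (0, a) (Ad a v, 0)) has_derivative
     (\<lambda>h. ?D (0, 0) (ad h v, 0) + frechet_derivative (\<lambda>z. ?D z (Ad 0 v, 0)) (at (0, 0)) (0, h))) (at 0)"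
    using has_derivative_frechet_apply[OF smooth_mul open_mul_dom _ has_derivative_Pair_const(1)
        has_derivative_Pair[OF Adv has_derivative_const], of 0 0] z0 by simp
  then have 1: "((\<lambda>a. ?D (a, 0) (0, v)) has_derivative
     (\<lambda>h. ad h v + frechet_derivative (\<lambda>z. ?D z (v, 0)) (at (0, 0)) (0, h))) (at 0)"
    using has_derivative_transform_within_open[OF _ open_inv_dom zero_in_inv_dom eq]
    by (simp add: Ad_zero mul_derivative_zero_right)
  have 2: "((\<lambda>a. ?D (a, 0) (0, v)) has_derivative (\<lambda>h. mul2 h v)) (at 0)"
    unfolding mul2_def
    by (rule has_derivative_compose[where g = "\<lambda>p. ?D p (0, v)", OF has_derivative_Pair_const(2)])
      (rule smooth_on_has_derivative[OF smooth_on_frechet_derivative[OF smooth_mul] z0])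
  have "mul2 w v = ad w v + frechet_derivative (\<lambda>z. ?D z (v, 0)) (at (0, 0)) (0, w)"
    using has_derivative_unique[OF 1 2] by metis
  \<comment> \<open>Here the first slot was differentiated before the second; symmetry of second
    derivatives exchanges them.\<close>
  also have "frechet_derivative (\<lambda>z. ?D z (v, 0)) (at (0, 0)) (0, w) = mul2 v w"
    unfolding mul2_def by (rule second_derivative_symmetric[OF open_mul_dom z0 smooth_mul])
  finally show ?thesis by simp
qed

text \<open>The chain rule for \<open>f (par (mul (a, b)))\<close> in \<open>b\<close>: in
  coordinates the field of \<open>v\<close> is the derivative of \<open>mul\<close> in its second
  slot along \<open>v\<close>.\<close>

lemma inv_field_par:
  assumes f: "f \<in> Cinf" and a: "a \<in> cdom"
  shows "inv_field v f (par a) =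
    frechet_derivative (\<lambda>b. f (par b)) (at a) (frechet_derivative mul (at (a, 0)) (0, v))"
proof (rule inv_field_eqI[OF f par_in_carrier[OF a]])
  have op: "open {b. (a, b) \<in> mul_dom}"
    using continuous_open_preimage[of UNIV "\<lambda>b. (a, b)", OF _ open_UNIV open_mul_dom]
    by (simp add: vimage_def continuous_on_Pair)
  have "((\<lambda>b. mul (a, b)) has_derivative (\<lambda>h. frechet_derivative mul (at (a, 0)) (0, h))) (at 0)"
    by (rule has_derivative_compose[OF has_derivative_Pair_const(1)])
      (use mul_has_derivative mul_zero_right[OF a] in blast)
  moreover have "((\<lambda>b. f (par b)) has_derivative frechet_derivative (\<lambda>b. f (par b)) (at a)) (at (mul (a, 0)))"
    using smooth_on_has_derivative[OF smooth_on_par[OF f] a] mul_zero_right[OF a] by simp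
  ultimately have "((\<lambda>b. f (par (mul (a, b)))) has_derivative
      (\<lambda>h. frechet_derivative (\<lambda>b. f (par b)) (at a) (frechet_derivative mul (at (a, 0)) (0, h)))) (at 0)"
    by (rule has_derivative_compose)
  then show "((\<lambda>b. f (par a \<otimes> par b)) has_derivative
      (\<lambda>h. frechet_derivative (\<lambda>b. f (par b)) (at a) (frechet_derivative mul (at (a, 0)) (0, h)))) (at 0)"
    by (rule has_derivative_transform_within_open[OF _ op])
      (use mul_zero_right[OF a] par_mul in auto)
qed

lemma inv_field_one:
  assumes "f \<in> Cinf"
  shows "inv_field v f \<one> = frechet_derivative (\<lambda>b. f (par b)) (at 0) v"
  using inv_field_par[OF assms zero_in_cdom] by (simp add: par_zero mul_derivative_zero_left)

text \<open>The first summand comes from the variation of the inner field, the second is the Hessian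
  of \<open>f\<close>. The Hessian is symmetric, so it drops out of the commutator.\<close>

lemma inv_field_inv_field:
  assumes f: "f \<in> Cinf"
  shows "inv_field w (inv_field v f) \<one> = frechet_derivative (\<lambda>b. f (par b)) (at 0) (mul2 w v) +
     frechet_derivative (\<lambda>z. frechet_derivative (\<lambda>b. f (par b)) (at z) v) (at 0) w"
proof -
  let ?f = "\<lambda>b. f (par b)" and ?D = "\<lambda>z. frechet_derivative mul (at z)"
  have z0: "(0, 0) \<in> mul_dom" using mul_zero_right zero_in_cdom by blast
  have 2: "((\<lambda>a. ?D (a, 0) (0, v)) has_derivative (\<lambda>h. mul2 h v)) (at 0)"
    unfolding mul2_def
    by (rule has_derivative_compose[where g = "\<lambda>p. ?D p (0, v)", OF has_derivative_Pair_const(2)])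
      (rule smooth_on_has_derivative[OF smooth_on_frechet_derivative[OF smooth_mul] z0])
  from has_derivative_frechet_apply[OF smooth_on_par[OF f] open_cdom _ has_derivative_ident this] zero_in_cdom
  have "((\<lambda>a. frechet_derivative ?f (at a) (?D (a, 0) (0, v))) has_derivative
     (\<lambda>h. frechet_derivative ?f (at 0) (mul2 h v) + frechet_derivative (\<lambda>z. frechet_derivative ?f (at z) v) (at 0) h)) (at 0)"
    by (simp add: mul_derivative_zero_left)
  then have "((\<lambda>a. inv_field v f (par a)) has_derivative
     (\<lambda>h. frechet_derivative ?f (at 0) (mul2 h v) + frechet_derivative (\<lambda>z. frechet_derivative ?f (at z) v) (at 0) h)) (at 0)"
    by (rule has_derivative_transform_within_open[OF _ open_cdom zero_in_cdom]) (simp add: inv_field_par[OF f])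
  from frechet_derivative_eqI[OF this] show ?thesis
    by (simp add: inv_field_one[OF Cinf_inv_field[OF f]])
qed

text \<open>At \<open>\<one>\<close> the Hessians cancel and the antisymmetrised \<open>mul2\<close>
  remains, which is \<open>ad\<close>. Translating the function carries this to every point.\<close>

lemma lie_bracket_inv_field: "lie_bracket (inv_field w) (inv_field v) = inv_field (ad w v)"
proof (intro ext)
  fix f x
  have one: "inv_field w (inv_field v f) \<one> - inv_field v (inv_field w f) \<one> = inv_field (ad w v) f \<one>"
    if f: "f \<in> Cinf" for f
  proof -
    let ?f = "\<lambda>b. f (par b)"
    have "linear (frechet_derivative ?f (at 0))"
      using smooth_on_has_derivative[OF smooth_on_par[OF f] zero_in_cdom] has_derivative_linear by blast
    moreover have "frechet_derivative (\<lambda>z. frechet_derivative ?f (at z) v) (at 0) w =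
        frechet_derivative (\<lambda>z. frechet_derivative ?f (at z) w) (at 0) v"
      by (rule second_derivative_symmetric[OF open_cdom zero_in_cdom smooth_on_par[OF f]])
    ultimately show ?thesis
      by (simp add: inv_field_inv_field[OF f] inv_field_one[OF f] ad_eq linear_diff)
  qed
  show "lie_bracket (inv_field w) (inv_field v) f x = inv_field (ad w v) f x"
  proof (cases "f \<in> Cinf \<and> x \<in> carrier G")
    case True
    then have t: "inv_field u (inv_field u' f) x = inv_field u (inv_field u' (left_translate G x f)) \<one>"
      "inv_field u f x = inv_field u (left_translate G x f) \<one>" for u u'
      by (simp_all add: inv_field_left_translate Cinf_inv_field left_translate_at_one)
    show ?thesis
      unfolding lie_bracket_def t using one[OF Cinf_left_translate] True by simp
  next
    case False
    \<comment> \<open>For \<open>f\<close> outside \<open>Cinf\<close> the inner field returns the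
      zero function. That function is smooth, so the outer field has to be evaluated on it.\<close>
    have z: "inv_field u (\<lambda>x. 0) y = 0" for u y
      using vector_field_inv_field[of u] Cinf_zero inv_field_eqI[OF Cinf_zero _ has_derivative_const, of y u]
      by (cases "y \<in> carrier G") (auto simp: inv_field_def)
    have "f \<notin> Cinf \<Longrightarrow> inv_field u f = (\<lambda>x. 0)" for u by (auto simp: inv_field_def)
    then show ?thesis using False z by (auto simp: lie_bracket_def) (auto simp: inv_field_def)
  qed
qed

text \<open>Conjugation by elements near \<open>\<one>\<close> fixes a neighbourhood of
  \<open>\<one>\<close>, so \<open>Ad a\<close> is the identity for \<open>a\<close> near
  \<open>0\<close> and its derivative in \<open>a\<close> vanishes.\<close>

lemma commuting_neighbourhood_imp_ad_zero:
  assumes U: "openin X U" "\<one> \<in> U" and comm: "\<And>x y. x \<in> U \<Longrightarrow> y \<in> U \<Longrightarrow> x \<otimes> y = y \<otimes> x"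
  shows "ad w v = 0"
proof -
  let ?T = "{a \<in> cdom. par a \<in> U}"
  have op: "open ?T" by (rule open_continuous_map_preimage[OF open_cdom cont_par U(1)])
  have z: "0 \<in> ?T" using zero_in_cdom U(2) by (simp add: par_zero)
  have "Ad a v = v" if a: "a \<in> ?T \<inter> inv_dom" for a
  proof -
    have "open {b. (a, b) \<in> conj_dom}"
      using continuous_open_preimage[of UNIV "\<lambda>b. (a, b)", OF _ open_UNIV open_conj_dom]
      by (simp add: vimage_def continuous_on_Pair)
    then have "open (?T \<inter> {b. (a, b) \<in> conj_dom})" using op by blast
    moreover have "0 \<in> ?T \<inter> {b. (a, b) \<in> conj_dom}" using z conj_zero_right a by blast
    moreover have "conj_map (a, b) = b" if b: "b \<in> ?T \<inter> {b. (a, b) \<in> conj_dom}" for b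
    proof -
      have c: "par a \<in> carrier G" "par b \<in> carrier G" using a b par_in_carrier by auto
      have "par a \<otimes> par b = par b \<otimes> par a" using a b comm by blast
      then have "par (conj_map (a, b)) = par b \<otimes> par a \<otimes> inv par a"
        using b par_conj[of "(a, b)"] by simp
      also have "\<dots> = par b" using c by (simp add: m_assoc)
      finally have "coord (par (conj_map (a, b))) = coord (par b)" by simp
      then show ?thesis using b conj_in_cdom[of "(a, b)"] by (simp add: coord_par)
    qed
    ultimately have "((\<lambda>b. b) has_derivative Ad a) (at 0)"
      by (rule has_derivative_transform_within_open[OF Ad_has_derivative[OF IntD2[OF a]]])
    then show ?thesis using has_derivative_unique[OF _ has_derivative_ident] by metis
  qed
  then have eq: "v = Ad a v" if "a \<in> ?T \<inter> inv_dom" for a using that by metis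
  have "open (?T \<inter> inv_dom)" "0 \<in> ?T \<inter> inv_dom"
    using op open_inv_dom z zero_in_inv_dom by auto
  then have "((\<lambda>a. Ad a v) has_derivative (\<lambda>h. 0)) (at 0)"
    by (rule has_derivative_transform_within_open[OF has_derivative_const[of v] _ _ eq])
  then show ?thesis by (simp add: ad_def frechet_derivative_eqI)
qed

end

section \<open>Closed normal subgroups\<close>

text \<open>Minimality of \<open>g\<close> on \<open>N\<close> bounds \<open>L y\<close> above by
  o(|y|), minimality of \<open>h\<close> bounds it below. It is used with a distance function and
  its composite with inversion, whose derivatives at \<open>0\<close> are opposite.\<close>

lemma has_derivative_zero_within_of_minima:
  fixes L :: "'a::real_normed_vector \<Rightarrow> real"
  assumes g: "(g has_derivative (\<lambda>v. - L v)) (at 0)" and h: "(h has_derivative L) (at 0)"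
    and T: "open T" "0 \<in> T" and min: "\<And>y. y \<in> N \<inter> T \<Longrightarrow> g 0 \<le> g y \<and> h 0 \<le> h y"
  shows "(L has_derivative (\<lambda>_. 0)) (at 0 within N)"
  unfolding has_derivative_within_alt
proof (intro conjI allI impI)
  have lin: "linear L" using h has_derivative_linear by blast
  show "bounded_linear (\<lambda>_::'a. 0::real)" by (rule bounded_linear_zero)
  fix e :: real assume e: "0 < e"
  obtain d1 where d1: "d1 > 0" "\<And>y. norm y < d1 \<Longrightarrow> \<bar>g y - g 0 + L y\<bar> \<le> e * norm y"
    using g e unfolding has_derivative_at_alt by auto
  obtain d2 where d2: "d2 > 0" "\<And>y. norm y < d2 \<Longrightarrow> \<bar>h y - h 0 - L y\<bar> \<le> e * norm y"
    using h e unfolding has_derivative_at_alt by auto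
  obtain d3 where d3: "d3 > 0" "ball 0 d3 \<subseteq> T" using T openE by blast
  show "\<exists>d>0. \<forall>y\<in>N. norm (y - 0) < d \<longrightarrow> norm (L y - L 0 - 0) \<le> e * norm (y - 0)"
  proof (intro exI[of _ "min d1 (min d2 d3)"] conjI ballI impI)
    fix y assume y: "y \<in> N" "norm (y - 0) < min d1 (min d2 d3)"
    then have "y \<in> N \<inter> T" using d3 by auto
    from min[OF this] d1(2)[of y] d2(2)[of y] y(2)
    have "\<bar>L y\<bar> \<le> e * norm y" by auto
    then show "norm (L y - L 0 - 0) \<le> e * norm (y - 0)" using lin by (simp add: linear_0)
  qed (use d1 d2 d3 in auto)
qed

context lie_group_chart
begin

definition chart_part :: "'g set \<Rightarrow> 'e set" where "chart_part N = {a \<in> cdom. par a \<in> N}"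

text \<open>\<open>conormal N\<close> plays the role of the annihilator of the Lie algebra of \<open>N\<close>.\<close>

definition conormal :: "'g set \<Rightarrow> 'e set" where
  "conormal N = {z. ((\<lambda>a. z \<bullet> a) has_derivative (\<lambda>_. 0)) (at 0 within chart_part N)}"

definition tangent :: "'g set \<Rightarrow> 'e set" where "tangent N = {v. \<forall>z\<in>conormal N. z \<bullet> v = 0}"

lemma subspace_conormal: "subspace (conormal N)"
  unfolding subspace_def
proof (intro conjI ballI allI)
  have "(\<bullet>) (0::'e) = (\<lambda>_. 0)" by (rule ext) simp
  then show "0 \<in> conormal N" by (simp add: conormal_def)
  fix z w c assume z: "z \<in> conormal N"
  have "(\<bullet>) (c *\<^sub>R z) = (\<lambda>a. c * (z \<bullet> a))" by (rule ext) simp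
  then show "c *\<^sub>R z \<in> conormal N"
    using z has_derivative_mult_right[of "\<lambda>a. z \<bullet> a" "\<lambda>_. 0" "at 0 within chart_part N" c]
    by (simp add: conormal_def)
  assume w: "w \<in> conormal N"
  have "(\<bullet>) (z + w) = (\<lambda>a. z \<bullet> a + w \<bullet> a)" by (rule ext) (rule inner_add_left)
  then show "z + w \<in> conormal N"
    using z w has_derivative_add[of "\<lambda>a. z \<bullet> a" "\<lambda>_. 0" "at 0 within chart_part N" "\<lambda>a. w \<bullet> a" "\<lambda>_. 0"]
    by (simp add: conormal_def)
qed

lemma conormal_UNIV_imp_isolated:
  assumes "conormal N = UNIV" "\<one> \<in> N"
  obtains U where "openin X U" "\<one> \<in> U" "N \<inter> U = {\<one>}"
proof -
  have "((\<lambda>a. \<Sum>i\<in>Basis. (i \<bullet> a) *\<^sub>R i) has_derivative (\<lambda>h. \<Sum>i\<in>Basis. 0 *\<^sub>R i)) (at 0 within chart_part N)"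
    using assms(1) by (intro has_derivative_sum has_derivative_scaleR_left) (auto simp: conormal_def)
  then have "((\<lambda>a. a) has_derivative (\<lambda>h. 0::'e)) (at 0 within chart_part N)"
    by (simp add: inner_commute[of _ "_::'e"] euclidean_representation)
  \<comment> \<open>With the constant 1/2 the estimate forces \<open>a = 0\<close>.\<close>
  then obtain d where d: "d > 0" "\<And>a. a \<in> chart_part N \<Longrightarrow> norm a < d \<Longrightarrow> norm a \<le> 1/2 * norm a"
    unfolding has_derivative_within_alt by (auto dest!: spec[of _ "1/2"])
  let ?U = "par ` (ball 0 d \<inter> cdom)"
  have "openin X ?U" by (rule openin_par_image) (auto simp: open_cdom)
  moreover have "\<one> \<in> ?U" using d(1) zero_in_cdom par_zero by (intro image_eqI[of _ _ 0]) auto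
  moreover have "N \<inter> ?U \<subseteq> {\<one>}"
  proof
    fix x assume "x \<in> N \<inter> ?U"
    then obtain a where a: "a \<in> chart_part N" "norm a < d" "x = par a" by (auto simp: chart_part_def)
    then have "a = 0" using d(2)[OF a(1,2)] by simp
    then show "x \<in> {\<one>}" using a par_zero by simp
  qed
  ultimately show thesis using that assms(2) by blast
qed

text \<open>In finite dimension a proper subspace has a nonzero orthogonal vector, and a vector
  orthogonal to \<open>conormal N\<close> is tangent.\<close>

lemma tangent_zero_imp_conormal_UNIV:
  assumes "tangent N = {0}"
  shows "conormal N = UNIV"
proof (rule ccontr)
  assume "conormal N \<noteq> UNIV"
  moreover have "span (conormal N) = conormal N" using subspace_conormal by simp
  ultimately have "span (conormal N) \<subset> span UNIV" by (simp only: span_UNIV) blast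
  then obtain x where x: "x \<noteq> 0" "\<And>y. y \<in> span (conormal N) \<Longrightarrow> orthogonal x y"
    using orthogonal_to_subspace_exists_gen by metis
  then have "x \<in> tangent N" by (auto simp: tangent_def orthogonal_def span_base inner_commute)
  then show False using x(1) assms by auto
qed

lemma tangent_UNIV_imp_conormal_zero:
  assumes "tangent N = UNIV" "z \<in> conormal N"
  shows "z = 0"
proof -
  have "z \<in> tangent N" using assms(1) by simp
  then have "z \<bullet> z = 0" using assms(2) unfolding tangent_def by blast
  then show ?thesis by simp
qed

text \<open>The sum is the transpose of \<open>Ad a\<close> applied to \<open>z\<close>. Conjugation
  by \<open>par a\<close> maps \<open>N\<close> into itself and agrees with \<open>Ad a\<close> to
  first order, so z \<bullet> Ad a b differs by o(|b|) from the value of \<open>z\<close> at another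
  point of \<open>N\<close>, and that value is o(|b|) too.\<close>

lemma conormal_Ad:
  assumes N: "N \<lhd> G" and a: "a \<in> inv_dom" and z: "z \<in> conormal N"
  shows "(\<Sum>i\<in>Basis. (z \<bullet> Ad a i) *\<^sub>R i) \<in> conormal N"
proof -
  let ?z = "\<Sum>i\<in>Basis. (z \<bullet> Ad a i) *\<^sub>R i"
  have zz: "?z \<bullet> v = z \<bullet> Ad a v" for v
    by (simp add: linear_eq_sum_Basis[OF linear_Ad[OF a], of v] inner_sum_left inner_sum_right inner_commute mult.commute)
  define S where "S = chart_part N \<inter> {b. (a, b) \<in> conj_dom}"
  have op: "open {b. (a, b) \<in> conj_dom}"
    using continuous_open_preimage[of UNIV "\<lambda>b. (a, b)", OF _ open_UNIV open_conj_dom]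
    by (simp add: vimage_def continuous_on_Pair)
  \<comment> \<open>Restricting to a neighbourhood of \<open>0\<close>, where
    \<open>conj_map\<close> is conjugation, does not change the limit.\<close>
  have at: "at 0 within S = at 0 within chart_part N"
    by (rule at_within_nhd[OF _ op]) (use conj_zero_right[OF a] in \<open>auto simp: S_def\<close>)
  have "(\<lambda>b. conj_map (a, b)) ` S \<subseteq> chart_part N"
  proof clarify
    fix b assume b: "b \<in> S"
    have "par a \<in> carrier G" using a inv_dom_subset par_in_carrier by blast
    then have "par a \<otimes> par b \<otimes> inv (par a) \<in> N"
      using b normal.inv_op_closed2[OF N] by (auto simp: S_def chart_part_def)
    then show "conj_map (a, b) \<in> chart_part N"
      using b conj_in_cdom par_conj by (auto simp: S_def chart_part_def)
  qed
  then have "((\<lambda>b. z \<bullet> b) has_derivative (\<lambda>_. 0)) (at (conj_map (a, 0)) within (\<lambda>b. conj_map (a, b)) ` S)"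
    using z conj_zero_right[OF a] by (auto simp: conormal_def intro: has_derivative_subset)
  then have 1: "((\<lambda>b. z \<bullet> conj_map (a, b)) has_derivative (\<lambda>_. 0)) (at 0 within S)"
    by (rule has_derivative_in_compose[OF has_derivative_at_withinI[OF Ad_has_derivative[OF a], of S]])
  have "((\<lambda>b. z \<bullet> conj_map (a, b)) has_derivative (\<lambda>h. z \<bullet> Ad a h)) (at 0 within S)"
    by (rule has_derivative_inner_right[OF has_derivative_at_withinI[OF Ad_has_derivative[OF a]]])
  moreover have "((\<lambda>b. z \<bullet> Ad a b) has_derivative (\<lambda>h. z \<bullet> Ad a h)) (at 0 within S)"
    using linear_Ad[OF a] by (intro has_derivative_inner_right linear_imp_has_derivative)
  ultimately have "((\<lambda>b. z \<bullet> conj_map (a, b) - (z \<bullet> conj_map (a, b) - z \<bullet> Ad a b)) has_derivative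
      (\<lambda>h. 0 - (z \<bullet> Ad a h - z \<bullet> Ad a h))) (at 0 within S)"
    by (intro has_derivative_diff 1)
  moreover have "(\<bullet>) ?z = (\<lambda>b. z \<bullet> Ad a b)" using zz by (rule ext)
  ultimately show ?thesis by (simp add: conormal_def at)
qed

text \<open>By invariance of \<open>conormal N\<close>, the function z \<bullet> Ad a v of
  \<open>a\<close> vanishes near \<open>0\<close>; its derivative in direction \<open>w\<close> is z
  \<bullet> ad w v.\<close>

lemma tangent_ad:
  assumes N: "N \<lhd> G" and v: "v \<in> tangent N"
  shows "ad w v \<in> tangent N"
  unfolding tangent_def
proof clarify
  fix z assume z: "z \<in> conormal N"
  have zero: "z \<bullet> Ad a v = 0" if a: "a \<in> inv_dom" for a
  proof -
    have "(\<Sum>i\<in>Basis. (z \<bullet> Ad a i) *\<^sub>R i) \<bullet> v = 0"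
      using v conormal_Ad[OF N a z] unfolding tangent_def by blast
    then show ?thesis
      by (simp add: linear_eq_sum_Basis[OF linear_Ad[OF a], of v] inner_sum_left inner_sum_right inner_commute mult.commute)
  qed
  have "((\<lambda>a. Ad a v) has_derivative (\<lambda>w. ad w v)) (at 0)"
    using smooth_on_has_derivative[OF smooth_Ad zero_in_inv_dom] by (simp add: ad_def)
  then have "((\<lambda>a. z \<bullet> Ad a v) has_derivative (\<lambda>w. z \<bullet> ad w v)) (at 0)"
    by (rule has_derivative_inner_right)
  then have "((\<lambda>a. 0) has_derivative (\<lambda>w. z \<bullet> ad w v)) (at (0::'e))"
    by (rule has_derivative_transform_within_open[OF _ open_inv_dom zero_in_inv_dom]) (simp add: zero)
  from has_derivative_unique[OF this has_derivative_const] show "z \<bullet> ad w v = 0" by metis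
qed

lemma lie_ideal_tangent:
  assumes N: "N \<lhd> G"
  shows "lie_ideal (lie_algebra G X A) (inv_field ` tangent N)"
  unfolding lie_ideal_def
proof (intro conjI ballI allI)
  show "inv_field ` tangent N \<subseteq> lie_algebra G X A" using lie_algebra_eq by auto
  have "(\<lambda>f x. 0) = inv_field 0" by (auto simp: fun_eq_iff inv_field_zero_vec)
  moreover have "0 \<in> tangent N" by (simp add: tangent_def)
  ultimately show "(\<lambda>f x. 0) \<in> inv_field ` tangent N" by blast
next
  fix D E assume "D \<in> inv_field ` tangent N" "E \<in> inv_field ` tangent N"
  then obtain v w where vw: "v \<in> tangent N" "w \<in> tangent N" "D = inv_field v" "E = inv_field w" by blast
  then have "(\<lambda>f x. D f x + E f x) = inv_field (v + w)" by (auto simp: fun_eq_iff inv_field_add_vec)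
  moreover have "v + w \<in> tangent N" using vw by (simp add: tangent_def inner_add_right)
  ultimately show "(\<lambda>f x. D f x + E f x) \<in> inv_field ` tangent N" by blast
next
  fix c D assume "D \<in> inv_field ` tangent N"
  then obtain v where v: "v \<in> tangent N" "D = inv_field v" by blast
  then have "(\<lambda>f x. c * D f x) = inv_field (c *\<^sub>R v)" by (auto simp: fun_eq_iff inv_field_scale_vec)
  moreover have "c *\<^sub>R v \<in> tangent N" using v by (simp add: tangent_def)
  ultimately show "(\<lambda>f x. c * D f x) \<in> inv_field ` tangent N" by blast
next
  fix D E assume "D \<in> lie_algebra G X A" "E \<in> inv_field ` tangent N"
  then obtain w v where "D = inv_field w" "v \<in> tangent N" "E = inv_field v" by (auto simp: lie_algebra_eq)
  then show "lie_bracket D E \<in> inv_field ` tangent N"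
    using lie_bracket_inv_field tangent_ad[OF N] by blast
qed

text \<open>Differentiate \<open>mul (a, minv a) = 0\<close>; the derivative of \<open>mul\<close>
  at the origin is addition.\<close>

lemma minv_has_derivative: "(minv has_derivative (\<lambda>h. - h)) (at 0)"
proof -
  have m: "(minv has_derivative frechet_derivative minv (at 0)) (at 0)"
    using smooth_on_has_derivative[OF smooth_minv zero_in_inv_dom] .
  let ?L = "frechet_derivative mul (at (0, 0))"
  have mul: "(mul has_derivative ?L) (at (0, minv 0))"
    using mul_has_derivative mul_zero_right[OF zero_in_cdom] minv_zero by simp
  from has_derivative_compose[OF has_derivative_Pair[OF has_derivative_ident m] mul]
  have "((\<lambda>a. mul (a, minv a)) has_derivative (\<lambda>h. ?L (h, frechet_derivative minv (at 0) h))) (at 0)" .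
  then have "((\<lambda>a. 0) has_derivative (\<lambda>h. ?L (h, frechet_derivative minv (at 0) h))) (at (0::'e))"
    by (rule has_derivative_transform_within_open[OF _ open_inv_dom zero_in_inv_dom]) (simp add: mul_minv)
  from has_derivative_unique[OF this has_derivative_const]
  have "?L (h, frechet_derivative minv (at 0) h) = 0" for h by metis
  moreover have "?L (h, k) = h + k" for h k
    using linear_add[OF has_derivative_linear[OF mul], of "(h, 0)" "(0, k)"]
    by (simp add: mul_derivative_zero_left mul_derivative_zero_right)
  ultimately have "frechet_derivative minv (at 0) = (\<lambda>h. - h)"
    by (simp add: fun_eq_iff add_eq_0_iff)
  then show ?thesis using m by simp
qed

text \<open>The differential of left translation by \<open>q\<close> is the identity at
  \<open>q = 0\<close> and depends continuously on \<open>q\<close>, so it moves \<open>v\<close> by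
  less than \<open>norm v\<close>. The positivity keeps the covector pulled back from a nearest
  point from being zero.\<close>

lemma left_translation_nearly_identity:
  obtains \<rho> where "\<rho> > 0" "ball 0 \<rho> \<subseteq> cdom"
    "\<And>q v. q \<in> ball 0 \<rho> \<Longrightarrow> v \<noteq> 0 \<Longrightarrow> v \<bullet> frechet_derivative mul (at (q, 0)) (0, v) > 0"
proof -
  let ?L = "\<lambda>q v. frechet_derivative mul (at (q, 0)) (0, v)"
  \<comment> \<open>Dominates the operator norm of the differential minus the identity.\<close>
  define h where "h q = (\<Sum>i\<in>Basis. norm (?L q i - i))" for q
  have "continuous_on cdom h"
    unfolding h_def
    by (intro continuous_intros continuous_on_compose2[OF smooth_on_imp_continuous_on[OF
            smooth_on_frechet_derivative[OF smooth_mul]]]) (use mul_zero_right in auto)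
  then have "open (cdom \<inter> h -` {..<1})" by (rule continuous_open_preimage[OF _ open_cdom open_lessThan])
  moreover have "0 \<in> cdom \<inter> h -` {..<1}"
    using zero_in_cdom by (simp add: h_def mul_derivative_zero_left)
  ultimately obtain \<rho> where \<rho>: "\<rho> > 0" "ball 0 \<rho> \<subseteq> cdom \<inter> h -` {..<1}" using openE by blast
  have "v \<bullet> ?L q v > 0" if q: "q \<in> ball 0 \<rho>" and v: "v \<noteq> 0" for q v
  proof -
    have "linear (?L q)"
    proof -
      have "(mul has_derivative frechet_derivative mul (at (q, 0))) (at (q, 0))"
        using mul_has_derivative mul_zero_right q \<rho>(2) by blast
      from has_derivative_compose[OF has_derivative_Pair_const(1) this]
      show ?thesis by (rule has_derivative_linear)
    qed
    then have "?L q v - v = (\<Sum>i\<in>Basis. (v \<bullet> i) *\<^sub>R (?L q i - i))"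
      using linear_eq_sum_Basis[of "?L q" v] euclidean_representation[of v]
      by (simp add: scaleR_diff_right sum_subtractf)
    also have "norm \<dots> \<le> (\<Sum>i\<in>Basis. norm v * norm (?L q i - i))"
      by (intro sum_norm_le) (auto intro!: mult_right_mono Basis_le_norm)
    also have "\<dots> = norm v * h q" by (simp add: h_def sum_distrib_left)
    also have "\<dots> < norm v" using v q \<rho>(2) by auto
    finally have "norm v * norm (?L q v - v) < norm v * norm v" using v by simp
    then have "\<bar>v \<bullet> (?L q v - v)\<bar> < v \<bullet> v"
      using Cauchy_Schwarz_ineq2[of v "?L q v - v"] by (simp add: dot_square_norm power2_eq_square)
    then show ?thesis by (simp add: inner_diff_right)
  qed
  then show thesis using that \<rho> by blast
qed

text \<open>If \<open>p\<close> near \<open>0\<close> were not in \<open>N\<close>, then at a point \<open>q\<close> of \<open>N\<close> nearest to \<open>p\<close> the direction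
  \<open>p - q\<close>, pulled back to \<open>0\<close>, would be conormal to \<open>N\<close>.\<close>

lemma closed_subgroup_conormal_zero:
  assumes N: "subgroup N G" and cl: "closedin X N" and con: "\<And>z. z \<in> conormal N \<Longrightarrow> z = 0"
  obtains U where "openin X U" "\<one> \<in> U" "U \<subseteq> N"
proof -
  obtain \<rho> where \<rho>: "\<rho> > 0" "ball 0 \<rho> \<subseteq> cdom"
    "\<And>q v. q \<in> ball 0 \<rho> \<Longrightarrow> v \<noteq> 0 \<Longrightarrow> v \<bullet> frechet_derivative mul (at (q, 0)) (0, v) > 0"
    using left_translation_nearly_identity by metis
  \<comment> \<open>For \<open>norm p < r\<close> the nearest point satisfies
    \<open>norm q \<le> 2 * norm p < 2 * r\<close>. So \<open>q\<close> is interior to the ball of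
    radius \<open>2 * r\<close> in which the minimum is taken, and that ball still lies inside
    radius \<open>\<rho>\<close>.\<close>
  define r where "r = \<rho> / 3"
  have r: "r > 0" "cball 0 (2 * r) \<subseteq> ball (0::'e) \<rho>" using \<rho>(1) by (auto simp: r_def)
  have inN: "p \<in> chart_part N" if p: "p \<in> ball 0 r" for p
  proof (rule ccontr)
    assume pN: "p \<notin> chart_part N"
    let ?S = "chart_part N \<inter> cball 0 (2 * r)"
    \<comment> \<open>\<open>chart_part N\<close> is closed only relative to \<open>cdom\<close>;
      intersecting with a closed ball inside \<open>cdom\<close> removes the qualification.\<close>
    have "closed ?S"
    proof -
      have "closedin (top_of_set cdom) {a \<in> topspace (top_of_set cdom). par a \<in> N}"
        using closedin_continuous_map_preimage[OF cont_par cl] .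
      then have "closedin (top_of_set cdom) (chart_part N)" by (simp add: chart_part_def)
      then obtain C where C: "closed C" "chart_part N = cdom \<inter> C" by (metis closedin_closed)
      have "?S = C \<inter> cball 0 (2 * r)" using C r \<rho>(2) by blast
      then show ?thesis using C by (simp add: closed_Int)
    qed
    moreover have z: "0 \<in> ?S"
      using r(1) zero_in_cdom subgroup.one_closed[OF N] by (simp add: chart_part_def par_zero)
    ultimately obtain q where q: "q \<in> ?S" "\<And>y. y \<in> ?S \<Longrightarrow> dist p q \<le> dist p y"
      using distance_attains_inf[of ?S p] by blast
    have "norm q \<le> norm p + dist p q"
      using norm_triangle_ineq[of p "q - p"] by (simp add: dist_norm norm_minus_commute)
    moreover have "dist p q \<le> norm p" using q(2)[OF z] by simp
    ultimately have q2: "norm q < 2 * r" using p by simp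
    have qd: "q \<in> cdom" "q \<in> ball 0 \<rho>" using q r \<rho> by auto
    have pq: "p - q \<noteq> 0" using pN q(1) by auto
    define L where "L v = frechet_derivative mul (at (q, 0)) (0, v)" for v
    have Lder: "((\<lambda>b. mul (q, b)) has_derivative L) (at 0)"
      unfolding L_def
      by (rule has_derivative_compose[OF has_derivative_Pair_const(1)])
        (use mul_has_derivative mul_zero_right[OF qd(1)] in blast)
    then have linL: "linear L" using has_derivative_linear by blast
    \<comment> \<open>The direction \<open>p - q\<close> pulled back to \<open>0\<close> by the
      transpose of \<open>L\<close>.\<close>
    define z where "z = (\<Sum>i\<in>Basis. ((p - q) \<bullet> L i) *\<^sub>R i)"
    have zv: "z \<bullet> v = (p - q) \<bullet> L v" for v
      unfolding z_def
      by (simp add: linear_eq_sum_Basis[OF linL, of v] inner_sum_left inner_sum_right inner_commute mult.commute)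
    \<comment> \<open>The squared distance from \<open>p\<close> to the left translate by
      \<open>q\<close> of the point \<open>y\<close>. On \<open>N\<close> it is minimal at
      \<open>y = 0\<close>, which bounds z \<bullet> y on one side only; the inverse of
      \<open>y\<close> also lies in \<open>N\<close> and gives the other side.\<close>
    define g where "g y = (p - mul (q, y)) \<bullet> (p - mul (q, y))" for y
    have m0: "mul (q, 0) = q" using mul_zero_right[OF qd(1)] by blast
    have "(g has_derivative (\<lambda>v. (p - mul (q, 0)) \<bullet> (0 - L v) + (0 - L v) \<bullet> (p - mul (q, 0)))) (at 0)"
      unfolding g_def by (intro has_derivative_inner has_derivative_diff has_derivative_const Lder)
    moreover have "(\<lambda>v. (p - mul (q, 0)) \<bullet> (0 - L v) + (0 - L v) \<bullet> (p - mul (q, 0))) = (\<lambda>v. - (2 * (z \<bullet> v)))"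
    proof
      fix v
      show "(p - mul (q, 0)) \<bullet> (0 - L v) + (0 - L v) \<bullet> (p - mul (q, 0)) = - (2 * (z \<bullet> v))"
        by (simp add: zv m0 inner_commute[of "L v" "p - q"])
    qed
    ultimately have g: "(g has_derivative (\<lambda>v. - (2 * (z \<bullet> v)))) (at 0)" by simp
    then have "(g has_derivative (\<lambda>v. - (2 * (z \<bullet> v)))) (at (minv 0))" by (simp add: minv_zero)
    from has_derivative_compose[OF minv_has_derivative this]
    have gi: "((\<lambda>y. g (minv y)) has_derivative (\<lambda>v. 2 * (z \<bullet> v))) (at 0)" by simp
    define T where "T = {y. (q, y) \<in> mul_dom \<and> mul (q, y) \<in> ball 0 (2 * r)}"
    have Tim: "T = (\<lambda>y. (q, y)) -` (mul_dom \<inter> mul -` ball 0 (2 * r))" by (auto simp: T_def)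
    have "open (mul_dom \<inter> mul -` ball 0 (2 * r))"
      by (rule continuous_open_preimage[OF smooth_on_imp_continuous_on[OF smooth_mul] open_mul_dom open_ball])
    then have T: "open T"
      unfolding Tim by (rule open_vimage) (intro continuous_intros)
    have T0: "0 \<in> T" using mul_zero_right[OF qd(1)] q2 by (simp add: T_def)
    have qN: "par q \<in> N" using q(1) by (simp add: chart_part_def)
    have gmin: "g 0 \<le> g y" if y: "y \<in> chart_part N" "y \<in> T" for y
    proof -
      have yN: "par y \<in> N" using y by (simp add: chart_part_def)
      have "par (mul (q, y)) = par q \<otimes> par y" using par_mul[of "(q, y)"] y by (simp add: T_def)
      then have "mul (q, y) \<in> ?S"
        using y qN yN subgroup.m_closed[OF N] mul_in_cdom by (simp add: T_def chart_part_def)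
      then have "dist p q \<le> dist p (mul (q, y))" using q(2) by blast
      then show ?thesis
        unfolding g_def m0 by (simp add: dist_norm dot_square_norm power_mono)
    qed
    let ?T' = "T \<inter> (inv_dom \<inter> minv -` T)"
    have "open ?T'"
      using T continuous_open_preimage[OF smooth_on_imp_continuous_on[OF smooth_minv] open_inv_dom T] by blast
    moreover have "0 \<in> ?T'" using T0 zero_in_inv_dom minv_zero by simp
    moreover have "g 0 \<le> g y \<and> g (minv 0) \<le> g (minv y)" if y: "y \<in> chart_part N \<inter> ?T'" for y
    proof -
      have "minv y \<in> chart_part N"
        using y par_minv[of y] minv_in_cdom subgroup.m_inv_closed[OF N] by (simp add: chart_part_def)
      then show ?thesis using y gmin by (simp add: minv_zero)
    qed
    ultimately have "((\<lambda>v. 2 * (z \<bullet> v)) has_derivative (\<lambda>_. 0)) (at 0 within chart_part N)"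
      by (rule has_derivative_zero_within_of_minima[OF g gi])
    from has_derivative_mult_right[OF this, of "1/2"] have "z \<in> conormal N" by (simp add: conormal_def)
    then have "z = 0" by (rule con)
    \<comment> \<open>This number is also the inner product of \<open>p - q\<close> with
      \<open>L (p - q)\<close>, which is positive.\<close>
    then have "z \<bullet> (p - q) = 0" by simp
    then show False using \<rho>(3)[OF qd(2) pq] by (simp add: zv L_def)
  qed
  let ?U = "par ` ball 0 r"
  have "ball 0 r \<subseteq> cball (0::'e) (2 * r)" using r(1) by auto
  then have sub: "ball 0 r \<subseteq> cdom" using r(2) \<rho>(2) by blast
  have "openin X ?U" by (rule openin_par_image[OF open_ball sub])
  moreover have "\<one> \<in> ?U" using r(1) par_zero by (intro image_eqI[of _ _ 0]) auto
  moreover have "?U \<subseteq> N" using inN by (auto simp: chart_part_def)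
  ultimately show thesis using that by blast
qed

section \<open>The dichotomy for closed normal subgroups\<close>

lemma open_subgroup_eq_carrier:
  assumes conn: "connected_space X" and N: "subgroup N G"
    and U: "openin X U" "\<one> \<in> U" "U \<subseteq> N" and cl: "closedin X N"
  shows "N = carrier G"
proof -
  have "openin X N"
    unfolding openin_subopen[of X N]
  proof
    fix x assume x: "x \<in> N"
    then have xc: "x \<in> carrier G" using subgroup.mem_carrier[OF N] by blast
    let ?W = "{y \<in> topspace X. inv x \<otimes> y \<in> U}"
    have "continuous_map X X (\<lambda>y. inv x \<otimes> y)"
      using xc carrier_eq by (intro cont_mult2) auto
    then have "openin X ?W" using U(1) openin_continuous_map_preimage by blast
    moreover have "x \<in> ?W" using xc U(2) carrier_eq by simp
    moreover have "?W \<subseteq> N"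
    proof clarify
      fix y assume y: "y \<in> topspace X" "inv x \<otimes> y \<in> U"
      then have "x \<otimes> (inv x \<otimes> y) \<in> N" using U(3) x subgroup.m_closed[OF N] by blast
      then show "y \<in> N" using y(1) xc carrier_eq by (simp add: m_assoc[symmetric])
    qed
    ultimately show "\<exists>T. openin X T \<and> x \<in> T \<and> T \<subseteq> N" by blast
  qed
  then show ?thesis
    using conn cl subgroup.one_closed[OF N] carrier_eq unfolding connected_space_clopen_in by blast
qed

lemma closed_normal_subgroup_cases:
  assumes simple: "simple_lie_algebra (lie_algebra G X A)" and conn: "connected_space X"
    and N: "N \<lhd> G" and cl: "closedin X N" and neq: "N \<noteq> carrier G"
  obtains U where "openin X U" "\<one> \<in> U" "N \<inter> U = {\<one>}"
proof -
  have sub: "subgroup N G" using N by (simp add: normal_def)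
  consider "inv_field ` tangent N = {\<lambda>f x. 0}" | "inv_field ` tangent N = range inv_field"
    using simple lie_ideal_tangent[OF N] by (auto simp: simple_lie_algebra_def lie_algebra_eq)
  then show thesis
  proof cases
    case 1
    then have "tangent N \<subseteq> {0}" using inv_field_eq_zero by blast
    moreover have "0 \<in> tangent N" by (simp add: tangent_def)
    ultimately have "tangent N = {0}" by blast
    then show ?thesis
      using conormal_UNIV_imp_isolated tangent_zero_imp_conormal_UNIV subgroup.one_closed[OF sub] that by metis
  next
    case 2
    then have "tangent N = UNIV" using inv_field_inject by blast
    then have "\<And>z. z \<in> conormal N \<Longrightarrow> z = 0" using tangent_UNIV_imp_conormal_zero by blast
    then obtain U where "openin X U" "\<one> \<in> U" "U \<subseteq> N"
      using closed_subgroup_conormal_zero[OF sub cl] by blast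
    then show ?thesis using open_subgroup_eq_carrier[OF conn sub _ _ _ cl] neq by blast
  qed
qed

lemma no_commuting_neighbourhood:
  assumes simple: "simple_lie_algebra (lie_algebra G X A)" and U: "openin X U" "\<one> \<in> U"
  shows "\<exists>x\<in>U. \<exists>y\<in>U. x \<otimes> y \<noteq> y \<otimes> x"
proof (rule ccontr)
  assume "\<not> ?thesis"
  then have "ad w v = 0" for w v using commuting_neighbourhood_imp_ad_zero[OF U] by blast
  then have "lie_bracket (inv_field w) (inv_field v) = (\<lambda>f x. 0)" for w v
    by (simp add: lie_bracket_inv_field fun_eq_iff inv_field_zero_vec)
  then show False using simple by (auto simp: simple_lie_algebra_def lie_algebra_eq)
qed

end

section \<open>Normal generation and dense images\<close>

context group
begin

section \<open>Normal closures as sets of products of conjugates\<close>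

lemma conjugates_subset: "S \<subseteq> carrier G \<Longrightarrow> conjugates G S \<subseteq> carrier G"
  by (auto simp: conjugates_def)

lemma conjugates_conj_closed:
  assumes S: "S \<subseteq> carrier G" and c: "c \<in> conjugates G S" and g: "g \<in> carrier G"
  shows "g \<otimes> c \<otimes> inv g \<in> conjugates G S"
proof -
  obtain x s where xs: "c = x \<otimes> s \<otimes> inv x" "x \<in> carrier G" "s \<in> S \<union> (\<lambda>s. inv s) ` S"
    using c by (auto simp: conjugates_def)
  then have s: "s \<in> carrier G" using S by auto
  have "g \<otimes> c \<otimes> inv g = (g \<otimes> x) \<otimes> s \<otimes> inv (g \<otimes> x)"
    using xs s g by (simp add: m_assoc inv_mult_group)
  then show ?thesis unfolding conjugates_def using xs g by blast
qed

lemma conjugates_inv_closed: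
  assumes S: "S \<subseteq> carrier G" and c: "c \<in> conjugates G S"
  shows "inv c \<in> conjugates G S"
proof -
  obtain x s where xs: "c = x \<otimes> s \<otimes> inv x" "x \<in> carrier G" "s \<in> S \<union> (\<lambda>s. inv s) ` S"
    using c by (auto simp: conjugates_def)
  then have s: "s \<in> carrier G" using S by auto
  have "inv c = x \<otimes> inv s \<otimes> inv x" using xs s by (simp add: m_assoc inv_mult_group)
  moreover have "inv s \<in> S \<union> (\<lambda>s. inv s) ` S" using xs(3) S by auto
  ultimately show ?thesis unfolding conjugates_def using xs by blast
qed

lemma subset_conjugates:
  assumes "S \<subseteq> carrier G"
  shows "S \<subseteq> conjugates G S"
proof
  fix s assume s: "s \<in> S"
  then have "s = \<one> \<otimes> s \<otimes> inv \<one>" using assms by auto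
  then show "s \<in> conjugates G S" unfolding conjugates_def using s by blast
qed

lemma normal_generate_conjugates: "S \<subseteq> carrier G \<Longrightarrow> generate G (conjugates G S) \<lhd> G"
  by (rule normal_generateI[OF conjugates_subset conjugates_conj_closed])

lemma normal_closure_eq_generate:
  assumes S: "S \<subseteq> carrier G"
  shows "normal_closure G S = generate G (conjugates G S)"
proof
  have "S \<subseteq> generate G (conjugates G S)"
    using subset_conjugates[OF S] by (auto intro: generate.incl)
  then show "normal_closure G S \<subseteq> generate G (conjugates G S)"
    unfolding normal_closure_def using normal_generate_conjugates[OF S] by blast
  show "generate G (conjugates G S) \<subseteq> normal_closure G S"
    unfolding normal_closure_def
  proof (rule Inter_greatest, clarify)
    fix N x assume N: "N \<lhd> G" "S \<subseteq> N" and x: "x \<in> generate G (conjugates G S)"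
    have sub: "subgroup N G" using N by (simp add: normal_def)
    have "conjugates G S \<subseteq> N"
      using N(2) normal.inv_op_closed2[OF N(1)] subgroup.m_inv_closed[OF sub] by (auto simp: conjugates_def)
    then show "x \<in> N" using generate_subgroup_incl[OF _ sub] x by blast
  qed
qed

lemma foldr_mult_closed: "set xs \<subseteq> carrier G \<Longrightarrow> foldr (\<otimes>) xs \<one> \<in> carrier G"
  by (induction xs) auto

lemma foldr_mult_append:
  "set xs \<subseteq> carrier G \<Longrightarrow> set ys \<subseteq> carrier G \<Longrightarrow>
    foldr (\<otimes>) (xs @ ys) \<one> = foldr (\<otimes>) xs \<one> \<otimes> foldr (\<otimes>) ys \<one>"
  by (induction xs) (auto simp: foldr_mult_closed m_assoc simp del: foldr_append)

text \<open>\<open>conjugates\<close> is closed under inverses, so plain products of its elements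
  exhaust the generated subgroup.\<close>

lemma generate_conjugates_product:
  assumes S: "S \<subseteq> carrier G" and x: "x \<in> generate G (conjugates G S)"
  shows "\<exists>xs. set xs \<subseteq> conjugates G S \<and> x = foldr (\<otimes>) xs \<one>"
  using x
proof (induction rule: generate.induct)
  case one
  show ?case by (rule exI[of _ "[]"]) simp
next
  case (incl c)
  then show ?case using conjugates_subset[OF S] by (intro exI[of _ "[c]"]) auto
next
  case (inv c)
  then show ?case using conjugates_subset[OF S] conjugates_inv_closed[OF S]
    by (intro exI[of _ "[inv c]"]) auto
next
  case (eng x y)
  then obtain xs ys where "set xs \<subseteq> conjugates G S" "x = foldr (\<otimes>) xs \<one>"
    "set ys \<subseteq> conjugates G S" "y = foldr (\<otimes>) ys \<one>" by blast
  moreover from this have "x \<otimes> y = foldr (\<otimes>) (xs @ ys) \<one>"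
    using foldr_mult_append[of xs ys] conjugates_subset[OF S] by simp
  ultimately show ?case by (intro exI[of _ "xs @ ys"]) auto
qed

text \<open>Normal generation provides some factorisation, so the \<open>LEAST\<close> in
  \<open>conj_length\<close> is attained.\<close>

lemma conj_length_witness:
  assumes S: "normally_generates G S" and h: "h \<in> carrier G"
  obtains xs where "length xs = conj_length G S h" "set xs \<subseteq> conjugates G S" "h = foldr (\<otimes>) xs \<one>"
proof -
  have "S \<subseteq> carrier G" "h \<in> generate G (conjugates G S)"
    using S h normal_closure_eq_generate by (auto simp: normally_generates_def)
  from generate_conjugates_product[OF this]
  have "\<exists>n xs. length xs = n \<and> set xs \<subseteq> conjugates G S \<and> h = foldr (\<otimes>) xs \<one>" by blast
  from LeastI_ex[OF this] show thesis using that unfolding conj_length_def by blast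
qed

end

section \<open>Neighbourhoods of the identity and closures in the Lie group\<close>

lemma closure_of_meets_open: "x \<in> X closure_of K \<Longrightarrow> openin X T \<Longrightarrow> x \<in> T \<Longrightarrow> \<exists>k\<in>K. k \<in> T"
  by (auto simp: in_closure_of)

context lie_group_chart
begin

text \<open>Induction on \<open>n\<close> by continuity of multiplication at the pair of identities:
  the head of the list goes into one factor neighbourhood and the product of the tail into the
  other.\<close>

lemma small_products:
  assumes "openin X W" "\<one> \<in> W"
  shows "\<exists>U. openin X U \<and> \<one> \<in> U \<and> (\<forall>xs. length xs \<le> n \<and> set xs \<subseteq> U \<longrightarrow> foldr (\<otimes>) xs \<one> \<in> W)"
  using assms
proof (induction n arbitrary: W)
  case 0
  then show ?case by (intro exI[of _ W]) auto
next
  case (Suc n)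
  define Q where "Q = {p \<in> topspace (prod_topology X X). (case p of (x, y) \<Rightarrow> x \<otimes> y) \<in> W}"
  have "openin (prod_topology X X) Q"
    unfolding Q_def using openin_continuous_map_preimage[OF cont_mult Suc.prems(1)] .
  moreover have "(\<one>, \<one>) \<in> Q"
    using Suc.prems carrier_eq by (simp add: Q_def)
  ultimately have "\<exists>U1 U2. openin X U1 \<and> openin X U2 \<and> \<one> \<in> U1 \<and> \<one> \<in> U2 \<and> U1 \<times> U2 \<subseteq> Q"
    by (simp only: openin_prod_topology_alt)
  then obtain U1 U2 where U12: "openin X U1" "openin X U2" "\<one> \<in> U1" "\<one> \<in> U2" "U1 \<times> U2 \<subseteq> Q"
    by blast
  obtain U' where U': "openin X U'" "\<one> \<in> U'"
    "\<And>xs. length xs \<le> n \<Longrightarrow> set xs \<subseteq> U' \<Longrightarrow> foldr (\<otimes>) xs \<one> \<in> U2"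
    using Suc.IH[OF U12(2,4)] by blast
  show ?case
  proof (intro exI[of _ "U1 \<inter> U'"] conjI allI impI)
    show "openin X (U1 \<inter> U')" "\<one> \<in> U1 \<inter> U'" using U12 U' by auto
    fix xs assume xs: "length xs \<le> Suc n \<and> set xs \<subseteq> U1 \<inter> U'"
    show "foldr (\<otimes>) xs \<one> \<in> W"
    proof (cases xs)
      case Nil then show ?thesis using Suc.prems by simp
    next
      case (Cons y ys)
      then have "(y, foldr (\<otimes>) ys \<one>) \<in> U1 \<times> U2" using xs U'(3)[of ys] by auto
      then show ?thesis using U12(5) Cons by (auto simp: Q_def)
    qed
  qed
qed

text \<open>The pairs whose conjugate leaves \<open>U\<close> form a closed set, and projection
  along the compact factor is closed. The projected set avoids \<open>\<one>\<close>, since every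
  conjugate of \<open>\<one>\<close> is \<open>\<one>\<close>.\<close>

lemma small_conjugates:
  assumes comp: "compact_space X" and U: "openin X U" "\<one> \<in> U"
  shows "\<exists>W. openin X W \<and> \<one> \<in> W \<and> (\<forall>x\<in>W. \<forall>g\<in>carrier G. g \<otimes> x \<otimes> inv g \<in> U)"
proof -
  let ?P = "prod_topology X X"
  let ?c = "\<lambda>p. fst p \<otimes> snd p \<otimes> inv (fst p)"
  have "continuous_map ?P X ?c"
    by (intro cont_mult2 cont_inv2 continuous_map_fst continuous_map_snd)
  moreover have "closedin X (topspace X - U)" using U by blast
  ultimately have K: "closedin ?P {p \<in> topspace ?P. ?c p \<in> topspace X - U}" (is "closedin _ ?K")
    using closedin_continuous_map_preimage by blast
  have "closedin X (snd ` ?K)" using closed_map_snd[OF comp] K by (auto simp: closed_map_def)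
  then have "openin X (topspace X - snd ` ?K)" by blast
  moreover have "\<one> \<in> topspace X - snd ` ?K" using U carrier_eq by auto
  moreover have "g \<otimes> x \<otimes> inv g \<in> U" if x: "x \<in> topspace X - snd ` ?K" and g: "g \<in> carrier G" for x g
  proof (rule ccontr)
    assume "g \<otimes> x \<otimes> inv g \<notin> U"
    then have "(g, x) \<in> ?K" using x g carrier_eq by auto
    then have "x \<in> snd ` ?K" by force
    then show False using x by blast
  qed
  ultimately show ?thesis by blast
qed

text \<open>Conjugation maps \<open>K \<times> M\<close> into \<open>M\<close>, hence by continuity
  the product of the closures into the closure of \<open>M\<close>. Since \<open>K\<close> is dense,
  the first factor becomes the whole group.\<close>

lemma closure_of_normal_image:
  assumes K: "subgroup K G" and dense: "X closure_of K = carrier G" and M: "subgroup M G"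
    and conj: "\<And>g m. g \<in> K \<Longrightarrow> m \<in> M \<Longrightarrow> g \<otimes> m \<otimes> inv g \<in> M"
  shows "X closure_of M \<lhd> G"
proof -
  let ?N = "X closure_of M"
  have MN: "M \<subseteq> ?N" using closure_of_subset[of M X] subgroup.subset[OF M] carrier_eq by auto
  \<comment> \<open>Used with \<open>S = M\<close> for multiplication and with \<open>S = K\<close>
    for conjugation.\<close>
  have closed: "f (x, y) \<in> ?N"
    if f: "continuous_map (prod_topology X X) X f" and x: "x \<in> X closure_of S" and y: "y \<in> ?N"
      and SM: "\<And>s m. s \<in> S \<Longrightarrow> m \<in> M \<Longrightarrow> f (s, m) \<in> M" for f S x y
  proof -
    have "f (x, y) \<in> f ` (prod_topology X X closure_of (S \<times> M))"
      using x y by (auto simp: closure_of_Times)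
    also have "\<dots> \<subseteq> X closure_of (f ` (S \<times> M))"
      by (rule continuous_map_image_closure_subset[OF f])
    also have "\<dots> \<subseteq> ?N" by (rule closure_of_mono) (use SM in auto)
    finally show ?thesis .
  qed
  have sub: "subgroup ?N G"
  proof (rule subgroupI)
    show "?N \<subseteq> carrier G" using closure_of_subset_topspace[of X M] carrier_eq by auto
    show "?N \<noteq> {}" using MN subgroup.one_closed[OF M] by auto
    fix x assume x: "x \<in> ?N"
    have "inv x \<in> (\<lambda>x. inv x) ` ?N" using x by blast
    also have "\<dots> \<subseteq> X closure_of ((\<lambda>x. inv x) ` M)"
      by (rule continuous_map_image_closure_subset[OF cont_inv])
    also have "\<dots> \<subseteq> ?N" by (rule closure_of_mono) (use subgroup.m_inv_closed[OF M] in auto)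
    finally show "inv x \<in> ?N" .
    fix y assume y: "y \<in> ?N"
    show "x \<otimes> y \<in> ?N" using closed[OF cont_mult x y] subgroup.m_closed[OF M] by auto
  qed
  have c: "continuous_map (prod_topology X X) X (\<lambda>p. fst p \<otimes> snd p \<otimes> inv (fst p))"
    by (intro cont_mult2 cont_inv2 continuous_map_fst continuous_map_snd)
  have "g \<otimes> x \<otimes> inv g \<in> ?N" if "g \<in> carrier G" "x \<in> ?N" for g x
    using closed[OF c, of g K x] that dense conj by simp
  then show ?thesis using normal_inv_iff sub by blast
qed

text \<open>The commutator of \<open>g\<close> with \<open>x\<close> lies in \<open>N\<close>, so it
  is \<open>\<one>\<close> as soon as it lies in \<open>U\<close>. The centraliser of
  \<open>x\<close> is therefore open as well as closed, and connectedness makes it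
  everything.\<close>

lemma isolated_normal_imp_central:
  assumes conn: "connected_space X" and N: "N \<lhd> G" and U: "openin X U" "N \<inter> U = {\<one>}"
    and x: "x \<in> N" and g: "g \<in> carrier G"
  shows "g \<otimes> x = x \<otimes> g"
proof -
  have sub: "subgroup N G" using N by (simp add: normal_def)
  have xc: "x \<in> carrier G" using subgroup.mem_carrier[OF sub x] .
  let ?d = "\<lambda>g. g \<otimes> x \<otimes> inv g \<otimes> inv x"
  have d: "continuous_map X X ?d" using xc carrier_eq by (intro cont_mult2 cont_inv2) auto
  let ?C = "{g \<in> topspace X. ?d g \<in> U}" and ?E = "{g \<in> topspace X. ?d g = \<one>}"
  have dN: "?d g \<in> N" if "g \<in> topspace X" for g
    using that carrier_eq normal.inv_op_closed2[OF N _ x] subgroup.m_closed[OF sub] subgroup.m_inv_closed[OF sub x] by auto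
  have "?C = ?E" using dN U(2) by auto
  then have op: "openin X ?E" using openin_continuous_map_preimage[OF d U(1)] by simp
  have "closedin X {g \<in> topspace X. ?d g \<in> {\<one>}}"
    by (rule closedin_continuous_map_preimage[OF d])
      (simp add: closedin_Hausdorff_singleton Hausdorff carrier_eq)
  then have "closedin X ?E" by (simp only: singleton_iff)
  with op have "?E = {} \<or> ?E = topspace X"
    using conn unfolding connected_space_clopen_in by blast
  moreover have "\<one> \<in> ?E" using carrier_eq xc by simp
  ultimately have "?E = topspace X" by blast
  then have "?d g = \<one>" using g carrier_eq by auto
  then have "g \<otimes> x \<otimes> inv g = x" using g xc by (metis inv_closed inv_equality inv_inv m_closed)
  then show ?thesis using g xc by (metis inv_closed inv_solve_right m_closed)
qed

text \<open>Commuting with a fixed \<open>y\<close> is a closed condition. If all elements of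
  \<open>K\<close> in \<open>V'\<close> were central, density would make any two elements of
  \<open>V'\<close> commute.\<close>

lemma dense_noncentral_element:
  assumes simple: "simple_lie_algebra (lie_algebra G X A)"
    and dense: "X closure_of K = carrier G" and V': "openin X V'" "\<one> \<in> V'"
  shows "\<exists>x\<in>K \<inter> V'. \<exists>g\<in>carrier G. g \<otimes> x \<noteq> x \<otimes> g"
proof (rule ccontr)
  assume neg: "\<not> ?thesis"
  have "x \<otimes> y = y \<otimes> x" if x: "x \<in> V'" and y: "y \<in> V'" for x y
  proof (rule ccontr)
    assume ne: "x \<otimes> y \<noteq> y \<otimes> x"
    have c: "V' \<subseteq> topspace X" using V' openin_subset by blast
    have "closedin X {x \<in> topspace X. x \<otimes> y = y \<otimes> x}" (is "closedin X ?C")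
      by (rule closedin_continuous_maps_eq[OF Hausdorff])
        (use y c in \<open>auto intro!: cont_mult2\<close>)
    then have op: "openin X (V' - ?C)" by (rule openin_diff[OF V'(1)])
    have xC: "x \<in> V' - ?C" using x ne by simp
    have "x \<in> X closure_of K" using x c dense carrier_eq by auto
    from closure_of_meets_open[OF this op xC]
    obtain k where k: "k \<in> K" "k \<in> V' - ?C" by (elim bexE)
    have "k \<otimes> y \<noteq> y \<otimes> k" using k(2) c by blast
    then have "y \<otimes> k \<noteq> k \<otimes> y" by (rule not_sym)
    moreover have "k \<in> K \<inter> V'" "y \<in> carrier G" using k y c carrier_eq by auto
    ultimately show False using neg by blast
  qed
  then show False using no_commuting_neighbourhood[OF simple V'] by blast
qed

end

section \<open>Strong boundedness against density of the image\<close>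

theorem theorem1p6:
  fixes G :: "('g, 'm) monoid_scheme" and X :: "'g topology"
    and A :: "('g, 'e::euclidean_space) atlas"
    and H :: "('h, 'n) monoid_scheme" and \<phi> :: "'h \<Rightarrow> 'g"
  assumes "simple_lie_group G X A"
    and "compact_space X"
    and "group H"
    and "finitely_normally_generated H"
    and "\<phi> \<in> hom H G"
    and "X closure_of (\<phi> ` carrier H) = carrier G"
  shows "\<not> strongly_bounded H"
proof
  assume sb: "strongly_bounded H"
  have lie: "lie_group G X A" and conn: "connected_space X"
    and simple: "simple_lie_algebra (lie_algebra G X A)"
    using assms(1) by (auto simp: simple_lie_group_def)
  have grp: "group G" using lie by (simp add: lie_group_def)
  then interpret G: group G .
  interpret H: group H by fact
  have "smooth_atlas X A" "topspace X = carrier G" using lie by (auto simp: lie_group_def smooth_manifold_def)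
  then obtain V \<psi> where V: "(V, \<psi>) \<in> A" "\<one>\<^bsub>G\<^esub> \<in> V"
    using smooth_atlas_cover[of X A "\<one>\<^bsub>G\<^esub>"] G.one_closed by metis
  interpret lie_group_chart G X A V \<psi> by unfold_locales (use lie V in auto)
  interpret hom: group_hom H G \<phi> by unfold_locales (use assms(5) in auto)
  note dense = assms(6)
  obtain S where S: "finite S" "normally_generates H S"
    using assms(4) by (auto simp: finitely_normally_generated_def)
  define k where "k = Suc (card S)"
  have "Delta k H \<noteq> \<infinity>" using sb by (auto simp: strongly_bounded_def k_def)
  \<comment> \<open>\<open>n\<close> depends on \<open>k\<close> only, so the neighbourhoods below
    may be chosen in terms of \<open>n\<close>, and the generating set \<open>T\<close> after
    them.\<close>
  then obtain n :: nat where n: "Delta k H < ereal (real n)" using less_PInf_Ex_of_nat by blast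
  have bound: "conj_length H T h \<le> n"
    if "normally_generates H T" "finite T" "card T \<le> k" "h \<in> carrier H" for T h
  proof -
    have "ereal (real (conj_length H T h)) \<le> conj_diameter H T"
      unfolding conj_diameter_def using that(4) by (rule SUP_upper)
    also have "\<dots> \<le> Delta k H" unfolding Delta_def by (rule SUP_upper) (use that in auto)
    finally have "ereal (real (conj_length H T h)) < ereal (real n)" using n by (rule order_le_less_trans)
    then show ?thesis by simp
  qed
  \<comment> \<open>Any nontrivial element will do: the image of \<open>H\<close> will be confined
    to \<open>W\<close>, while density puts a point of it into \<open>W'\<close>.\<close>
  obtain g0 where g0: "g0 \<in> carrier G" "g0 \<noteq> \<one>\<^bsub>G\<^esub>"
    using no_commuting_neighbourhood[OF simple openin_topspace] carrier_eq by force
  then have "\<one>\<^bsub>G\<^esub> \<in> topspace X \<and> g0 \<in> topspace X \<and> \<one>\<^bsub>G\<^esub> \<noteq> g0" using carrier_eq by auto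
  from Hausdorff[unfolded Hausdorff_space_def, rule_format, OF this]
  obtain W W' where W: "openin X W" "openin X W'" "\<one>\<^bsub>G\<^esub> \<in> W" "g0 \<in> W'" "disjnt W W'"
    by (elim exE conjE)
  obtain U where U: "openin X U" "\<one>\<^bsub>G\<^esub> \<in> U"
    "\<forall>xs. length xs \<le> n \<and> set xs \<subseteq> U \<longrightarrow> foldr (\<otimes>\<^bsub>G\<^esub>) xs \<one>\<^bsub>G\<^esub> \<in> W"
    using small_products[OF W(1,3), of n] by (elim exE conjE)
  obtain B where B: "openin X B" "\<one>\<^bsub>G\<^esub> \<in> B"
    "\<forall>x\<in>B. \<forall>g\<in>carrier G. g \<otimes>\<^bsub>G\<^esub> x \<otimes>\<^bsub>G\<^esub> inv\<^bsub>G\<^esub> g \<in> U"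
    using small_conjugates[OF assms(2) U(1,2)] by (elim exE conjE)
  \<comment> \<open>\<open>conjugates\<close> also admits inverses of generators, so these have to
    lie in \<open>B\<close> too.\<close>
  define B' where "B' = B \<inter> {x \<in> topspace X. inv\<^bsub>G\<^esub> x \<in> B}"
  have B': "openin X B'" "\<one>\<^bsub>G\<^esub> \<in> B'"
    unfolding B'_def using B openin_continuous_map_preimage[OF cont_inv B(1)] carrier_eq by auto
  obtain h g where h: "h \<in> carrier H" "\<phi> h \<in> B'" and g: "g \<in> carrier G"
    "g \<otimes>\<^bsub>G\<^esub> \<phi> h \<noteq> \<phi> h \<otimes>\<^bsub>G\<^esub> g"
    using dense_noncentral_element[OF simple dense B'] by blast
  define M where "M = normal_closure H {h}"
  have M: "M \<lhd> H" and hM: "h \<in> M"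
    using h(1) H.normal_generate_conjugates[of "{h}"] H.normal_closure_eq_generate[of "{h}"]
      H.subset_conjugates[of "{h}"] by (auto simp: M_def intro: generate.incl)
  have subM: "subgroup M H" using M by (simp add: normal_def)
  let ?N = "X closure_of (\<phi> ` M)"
  have sG: "subgroup (\<phi> ` carrier H) G" "subgroup (\<phi> ` M) G"
    using hom.subgroup_img_is_subgroup[OF H.subgroup_self] hom.subgroup_img_is_subgroup[OF subM] by auto
  have N: "?N \<lhd> G"
  proof (rule closure_of_normal_image[OF sG(1) dense sG(2)])
    fix a m assume "a \<in> \<phi> ` carrier H" "m \<in> \<phi> ` M"
    then obtain a' m' where am: "a' \<in> carrier H" "m' \<in> M" "a = \<phi> a'" "m = \<phi> m'" by blast
    then have "a \<otimes>\<^bsub>G\<^esub> m \<otimes>\<^bsub>G\<^esub> inv\<^bsub>G\<^esub> a = \<phi> (a' \<otimes>\<^bsub>H\<^esub> m' \<otimes>\<^bsub>H\<^esub> inv\<^bsub>H\<^esub> a')"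
      using subgroup.mem_carrier[OF subM] by simp
    then show "a \<otimes>\<^bsub>G\<^esub> m \<otimes>\<^bsub>G\<^esub> inv\<^bsub>G\<^esub> a \<in> \<phi> ` M"
      using normal.inv_op_closed2[OF M] am by simp
  qed
  have "\<phi> h \<in> ?N"
    using hM closure_of_subset[of "\<phi> ` M" X] subgroup.subset[OF sG(2)] carrier_eq by auto
  then have "?N = carrier G"
    using closed_normal_subgroup_cases[OF simple conn N closedin_closure_of]
      isolated_normal_imp_central[OF conn N _ _ _ g(1)] g(2) by metis
  have "\<exists>m\<in>M. \<phi> (s \<otimes>\<^bsub>H\<^esub> m) \<in> B'" if s: "s \<in> S" for s
  proof -
    have sH: "s \<in> carrier H" using s S(2) by (auto simp: normally_generates_def)
    have "continuous_map X X (\<lambda>y. \<phi> s \<otimes>\<^bsub>G\<^esub> y)"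
      using sH carrier_eq by (intro cont_mult2) auto
    then have op: "openin X {y \<in> topspace X. \<phi> s \<otimes>\<^bsub>G\<^esub> y \<in> B'}"
      by (rule openin_continuous_map_preimage[OF _ B'(1)])
    \<comment> \<open>At this point of the closure of the image of \<open>M\<close> the translate by
      \<open>\<phi> s\<close> takes the value \<open>\<one>\<close>, so some nearby
      \<open>\<phi> m\<close> is carried into \<open>B'\<close>.\<close>
    have mem: "inv\<^bsub>G\<^esub> (\<phi> s) \<in> {y \<in> topspace X. \<phi> s \<otimes>\<^bsub>G\<^esub> y \<in> B'}"
      using sH carrier_eq B'(2) by simp
    have "inv\<^bsub>G\<^esub> (\<phi> s) \<in> ?N" using sH \<open>?N = carrier G\<close> by simp
    from closure_of_meets_open[OF this op mem]
    have "\<exists>y\<in>\<phi> ` M. \<phi> s \<otimes>\<^bsub>G\<^esub> y \<in> B'" by blast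
    then show ?thesis using sH subgroup.mem_carrier[OF subM] by auto
  qed
  then obtain m where m: "\<And>s. s \<in> S \<Longrightarrow> m s \<in> M \<and> \<phi> (s \<otimes>\<^bsub>H\<^esub> m s) \<in> B'" by metis
  define T where "T = insert h ((\<lambda>s. s \<otimes>\<^bsub>H\<^esub> m s) ` S)"
  have SH: "S \<subseteq> carrier H" using S(2) by (simp add: normally_generates_def)
  have TH: "T \<subseteq> carrier H" using h(1) SH m subgroup.mem_carrier[OF subM] by (auto simp: T_def)
  have "finite T" using S(1) by (simp add: T_def)
  moreover have "card T \<le> k"
  proof -
    have "card T \<le> Suc (card ((\<lambda>s. s \<otimes>\<^bsub>H\<^esub> m s) ` S))" unfolding T_def by (rule card_insert_le_m1) auto
    also have "\<dots> \<le> k" using card_image_le[OF S(1)] by (simp add: k_def)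
    finally show ?thesis .
  qed
  moreover have T: "normally_generates H T"
    unfolding normally_generates_def
  proof (intro conjI TH equalityI)
    show "normal_closure H T \<subseteq> carrier H"
      using H.normal_closure_eq_generate[OF TH] H.generate_incl[OF H.conjugates_subset[OF TH]] by simp
    show "carrier H \<subseteq> normal_closure H T"
      unfolding normal_closure_def
    proof (rule Inter_greatest, clarify)
      fix P x assume P: "P \<lhd> H" "T \<subseteq> P" and x: "x \<in> carrier H"
      have subP: "subgroup P H" using P by (simp add: normal_def)
      \<comment> \<open>\<open>P\<close> contains \<open>h\<close>, hence all of \<open>M\<close>
        and every correction \<open>m s\<close>, so each \<open>s\<close> can be recovered from its
        corrected version.\<close>
      have "M \<subseteq> P" unfolding M_def normal_closure_def using P by (auto simp: T_def)
      have "s \<in> P" if s: "s \<in> S" for s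
      proof -
        have "s \<otimes>\<^bsub>H\<^esub> m s \<in> P" "m s \<in> P" using P(2) s m \<open>M \<subseteq> P\<close> by (auto simp: T_def)
        then have "s \<otimes>\<^bsub>H\<^esub> m s \<otimes>\<^bsub>H\<^esub> inv\<^bsub>H\<^esub> (m s) \<in> P"
          using subgroup.m_closed[OF subP] subgroup.m_inv_closed[OF subP] by blast
        then show ?thesis
          using s SH m subgroup.mem_carrier[OF subM] by (simp add: H.m_assoc subset_iff)
      qed
      then have "normal_closure H S \<subseteq> P" unfolding normal_closure_def using P(1) by blast
      then show "x \<in> P" using S(2) x by (auto simp: normally_generates_def)
    qed
  qed
  ultimately have len: "conj_length H T x \<le> n" if "x \<in> carrier H" for x using bound that by blast
  have TB: "\<phi> t \<in> B'" if "t \<in> T" for t using that h m by (auto simp: T_def)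
  have cU: "\<phi> c \<in> U" if c: "c \<in> conjugates H T" for c
  proof -
    obtain x s where xs: "c = x \<otimes>\<^bsub>H\<^esub> s \<otimes>\<^bsub>H\<^esub> inv\<^bsub>H\<^esub> x" "x \<in> carrier H"
      "s \<in> T \<union> (\<lambda>s. inv\<^bsub>H\<^esub> s) ` T" using c by (auto simp: conjugates_def)
    then have s: "s \<in> carrier H" "\<phi> s \<in> B"
      using TH TB by (auto simp: B'_def subset_iff)
    have "\<phi> c = \<phi> x \<otimes>\<^bsub>G\<^esub> \<phi> s \<otimes>\<^bsub>G\<^esub> inv\<^bsub>G\<^esub> (\<phi> x)" using xs s by simp
    then show ?thesis using B(3) s xs by simp
  qed
  have "\<phi> x \<in> W" if x: "x \<in> carrier H" for x
  proof -
    obtain xs where xs: "length xs = conj_length H T x" "set xs \<subseteq> conjugates H T"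
      "x = foldr (\<otimes>\<^bsub>H\<^esub>) xs \<one>\<^bsub>H\<^esub>" using H.conj_length_witness[OF T x] by blast
    have "\<phi> (foldr (\<otimes>\<^bsub>H\<^esub>) ys \<one>\<^bsub>H\<^esub>) = foldr (\<otimes>\<^bsub>G\<^esub>) (map \<phi> ys) \<one>\<^bsub>G\<^esub>" if "set ys \<subseteq> carrier H" for ys
      using that by (induction ys) (auto simp: H.foldr_mult_closed)
    then have "\<phi> x = foldr (\<otimes>\<^bsub>G\<^esub>) (map \<phi> xs) \<one>\<^bsub>G\<^esub>"
      using xs(2,3) H.conjugates_subset[OF TH] by auto
    moreover have "foldr (\<otimes>\<^bsub>G\<^esub>) (map \<phi> xs) \<one>\<^bsub>G\<^esub> \<in> W"
      using xs len[OF x] cU by (intro U(3)[rule_format]) auto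
    ultimately show ?thesis by simp
  qed
  moreover have "\<exists>y\<in>\<phi> ` carrier H. y \<in> W'"
    by (rule closure_of_meets_open[OF _ W(2,4)]) (simp add: g0(1) dense)
  ultimately show False using W(5) by (auto simp: disjnt_iff)
qed

end
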